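(* For $\psi\in \mathrm{Diff}(S^1)$ let $\Phi(\psi)$ be the linear map on $H$ given by $\Phi(\psi)u=\psi.u$, where $(\psi.u)(\theta)=u(\psi^{-1}(\theta))-\frac{1}{2\pi}\int_0^{2\pi}u(\psi^{-1}(\theta))\,d\theta$. Then $\Phi(\psi)\in \mathrm{Sp}(\infty)$ for every $\psi\in\mathrm{Diff}(S^1)$, and $\Phi:\mathrm{Diff}(S^1)\to \mathrm{Sp}(\infty)$ is a group homomorphism. Moreover, $\Phi$ is injective, but not surjective.
   Context: $\mathrm{Diff}(S^1)$ is the group (under composition) of orientation preserving $C^\infty$ diffeomorphisms of the unit circle $S^1$. $H$ is the space of complex-valued $C^\infty$ functions on $S^1$ with mean value $0$. On $H$, $\omega(u,v)=\frac{1}{2\pi}\int_0^{2\pi}uv'\,d\theta$. $J$ is the linear map with $Je^{in\theta}=i\,\mathrm{sgn}(n)e^{in\theta}$ ($n\neq 0$), and $(u,v)_\omega=-\omega(u,J\bar v)=\sum_{n\ne0}|n|\hat u(n)\overline{\hat v(n)}$, where $\hat u(n)=\frac1{2\pi}\int_0^{2\pi}u e^{-in\theta}d\theta$; this is an inner product on $H$ with norm $\|\cdot\|_\omega$, and $\mathbb{H}_\omega$ is the completion of $H$ in this norm. $\pi^+$ and $\pi^-$ are the projections of $\mathbb{H}_\omega$ onto the closed spans of $\{e^{in\theta}:n>0\}$ and $\{e^{in\theta}:n<0\}$. A linear map on $H$ is called bounded if it is bounded for $\|\cdot\|_\omega$; it then extends to a bounded operator on $\mathbb{H}_\omega$. The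 conjugate $\bar A$ of an operator $A$ is $\bar A u=\overline{A\bar u}$. For a bounded operator $A$, $\|A\|_2$ denotes the Hilbert-Schmidt norm of $\pi^+A\pi^-$. $\mathrm{Sp}(\infty)$ is the group (under composition) of bounded linear maps $A:H\to H$ such that (1) $A$ is invertible (as a map of $H$); (2) $A=\bar A$; (3) $\omega(Au,Av)=\omega(u,v)$ for all $u,v\in H$; (4) $\|A\|_2<\infty$. *)

theory Defs
  imports "HOL-Analysis.Analysis" "HOL-Algebra.Bij"
begin

typedef circle = "sphere (0::complex) 1"
  morphisms of_circle to_circle
  by (rule exI[of _ 1]) simp

definition pt :: "real \<Rightarrow> circle" where
  "pt \<theta> = to_circle (cis \<theta>)"

text \<open>The sequence \<open>g\<close> lists the derivatives of \<open>f\<close> of all orders.\<close>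

definition smooth :: "(real \<Rightarrow> complex) \<Rightarrow> bool" where
  "smooth f \<longleftrightarrow> (\<exists>g. g 0 = f \<and>
     (\<forall>k t. (g k has_vector_derivative g (Suc k) t) (at t)))"

definition smooth_circle_fun :: "(circle \<Rightarrow> complex) \<Rightarrow> bool" where
  "smooth_circle_fun u \<longleftrightarrow> smooth (\<lambda>\<theta>. u (pt \<theta>))"

definition smooth_circle_map :: "(circle \<Rightarrow> circle) \<Rightarrow> bool" where
  "smooth_circle_map \<psi> \<longleftrightarrow> smooth (\<lambda>\<theta>. of_circle (\<psi> (pt \<theta>)))"

text \<open>
  If locally \<open>\<psi>(exp(i\<theta>)) = exp(i f(\<theta>))\<close> with \<open>f\<close> real, then the quotient below equals \<open>i f'(\<theta>)\<close>,
  so the condition says that \<open>\<psi>\<close> maps the positive tangent direction to the positive one.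
\<close>

definition orientation_preserving :: "(circle \<Rightarrow> circle) \<Rightarrow> bool" where
  "orientation_preserving \<psi> \<longleftrightarrow>
     (\<forall>\<theta>. Im (vector_derivative (\<lambda>t. of_circle (\<psi> (pt t))) (at \<theta>) / of_circle (\<psi> (pt \<theta>))) > 0)"

definition Diff_S1 :: "(circle \<Rightarrow> circle) monoid" where
  "Diff_S1 = \<lparr>carrier = {\<psi>. bij \<psi> \<and> smooth_circle_map \<psi> \<and>
                  smooth_circle_map (inv_into UNIV \<psi>) \<and> orientation_preserving \<psi>},
              mult = (\<circ>), one = id\<rparr>"

definition mean :: "(circle \<Rightarrow> complex) \<Rightarrow> complex" where
  "mean u = 1 / (2 * of_real pi) * integral {0..2 * pi} (\<lambda>\<theta>. u (pt \<theta>))"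

definition H_S1 :: "(circle \<Rightarrow> complex) set" where
  "H_S1 = {u. smooth_circle_fun u \<and> mean u = 0}"

definition omega :: "(circle \<Rightarrow> complex) \<Rightarrow> (circle \<Rightarrow> complex) \<Rightarrow> complex" where
  "omega u v = 1 / (2 * of_real pi) *
     integral {0..2 * pi} (\<lambda>\<theta>. u (pt \<theta>) * vector_derivative (\<lambda>t. v (pt t)) (at \<theta>))"

definition fourier :: "(circle \<Rightarrow> complex) \<Rightarrow> int \<Rightarrow> complex" where
  "fourier u n = 1 / (2 * of_real pi) *
     integral {0..2 * pi} (\<lambda>\<theta>. u (pt \<theta>) * cis (- (of_int n * \<theta>)))"

text \<open>
  The completion of \<open>H_S1\<close> for the inner product \<open>(u, v) = (\<Sum>n\<noteq>0. \<bar>n\<bar> * fourier u n * cnj (fourier v n))\<close>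
  is realised as the space of Fourier coefficient sequences, with \<open>fourier\<close> as the dense
  isometric embedding of \<open>H_S1\<close>.
\<close>

definition H_omega :: "(int \<Rightarrow> complex) set" where
  "H_omega = {a. a 0 = 0 \<and> (\<lambda>n. real_of_int \<bar>n\<bar> * (cmod (a n))\<^sup>2) summable_on UNIV}"

definition norm_H_omega :: "(int \<Rightarrow> complex) \<Rightarrow> real" where
  "norm_H_omega a = sqrt (\<Sum>\<^sub>\<infinity>n. real_of_int \<bar>n\<bar> * (cmod (a n))\<^sup>2)"

definition norm_omega :: "(circle \<Rightarrow> complex) \<Rightarrow> real" where
  "norm_omega u = norm_H_omega (fourier u)"

definition proj_pos :: "(int \<Rightarrow> complex) \<Rightarrow> (int \<Rightarrow> complex)" where
  "proj_pos a = (\<lambda>n. if n > 0 then a n else 0)"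

definition proj_neg :: "(int \<Rightarrow> complex) \<Rightarrow> (int \<Rightarrow> complex)" where
  "proj_neg a = (\<lambda>n. if n < 0 then a n else 0)"

definition linear_on_H :: "((circle \<Rightarrow> complex) \<Rightarrow> (circle \<Rightarrow> complex)) \<Rightarrow> bool" where
  "linear_on_H A \<longleftrightarrow>
     (\<forall>u\<in>H_S1. \<forall>v\<in>H_S1. A (\<lambda>z. u z + v z) = (\<lambda>z. A u z + A v z)) \<and>
     (\<forall>c. \<forall>u\<in>H_S1. A (\<lambda>z. c * u z) = (\<lambda>z. c * A u z))"

definition bounded_on_H :: "((circle \<Rightarrow> complex) \<Rightarrow> (circle \<Rightarrow> complex)) \<Rightarrow> bool" where
  "bounded_on_H A \<longleftrightarrow> (\<exists>C. \<forall>u\<in>H_S1. norm_omega (A u) \<le> C * norm_omega u)"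

definition conj_op ::
  "((circle \<Rightarrow> complex) \<Rightarrow> (circle \<Rightarrow> complex)) \<Rightarrow> (circle \<Rightarrow> complex) \<Rightarrow> (circle \<Rightarrow> complex)" where
  "conj_op A u = (\<lambda>z. cnj (A (\<lambda>w. cnj (u w)) z))"

definition trig_partial :: "(int \<Rightarrow> complex) \<Rightarrow> nat \<Rightarrow> circle \<Rightarrow> complex" where
  "trig_partial a N = (\<lambda>z. \<Sum>n\<in>{- int N..int N}. a n * of_circle z powi n)"

text \<open>
  The trigonometric polynomials \<open>trig_partial a N\<close> lie in \<open>H_S1\<close> and converge to \<open>a\<close> in the completion,
  and every Fourier coefficient is continuous there. So for a bounded linear map \<open>A\<close> on \<open>H_S1\<close>
  the following is the unique continuous extension of \<open>A\<close>.
\<close>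

definition extension ::
  "((circle \<Rightarrow> complex) \<Rightarrow> (circle \<Rightarrow> complex)) \<Rightarrow> (int \<Rightarrow> complex) \<Rightarrow> (int \<Rightarrow> complex)" where
  "extension A = (\<lambda>a\<in>H_omega. \<lambda>m. lim (\<lambda>N. fourier (A (trig_partial a N)) m))"

text \<open>
  The vectors \<open>exp(ik\<theta>) / sqrt \<bar>k\<bar>\<close>, \<open>k \<noteq> 0\<close>, form an orthonormal basis of the completion, and the
  squared Hilbert-Schmidt norm of \<open>T\<close> is the sum of the squared norms of their images.
\<close>

definition basis_vec :: "int \<Rightarrow> int \<Rightarrow> complex" where
  "basis_vec k = (\<lambda>n. if n = k then of_real (1 / sqrt (of_int \<bar>k\<bar>)) else 0)"

definition hilbert_schmidt :: "((int \<Rightarrow> complex) \<Rightarrow> (int \<Rightarrow> complex)) \<Rightarrow> bool" where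
  "hilbert_schmidt T \<longleftrightarrow> (\<lambda>k. (norm_H_omega (T (basis_vec k)))\<^sup>2) summable_on (- {0})"

text \<open>
  Membership in \<^term>\<open>Bij H_S1\<close> says that \<open>A\<close> is a bijection of \<open>H_S1\<close> onto itself
  (and is \<^term>\<open>undefined\<close> outside \<open>H_S1\<close>).
\<close>

definition Sp_infinity :: "((circle \<Rightarrow> complex) \<Rightarrow> (circle \<Rightarrow> complex)) monoid" where
  "Sp_infinity = (BijGroup H_S1)\<lparr>carrier := {A \<in> Bij H_S1.
      linear_on_H A \<and> bounded_on_H A \<and>
      (\<forall>u\<in>H_S1. A u = conj_op A u) \<and>
      (\<forall>u\<in>H_S1. \<forall>v\<in>H_S1. omega (A u) (A v) = omega u v) \<and>
      hilbert_schmidt (\<lambda>a. proj_pos (extension A (proj_neg a)))}\<rparr>"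

definition Phi :: "(circle \<Rightarrow> circle) \<Rightarrow> (circle \<Rightarrow> complex) \<Rightarrow> (circle \<Rightarrow> complex)" where
  "Phi \<psi> = (\<lambda>u\<in>H_S1. \<lambda>z. u (inv_into UNIV \<psi> z) - mean (\<lambda>w. u (inv_into UNIV \<psi> w)))"

end

theory Submission imports Defs begin

text \<open>
  Composition with a diffeomorphism preserves the form \<open>\<integral> u dv\<close> by the substitution rule, and the
  subtracted mean contributes nothing because a derivative has mean zero. The compatibility of
  \<open>Phi\<close> with composition, inverses and conjugation is a direct computation. What needs an argument is
  that \<open>Phi \<psi>\<close> is bounded for the norm \<open>\<Sum> \<bar>n\<bar> \<bar>u\<^sub>n\<bar>\<^sup>2\<close> and has a Hilbert-Schmidt block
  \<open>\<pi>\<^sup>+ A \<pi>\<^sup>-\<close>, and that these two properties define a group.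

  The Hilbert-Schmidt property comes first (\<open>pullback_HS_bounded\<close>). If \<open>\<phi>\<close> is a lift of the inverse
  diffeomorphism to the line, the matrix entry in row \<open>m > 0\<close> and column \<open>k < 0\<close> is an oscillatory
  integral with phase \<open>k \<phi>(t) - m t\<close>. Since \<open>\<phi>' > 0\<close>, both terms of its derivative are negative and
  it is at least a constant times \<open>\<bar>k\<bar> + m\<close> in modulus. Two integrations by parts therefore bound the
  entry by \<open>C / (\<bar>k\<bar> + m)\<^sup>2\<close> (\<open>nonstationary_phase\<close>), and this is square summable with the weight
  \<open>m / \<bar>k\<bar>\<close>.

  Boundedness then follows formally (\<open>HS_bounded_imp_bounded_trig_partial\<close>). The number
  \<open>\<i> \<omega>(u, cnj u) = \<Sum> n \<bar>u\<^sub>n\<bar>\<^sup>2\<close> is the energy of the positive frequencies minus that of the negative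
  ones, and a real symplectic operator preserves it. For \<open>u\<close> with negative frequencies only, the
  Hilbert-Schmidt block controls the positive part of \<open>A u\<close>, hence the conserved difference controls
  the negative part as well. Conjugation gives the same for positive frequencies. This works for
  trigonometric polynomials, and uniform convergence of Fourier series extends it to all of \<open>H_S1\<close>.

  For the group structure, the inverse of a symplectic operator is its adjoint for \<open>\<omega>\<close>. Duality makes
  it bounded, and its matrix is a reflected transpose of the original one, which maps the block
  \<open>m > 0 > k\<close> to itself. For a product, \<open>\<pi>\<^sup>+ A B \<pi>\<^sup>-\<close> is the sum of \<open>(\<pi>\<^sup>+ A) (\<pi>\<^sup>+ B \<pi>\<^sup>-)\<close> and
  \<open>(\<pi>\<^sup>+ A \<pi>\<^sup>-) (B \<pi>\<^sup>-)\<close>; the first is handled by boundedness of \<open>A\<close>, and the second becomes a term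
  of the first kind after passing to the inverses (\<open>HS_bounded_compose\<close>).

  Finally, \<open>Phi \<psi>\<close> determines the inverse of \<open>\<psi>\<close> up to a translation of the plane, and the only
  translation that maps the unit circle into itself is the identity. The operator \<open>- id\<close> lies in the
  group but not in the image: acting on \<open>z\<close> it would force the diffeomorphism to be \<open>z \<mapsto> - z\<close>, which
  fixes \<open>z\<^sup>2\<close>.
\<close>

section \<open>Smooth functions of a real variable\<close>

text \<open>
  The derivatives are recorded order by order instead of as one sequence, so that closure under
  products and compositions can be proved by induction on the order.
\<close>

primrec diff_times :: "nat \<Rightarrow> (real \<Rightarrow> 'a::real_normed_vector) \<Rightarrow> bool" where
  "diff_times 0 f \<longleftrightarrow> True"
| "diff_times (Suc k) f \<longleftrightarrow>
     (\<exists>f'. (\<forall>t. (f has_vector_derivative f' t) (at t)) \<and> diff_times k f')"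

abbreviation inf_diff :: "(real \<Rightarrow> 'a::real_normed_vector) \<Rightarrow> bool" where
  "inf_diff f \<equiv> \<forall>k. diff_times k f"

lemma inf_diff_vector_derivative:
  assumes "inf_diff f"
  shows "(f has_vector_derivative vector_derivative f (at t)) (at t)"
    and "inf_diff (\<lambda>t. vector_derivative f (at t))"
proof -
  have "diff_times (Suc 0) f" using assms by blast
  then show "(f has_vector_derivative vector_derivative f (at t)) (at t)"
    by (auto simp: vector_derivative_works[symmetric] intro: differentiableI_vector)
  show "inf_diff (\<lambda>t. vector_derivative f (at t))"
  proof
    fix k
    have "diff_times (Suc k) f" using assms by blast
    then obtain f' where f': "\<And>t. (f has_vector_derivative f' t) (at t)" "diff_times k f'"
      by auto
    then have "(\<lambda>t. vector_derivative f (at t)) = f'"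
      by (auto intro: vector_derivative_at)
    then show "diff_times k (\<lambda>t. vector_derivative f (at t))" using f' by simp
  qed
qed

lemma inf_diff_derivI:
  assumes "\<And>t. (f has_vector_derivative f' t) (at t)" "inf_diff f'"
  shows "inf_diff f"
proof
  fix k show "diff_times k f" using assms by (cases k) auto
qed

lemma smooth_iff_inf_diff: "smooth f \<longleftrightarrow> inf_diff f"
proof
  assume "smooth f"
  then obtain g where g: "g 0 = f" "\<And>k t. (g k has_vector_derivative g (Suc k) t) (at t)"
    unfolding smooth_def by blast
  have "diff_times k (g j)" for k j
    by (induction k arbitrary: j) (use g in auto)
  then show "inf_diff f" using g by metis
next
  assume f: "inf_diff f"
  define g where "g k = ((\<lambda>h t. vector_derivative h (at t)) ^^ k) f" for k
  have g: "inf_diff (g k)" for k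

  proof (induction k)
    case (Suc k)
    have "g (Suc k) = (\<lambda>t. vector_derivative (g k) (at t))" by (simp add: g_def)
    then show ?case using inf_diff_vector_derivative(2)[OF Suc] by simp
  qed (use f in \<open>simp add: g_def\<close>)
  show "smooth f" unfolding smooth_def
    by (rule exI[of _ g]) (use inf_diff_vector_derivative(1)[OF g] in \<open>auto simp: g_def\<close>)
qed

lemma diff_times_SucI:
  "(\<And>t. (f has_vector_derivative f' t) (at t)) \<Longrightarrow> diff_times k f' \<Longrightarrow> diff_times (Suc k) f"
  by auto

lemma diff_times_Suc_imp: "diff_times (Suc k) f \<Longrightarrow> diff_times k f"
  by (induction k arbitrary: f) auto

lemma diff_times_const: "diff_times k (\<lambda>t. c)"
proof (induction k arbitrary: c)
  case (Suc k)
  show ?case using Suc[of 0] by (auto intro!: exI[of _ "\<lambda>_. 0"])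
qed simp

lemma diff_times_ident: "diff_times k (\<lambda>t::real. t)"
  by (cases k) (auto intro!: exI[of _ "\<lambda>_. 1"] diff_times_const)

lemma diff_times_add:
  "diff_times k f \<Longrightarrow> diff_times k g \<Longrightarrow> diff_times k (\<lambda>t. f t + g t)"
proof (induction k arbitrary: f g)
  case (Suc k)
  then obtain f' g' where "\<And>t. (f has_vector_derivative f' t) (at t)" "diff_times k f'"
     "\<And>t. (g has_vector_derivative g' t) (at t)" "diff_times k g'" by auto
  then show ?case using Suc.IH
    by (auto intro!: exI[of _ "\<lambda>t. f' t + g' t"] derivative_intros)
qed simp

lemma diff_times_linear:
  assumes "bounded_linear L"
  shows "diff_times k f \<Longrightarrow> diff_times k (\<lambda>t. L (f t))"
proof (induction k arbitrary: f)
  case (Suc k)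
  then obtain f' where "\<And>t. (f has_vector_derivative f' t) (at t)" "diff_times k f'" by auto
  then show ?case using Suc.IH
    by (auto intro!: exI[of _ "\<lambda>t. L (f' t)"] bounded_linear.has_vector_derivative[OF assms])
qed simp

lemma diff_times_bilinear:
  assumes "bounded_bilinear B"
  shows "diff_times k f \<Longrightarrow> diff_times k g \<Longrightarrow> diff_times k (\<lambda>t. B (f t) (g t))"
proof (induction k arbitrary: f g)
  case (Suc k)
  then obtain f' g' where d: "\<And>t. (f has_vector_derivative f' t) (at t)" "diff_times k f'"
     "\<And>t. (g has_vector_derivative g' t) (at t)" "diff_times k g'" by auto
  have "diff_times k f" "diff_times k g" using Suc.prems diff_times_Suc_imp by blast+
  then have "diff_times k (\<lambda>t. B (f t) (g' t) + B (f' t) (g t))"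
    using d Suc.IH by (intro diff_times_add) auto
  with bounded_bilinear.has_vector_derivative[OF assms d(1) d(3)] show ?case
    by (rule diff_times_SucI)
qed simp

lemmas diff_times_mult = diff_times_bilinear[OF bounded_bilinear_mult]

lemma diff_times_cmult:
  fixes f :: "real \<Rightarrow> 'a::real_normed_algebra"
  shows "diff_times k f \<Longrightarrow> diff_times k (\<lambda>t. c * f t)"
  by (rule diff_times_mult[OF diff_times_const])

lemma diff_times_diff:
  "diff_times k f \<Longrightarrow> diff_times k g \<Longrightarrow> diff_times k (\<lambda>t. f t - g t)"
  using diff_times_add[of k f "\<lambda>t. - g t"] diff_times_linear[OF bounded_linear_minus[OF bounded_linear_ident], of k g]
  by simp

lemma diff_times_sum:
  "(\<And>i. i \<in> I \<Longrightarrow> diff_times k (f i)) \<Longrightarrow> diff_times k (\<lambda>t. \<Sum>i\<in>I. f i t)"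
  by (induction I rule: infinite_finite_induct) (auto intro: diff_times_add diff_times_const)

lemma diff_times_compose:
  fixes \<phi> :: "real \<Rightarrow> real"
  shows "diff_times k f \<Longrightarrow> diff_times k \<phi> \<Longrightarrow> diff_times k (\<lambda>t. f (\<phi> t))"
proof (induction k arbitrary: f)
  case (Suc k)
  then obtain f' \<phi>' where d: "\<And>t. (f has_vector_derivative f' t) (at t)" "diff_times k f'"
     "\<And>t. (\<phi> has_vector_derivative \<phi>' t) (at t)" "diff_times k \<phi>'" by auto
  have "diff_times k \<phi>" using Suc.prems diff_times_Suc_imp by blast
  then have "diff_times k (\<lambda>t. \<phi>' t *\<^sub>R f' (\<phi> t))"
    using d Suc.IH by (intro diff_times_bilinear[OF bounded_bilinear_scaleR]) auto
  with vector_diff_chain_at[OF d(3) d(1)] show ?case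
    unfolding o_def by (rule diff_times_SucI)
qed simp

lemma has_vector_derivative_cis:
  "(cis has_vector_derivative \<i> * cis t) (at t)"
  unfolding has_vector_derivative_def by (auto intro!: derivative_eq_intros simp: scaleR_conv_of_real)

lemma diff_times_cis: "diff_times k cis"
proof (induction k)
  case (Suc k)
  show ?case using has_vector_derivative_cis diff_times_cmult[OF Suc, of \<i>] by (rule diff_times_SucI)
qed simp

lemma inf_diff_continuous: "inf_diff f \<Longrightarrow> continuous_on S f"
  by (rule continuous_on_vector_derivative, rule has_vector_derivative_at_within,
      rule inf_diff_vector_derivative(1))

section \<open>The circle\<close>

lemma of_circle_pt [simp]: "of_circle (pt t) = cis t"
  unfolding pt_def by (rule to_circle_inverse) simp

lemma norm_of_circle [simp]: "norm (of_circle z) = 1"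
  using of_circle[of z] by simp

lemma circle_eqI: "of_circle z = of_circle w \<Longrightarrow> z = w"
  by (simp add: of_circle_inject)

lemma pt_surj: obtains t where "z = pt t"
proof -
  have "cis (Arg (of_circle z)) = of_circle z"
    using cis_Arg[of "of_circle z"] norm_of_circle[of z] by (metis norm_zero zero_neq_one divide_self_if sgn_eq of_real_1 div_by_1)
  then show ?thesis using that circle_eqI by (metis of_circle_pt)
qed

lemma cis_eq_iff: "cis s = cis t \<longleftrightarrow> (\<exists>n::int. s = t + 2 * pi * of_int n)"
proof
  assume "cis s = cis t"
  then have "exp (\<i> * s) = exp (\<i> * t)" by (simp add: cis_conv_exp)
  then obtain n :: int where "\<i> * s = \<i> * t + of_int (2 * n) * of_real pi * \<i>"
    by (auto simp: exp_eq)
  then have "Im (\<i> * s) = Im (\<i> * t + of_int (2 * n) * of_real pi * \<i>)" by simp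
  then show "\<exists>n::int. s = t + 2 * pi * of_int n" by (intro exI[of _ n]) simp
next
  assume "\<exists>n::int. s = t + 2 * pi * of_int n"
  then obtain n :: int where "s = t + 2 * pi * of_int n" by blast
  then show "cis s = cis t"  using cis_mult[of t "2 * pi * of_int n"] by simp
qed

lemma pt_eq_iff: "pt s = pt t \<longleftrightarrow> (\<exists>n::int. s = t + 2 * pi * of_int n)"
  using cis_eq_iff by (metis of_circle_pt circle_eqI)

lemma pt_periodic [simp]: "pt (t + 2 * pi) = pt t"
  unfolding pt_eq_iff by (rule exI[of _ 1]) simp

lemma pt_2pi [simp]: "pt (2 * pi) = pt 0"
  using pt_periodic[of 0] by simp

lemma pt_surj_interval: obtains t where "t \<in> {0..2 * pi}" "z = pt t"
proof -
  obtain s where s: "z = pt s" by (rule pt_surj)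
  define n where "n = \<lfloor>s / (2 * pi)\<rfloor>"
  have "of_int n \<le> s / (2*pi)" "s / (2*pi) < of_int n + 1" unfolding n_def by linarith+
  then have "s - 2 * pi * of_int n \<in> {0..2*pi}" by (simp add: field_simps)
  moreover have "z = pt (s - 2 * pi * of_int n)"
    unfolding s pt_eq_iff by (rule exI[of _ n]) simp
  ultimately show ?thesis using that by blast
qed

text \<open>
  The logarithmic derivative of a curve in the circle is purely imaginary. Its antiderivative is the
  angle function, and comparing the two curves shows that a quotient has derivative zero.
\<close>

lemma smooth_lift_exists:
  assumes "smooth_circle_map \<psi>"
  obtains \<phi> where "inf_diff \<phi>" "\<And>t. \<psi> (pt t) = pt (\<phi> t)"
proof -
  define \<gamma> where "\<gamma> t = of_circle (\<psi> (pt t))" for t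
  have \<gamma>: "inf_diff \<gamma>" using assms unfolding smooth_circle_map_def smooth_iff_inf_diff \<gamma>_def .
  define \<gamma>' where "\<gamma>' t = vector_derivative \<gamma> (at t)" for t
  have \<gamma>': "inf_diff \<gamma>'" "\<And>t. (\<gamma> has_vector_derivative \<gamma>' t) (at t)"
    using inf_diff_vector_derivative[OF \<gamma>] unfolding \<gamma>'_def by auto
  have n1: "\<gamma> t * cnj (\<gamma> t) = 1" for t
    by (simp add: \<gamma>_def complex_norm_square[symmetric])
  define \<sigma> where "\<sigma> t = Im (\<gamma>' t * cnj (\<gamma> t))" for t
  have \<sigma>: "inf_diff \<sigma>" unfolding \<sigma>_def
    using \<gamma> \<gamma>' diff_times_linear[OF bounded_linear_Im] diff_times_linear[OF bounded_linear_cnj] diff_times_mult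
    by blast
  \<comment> \<open>Differentiating \<open>\<gamma> * cnj \<gamma> = 1\<close> shows that the logarithmic derivative is purely imaginary.\<close>
  have re: "Re (\<gamma>' t * cnj (\<gamma> t)) = 0" for t
  proof -
    have "((\<lambda>t. \<gamma> t * cnj (\<gamma> t)) has_vector_derivative \<gamma> t * cnj (\<gamma>' t) + \<gamma>' t * cnj (\<gamma> t)) (at t)"
      by (intro derivative_intros \<gamma>' bounded_linear.has_vector_derivative[OF bounded_linear_cnj])
    moreover have "((\<lambda>t. \<gamma> t * cnj (\<gamma> t)) has_vector_derivative 0) (at t)"
      using n1 by simp
    ultimately have "\<gamma> t * cnj (\<gamma>' t) + \<gamma>' t * cnj (\<gamma> t) = 0"
      using vector_derivative_unique_at by blast
    then have "Re (\<gamma> t * cnj (\<gamma>' t) + \<gamma>' t * cnj (\<gamma> t)) = 0" by simp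
    then show ?thesis by simp
  qed
  have log_deriv: "\<gamma>' t = \<i> * \<sigma> t * \<gamma> t" for t
  proof -
    have "\<gamma>' t * cnj (\<gamma> t) = \<i> * \<sigma> t" using re[of t] by (simp add: complex_eq_iff \<sigma>_def)
    then have "\<gamma>' t * (\<gamma> t * cnj (\<gamma> t)) = \<i> * \<sigma> t * \<gamma> t" by (simp add: algebra_simps)
    then show ?thesis using n1 by simp
  qed
  obtain \<theta>0 where \<theta>0: "\<psi> (pt 0) = pt \<theta>0" by (rule pt_surj)
  have "continuous_on UNIV \<sigma>" using inf_diff_continuous[OF \<sigma>] .
  then have "isCont \<sigma> t" for t by (simp add: continuous_on_eq_continuous_at)
  then have "\<exists>F. \<forall>t. (F has_vector_derivative \<sigma> t) (at t)"
    using einterval_antiderivative[of "-\<infinity>" "\<infinity>" \<sigma>] by simp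
  then obtain F where F: "\<And>t. (F has_vector_derivative \<sigma> t) (at t)" by blast
  define \<phi> where "\<phi> t = F t - F 0 + \<theta>0" for t
  have \<phi>': "(\<phi> has_vector_derivative \<sigma> t) (at t)" for t
    unfolding \<phi>_def by (auto intro!: derivative_eq_intros F)
  have "\<gamma> t * cis (- \<phi> t) = 1" for t
  proof -
    have "((\<lambda>t. \<gamma> t * cis (- \<phi> t)) has_vector_derivative 0) (at t)" for t
    proof -
      have "((\<lambda>t. cis (- \<phi> t)) has_vector_derivative (- \<sigma> t) *\<^sub>R (\<i> * cis (- \<phi> t))) (at t)"
        using vector_diff_chain_at[of "\<lambda>t. - \<phi> t" "- \<sigma> t" t cis, OF _ has_vector_derivative_cis]
        by (auto intro!: derivative_intros \<phi>' simp: o_def)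
      then have "((\<lambda>t. \<gamma> t * cis (- \<phi> t)) has_vector_derivative
           \<gamma> t * ((- \<sigma> t) *\<^sub>R (\<i> * cis (- \<phi> t))) + \<gamma>' t * cis (- \<phi> t)) (at t)"
        by (intro derivative_intros \<gamma>')
      then show ?thesis by (simp add: log_deriv scaleR_conv_of_real algebra_simps)
    qed
    then obtain c where c: "\<And>t. \<gamma> t * cis (- \<phi> t) = c"
      using has_vector_derivative_zero_constant[of UNIV "\<lambda>t. \<gamma> t * cis (- \<phi> t)"] by auto
    have "c = 1" using c[of 0] by (simp add: \<phi>_def \<gamma>_def \<theta>0 cis_mult)
    then show ?thesis using c by simp
  qed
  then have "\<gamma> t = cis (\<phi> t)" for t
    using cis_inverse[of "- \<phi> t"] inverse_unique[of "cis (- \<phi> t)" "\<gamma> t"] by (simp add: mult.commute)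
  then have "\<psi> (pt t) = pt (\<phi> t)" for t by (intro circle_eqI) (simp add: \<gamma>_def)
  moreover have "inf_diff \<phi>" using inf_diff_derivI[OF \<phi>' \<sigma>] .
  ultimately show ?thesis using that by blast
qed

lemma has_vector_derivative_cis_lift:
  assumes "inf_diff \<phi>" "\<And>t. \<psi> (pt t) = pt (\<phi> t)"
  shows "((\<lambda>t. of_circle (\<psi> (pt t))) has_vector_derivative
     \<i> * vector_derivative \<phi> (at t) * of_circle (\<psi> (pt t))) (at t)"
  using vector_diff_chain_at[OF inf_diff_vector_derivative(1)[OF assms(1)] has_vector_derivative_cis]
  by (simp add: assms(2) o_def scaleR_conv_of_real mult_ac)

lemma orientation_preserving_iff_lift:
  assumes "inf_diff \<phi>" "\<And>t. \<psi> (pt t) = pt (\<phi> t)"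
  shows "orientation_preserving \<psi> \<longleftrightarrow> (\<forall>t. vector_derivative \<phi> (at t) > 0)"
  unfolding orientation_preserving_def
  using vector_derivative_at[OF has_vector_derivative_cis_lift[OF assms]]
  by (simp add: assms(2))

lemma smooth_circle_fun_compose:
  assumes "smooth_circle_fun u" "smooth_circle_map \<psi>"
  shows "smooth_circle_fun (\<lambda>z. u (\<psi> z))"
proof -
  obtain \<phi> where \<phi>: "inf_diff \<phi>" "\<And>t. \<psi> (pt t) = pt (\<phi> t)"
    using smooth_lift_exists[OF assms(2)] by blast
  show ?thesis
    using assms(1) diff_times_compose \<phi>
    unfolding smooth_circle_fun_def smooth_iff_inf_diff \<phi>(2) by blast
qed

lemma smooth_circle_map_compose:
  assumes "smooth_circle_map \<psi>\<^sub>1" "smooth_circle_map \<psi>\<^sub>2"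
  shows "smooth_circle_map (\<psi>\<^sub>1 \<circ> \<psi>\<^sub>2)"
  using smooth_circle_fun_compose[of "\<lambda>z. of_circle (\<psi>\<^sub>1 z)" \<psi>\<^sub>2] assms
  unfolding smooth_circle_map_def smooth_circle_fun_def by simp

lemma orientation_preserving_compose:
  assumes "smooth_circle_map \<psi>\<^sub>1" "smooth_circle_map \<psi>\<^sub>2"
    "orientation_preserving \<psi>\<^sub>1" "orientation_preserving \<psi>\<^sub>2"
  shows "orientation_preserving (\<psi>\<^sub>1 \<circ> \<psi>\<^sub>2)"
proof -
  obtain \<phi>1 where \<phi>1: "inf_diff \<phi>1" "\<And>t. \<psi>\<^sub>1 (pt t) = pt (\<phi>1 t)"
    using smooth_lift_exists[OF assms(1)] by blast
  obtain \<phi>2 where \<phi>2: "inf_diff \<phi>2" "\<And>t. \<psi>\<^sub>2 (pt t) = pt (\<phi>2 t)"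
    using smooth_lift_exists[OF assms(2)] by blast
  have "inf_diff (\<lambda>t. \<phi>1 (\<phi>2 t))" using diff_times_compose \<phi>1 \<phi>2 by blast
  moreover have "vector_derivative (\<lambda>t. \<phi>1 (\<phi>2 t)) (at t) =
      vector_derivative \<phi>2 (at t) * vector_derivative \<phi>1 (at (\<phi>2 t))" for t
    using vector_derivative_at[OF vector_diff_chain_at[OF inf_diff_vector_derivative(1)[OF \<phi>2(1)]
          inf_diff_vector_derivative(1)[OF \<phi>1(1)]]] by (simp add: o_def)
  ultimately show ?thesis
    using assms(3,4) orientation_preserving_iff_lift[of "\<lambda>t. \<phi>1 (\<phi>2 t)" "\<psi>\<^sub>1 \<circ> \<psi>\<^sub>2"]
      orientation_preserving_iff_lift[OF \<phi>1] orientation_preserving_iff_lift[OF \<phi>2]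
    by (simp add: \<phi>1 \<phi>2 del: diff_times.simps)
qed

text \<open>
  Differentiating \<open>cis (f (h t)) = cis t\<close> for lifts \<open>f\<close> of \<open>\<psi>\<close> and \<open>h\<close> of its inverse gives
  \<open>f' (h t) * h' t = 1\<close>, so the two derivatives have the same sign.
\<close>

lemma orientation_preserving_inverse:
  assumes "bij \<psi>" "smooth_circle_map \<psi>" "smooth_circle_map (inv_into UNIV \<psi>)" "orientation_preserving \<psi>"
  shows "orientation_preserving (inv_into UNIV \<psi>)"
proof -
  obtain f where f: "inf_diff f" "\<And>t. \<psi> (pt t) = pt (f t)"
    using smooth_lift_exists[OF assms(2)] by blast
  obtain h where h: "inf_diff h" "\<And>t. inv_into UNIV \<psi> (pt t) = pt (h t)"
    using smooth_lift_exists[OF assms(3)] by blast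
  have fh: "cis (f (h t)) = cis t" for t
    using bij_inv_eq_iff[OF assms(1)] f h by (metis of_circle_pt)
  have fpos: "vector_derivative f (at t) > 0" for t
    using assms(4) orientation_preserving_iff_lift[OF f] by blast
  have "vector_derivative h (at t) > 0" for t
  proof -
    have "((\<lambda>t. f (h t)) has_vector_derivative
        vector_derivative h (at t) * vector_derivative f (at (h t))) (at t)"
      using vector_diff_chain_at[OF inf_diff_vector_derivative(1)[OF h(1)]
          inf_diff_vector_derivative(1)[OF f(1)]] by (simp add: o_def)
    from vector_diff_chain_at[OF this has_vector_derivative_cis]
    have "(cis has_vector_derivative (vector_derivative h (at t) * vector_derivative f (at (h t))) *\<^sub>R
        (\<i> * cis t)) (at t)" by (simp add: o_def fh)
    then have "(vector_derivative h (at t) * vector_derivative f (at (h t))) *\<^sub>R (\<i> * cis t) = \<i> * cis t"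
      using has_vector_derivative_cis vector_derivative_unique_at by blast
    then have "vector_derivative h (at t) * vector_derivative f (at (h t)) = 1"
      by (simp add: scaleR_conv_of_real flip: of_real_mult)
    then show ?thesis using fpos[of "h t"] by (metis zero_less_mult_pos2 zero_less_one)
  qed
  then show ?thesis using orientation_preserving_iff_lift[OF h] by blast
qed

lemma Diff_S1_carrier:
  "\<psi> \<in> carrier Diff_S1 \<longleftrightarrow> bij \<psi> \<and> smooth_circle_map \<psi> \<and>
     smooth_circle_map (inv_into UNIV \<psi>) \<and> orientation_preserving \<psi>"
  by (simp add: Diff_S1_def)

lemma Diff_S1_compose:
  assumes "\<psi>\<^sub>1 \<in> carrier Diff_S1" "\<psi>\<^sub>2 \<in> carrier Diff_S1"
  shows "\<psi>\<^sub>1 \<circ> \<psi>\<^sub>2 \<in> carrier Diff_S1"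
  using assms unfolding Diff_S1_carrier
  by (auto intro: bij_comp smooth_circle_map_compose orientation_preserving_compose
      simp: o_inv_distrib)

lemma Diff_S1_inverse:
  assumes "\<psi> \<in> carrier Diff_S1"
  shows "inv_into UNIV \<psi> \<in> carrier Diff_S1"
  using assms orientation_preserving_inverse unfolding Diff_S1_carrier
  by (auto simp: bij_imp_bij_inv inv_inv_eq)

lemma id_in_Diff_S1: "id \<in> carrier Diff_S1"
proof -
  have "smooth_circle_map id"
    unfolding smooth_circle_map_def smooth_iff_inf_diff by (auto intro: diff_times_cis simp del: diff_times.simps)
  moreover have "orientation_preserving id"
    using orientation_preserving_iff_lift[of "\<lambda>t. t" id] diff_times_ident by auto
  ultimately show ?thesis unfolding Diff_S1_carrier by simp
qed

lemma group_Diff_S1: "group Diff_S1"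
proof (rule groupI)
  fix \<psi> assume "\<psi> \<in> carrier Diff_S1"
  then show "\<exists>\<psi>'\<in>carrier Diff_S1. \<psi>' \<otimes>\<^bsub>Diff_S1\<^esub> \<psi> = \<one>\<^bsub>Diff_S1\<^esub>"
    using Diff_S1_inverse[of \<psi>] unfolding Diff_S1_carrier
    by (auto intro!: bexI[of _ "inv_into UNIV \<psi>"] simp: Diff_S1_def bij_is_inj)
qed (use Diff_S1_compose id_in_Diff_S1 in \<open>auto simp: Diff_S1_def\<close>)

text \<open>
  The lift gains a multiple of \<open>2 * pi\<close> over one period. The multiple is positive because the lift
  increases, and injectivity on the circle excludes all multiples above one.
\<close>

lemma diffeo_lift:
  assumes "\<psi> \<in> carrier Diff_S1"
  obtains \<phi> where "inf_diff \<phi>" "\<And>t. \<psi> (pt t) = pt (\<phi> t)"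
    "\<And>t. \<phi> (t + 2 * pi) = \<phi> t + 2 * pi" "\<And>t. vector_derivative \<phi> (at t) > 0"
proof -
  have \<psi>: "bij \<psi>" "smooth_circle_map \<psi>" "orientation_preserving \<psi>"
    using assms by (auto simp: Diff_S1_carrier)
  obtain \<phi> where \<phi>: "inf_diff \<phi>" "\<And>t. \<psi> (pt t) = pt (\<phi> t)"
    using smooth_lift_exists[OF \<psi>(2)] by blast
  have pos: "vector_derivative \<phi> (at t) > 0" for t
    using \<psi>(3) orientation_preserving_iff_lift[OF \<phi>] by blast
  have D: "(\<phi> has_real_derivative vector_derivative \<phi> (at t)) (at t)" for t
    using inf_diff_vector_derivative(1)[OF \<phi>(1)] by (simp add: has_real_derivative_iff_has_vector_derivative)
  have mono: "\<phi> s < \<phi> t" if "s < t" for s t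
    using DERIV_pos_imp_increasing[OF that, of \<phi>] D pos by blast
  have "\<phi> (t + 2 * pi) = \<phi> t + 2 * pi" for t
  proof -
    have "pt (\<phi> (t + 2 * pi)) = pt (\<phi> t)" using \<phi>(2) by (metis pt_periodic)
    then obtain n :: int where n: "\<phi> (t + 2 * pi) = \<phi> t + 2 * pi * of_int n"
      unfolding pt_eq_iff by blast
    have "\<phi> t < \<phi> (t + 2 * pi)" by (rule mono) simp
    then have "n > 0" using n by (simp add: zero_less_mult_iff)
    moreover have "\<not> n \<ge> 2"
    proof
      assume "n \<ge> 2"
      then have n2: "2 * pi * 2 \<le> 2 * pi * of_int n" by (intro mult_left_mono) auto
      \<comment> \<open>A degree above one makes \<open>\<phi>\<close> pass through a full turn strictly inside one period.\<close>
      have "\<exists>s. t \<le> s \<and> s \<le> t + 2 * pi \<and> \<phi> s = \<phi> t + 2 * pi"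
        using n n2 pi_gt_zero inf_diff_continuous[OF \<phi>(1)]
        by (intro IVT') auto
      then obtain s where s: "t \<le> s" "s \<le> t + 2 * pi" "\<phi> s = \<phi> t + 2 * pi" by blast
      have "\<psi> (pt s) = \<psi> (pt t)" using s(3) by (simp add: \<phi>(2))
      then have "pt s = pt t" using \<psi>(1) by (simp add: bij_is_inj inj_eq)
      then obtain j :: int where j: "s = t + 2 * pi * of_int j" unfolding pt_eq_iff by blast
      have "0 \<le> 2 * pi * real_of_int j" "2 * pi * real_of_int j \<le> 2 * pi * 1" using s(1,2) j by auto
      then have "0 \<le> j" "j \<le> 1" using pi_gt_zero by (auto simp: zero_le_mult_iff)
      then have "j = 0 \<or> j = 1" by linarith
      then show False using s(3) j n n2 pi_gt_zero by auto
    qed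
    ultimately have "n = 1" by linarith
    then show ?thesis using n by simp
  qed
  then show ?thesis using that \<phi> pos by blast
qed

section \<open>Summation over infinite index sets\<close>

lemma summable_on_comparison:
  fixes f g :: "'a \<Rightarrow> real"
  assumes "g summable_on A" "\<And>x. x \<in> A \<Longrightarrow> 0 \<le> f x" "\<And>x. x \<in> A \<Longrightarrow> f x \<le> g x"
  shows "f summable_on A"
proof (rule nonneg_bdd_above_summable_on)
  show "bdd_above (sum f ` {F. F \<subseteq> A \<and> finite F})"
  proof (rule bdd_aboveI2)
    fix F assume F: "F \<in> {F. F \<subseteq> A \<and> finite F}"
    then have "sum f F \<le> sum g F" by (intro sum_mono assms) auto
    also have "\<dots> \<le> infsum g A"
      using F assms by (intro finite_sum_le_infsum) (auto intro: order_trans)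
    finally show "sum f F \<le> infsum g A" .
  qed
qed (use assms in auto)

lemma summable_on_union:
  fixes f :: "'a \<Rightarrow> 'b::banach"
  assumes "f summable_on A" "f summable_on B"
  shows "f summable_on (A \<union> B)"
  using summable_on_Un_disjoint[OF assms(1) summable_on_subset_banach[OF assms(2), of "B - A"]]
  by auto

section \<open>Means and derivatives of functions on the circle\<close>

abbreviation circle_cont :: "(circle \<Rightarrow> complex) \<Rightarrow> bool" where
  "circle_cont u \<equiv> continuous_on UNIV (\<lambda>t. u (pt t))"

definition chi :: "int \<Rightarrow> circle \<Rightarrow> complex" where
  "chi n = (\<lambda>z. of_circle z powi n)"

lemma chi_pt [simp]: "chi n (pt t) = cis (of_int n * t)"
  by (simp add: chi_def cis_power_int)

lemma norm_chi [simp]: "norm (chi n z) = 1"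
  by (simp add: chi_def norm_power_int)

lemma chi_mult: "chi m z * chi n z = chi (m + n) z"
proof -
  have "of_circle z \<noteq> 0" using norm_of_circle[of z] by (metis norm_zero zero_neq_one)
  then show ?thesis by (simp add: chi_def power_int_add)
qed

lemma chi_0 [simp]: "chi 0 z = 1" by (simp add: chi_def)

lemma cnj_chi [simp]: "cnj (chi n z) = chi (- n) z"
proof -
  obtain t where "z = pt t" by (rule pt_surj)
  then show ?thesis by (simp add: cis_cnj)
qed

lemma fourier_eq_mean: "fourier u n = mean (\<lambda>z. u z * chi (- n) z)"
  by (simp add: fourier_def mean_def)

lemma circle_cont_integrable: "circle_cont u \<Longrightarrow> (\<lambda>t. u (pt t)) integrable_on {0..2 * pi}"
  by (rule integrable_continuous_real) (rule continuous_on_subset, auto)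

lemma circle_cont_bounded:
  assumes "circle_cont u"
  obtains B where "B > 0" "\<And>z. norm (u z) \<le> B"
proof -
  have "compact ((\<lambda>t. u (pt t)) ` {0..2 * pi})"
    by (rule compact_continuous_image[OF continuous_on_subset[OF assms]]) auto
  then obtain B where B: "B > 0" "\<And>t. t \<in> {0..2 * pi} \<Longrightarrow> norm (u (pt t)) \<le> B"
    using compact_imp_bounded bounded_pos by (metis imageI)
  have "norm (u z) \<le> B" for z
    using B(2) pt_surj_interval[of z] by metis
  then show ?thesis using that B(1) by blast
qed

lemma mean_add: "circle_cont u \<Longrightarrow> circle_cont v \<Longrightarrow> mean (\<lambda>z. u z + v z) = mean u + mean v"
  unfolding mean_def by (simp add: integral_add circle_cont_integrable distrib_left)

lemma mean_diff: "circle_cont u \<Longrightarrow> circle_cont v \<Longrightarrow> mean (\<lambda>z. u z - v z) = mean u - mean v"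
  unfolding mean_def by (simp add: integral_diff circle_cont_integrable right_diff_distrib)

lemma mean_cmult [simp]: "mean (\<lambda>z. c * u z) = c * mean u"
  unfolding mean_def by simp

lemma mean_const [simp]: "mean (\<lambda>z. c) = c"
  unfolding mean_def by (simp add: scaleR_conv_of_real)

lemma mean_cnj: "mean (\<lambda>z. cnj (u z)) = cnj (mean u)"
  unfolding mean_def by (simp add: integral_cnj)

lemma norm_mean_le:
  assumes "circle_cont u" "\<And>z. norm (u z) \<le> B"
  shows "norm (mean u) \<le> B"
proof -
  have "norm (integral {0..2 * pi} (\<lambda>t. u (pt t))) \<le> B * (2 * pi - 0)"
    by (rule integral_bound) (use assms in \<open>auto intro: continuous_on_subset\<close>)
  then show ?thesis unfolding mean_def by (simp add: norm_mult norm_divide field_simps)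
qed

text \<open>
  The angular derivative as a function on the circle. Any angle of \<open>z\<close> may serve as base point, since
  \<open>t \<mapsto> u (pt t)\<close> is periodic; a definite choice is made with \<open>Arg\<close>.
\<close>

definition cderiv :: "(circle \<Rightarrow> complex) \<Rightarrow> circle \<Rightarrow> complex" where
  "cderiv u z = vector_derivative (\<lambda>t. u (pt t)) (at (Arg (of_circle z)))"

lemma has_vector_derivative_periodic:
  assumes "\<And>t. f (t + c) = f t" "(f has_vector_derivative d) (at t)"
  shows "(f has_vector_derivative d) (at (t + c))"
proof -
  have "((f \<circ> (\<lambda>s. s - c)) has_vector_derivative 1 *\<^sub>R d) (at (t + c))"
    by (rule vector_diff_chain_at) (auto intro!: derivative_eq_intros simp: assms(2))
  moreover have "(f \<circ> (\<lambda>s. s - c)) s = f s" for s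
    using assms(1)[of "s - c"] by simp
  then have "f \<circ> (\<lambda>s. s - c) = f" by (rule ext)
  ultimately show ?thesis by simp
qed

lemma pt_shift [simp]: "pt (t + 2 * pi * of_int n) = pt t"
  unfolding pt_eq_iff by blast

lemma cderiv_pt_eqI:
  assumes "((\<lambda>t. u (pt t)) has_vector_derivative d) (at t)"
  shows "cderiv u (pt t) = d"
proof -
  have "pt (Arg (cis t)) = pt t"
    by (rule circle_eqI) (simp add: cis_Arg)
  then obtain n :: int where "Arg (cis t) = t + 2 * pi * of_int n"
    unfolding pt_eq_iff by blast
  then have "((\<lambda>t. u (pt t)) has_vector_derivative d) (at (Arg (cis t)))"
    using has_vector_derivative_periodic[OF _ assms, of "2 * pi * of_int n"] by simp
  then show ?thesis unfolding cderiv_def by (simp add: vector_derivative_at)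
qed

lemma smooth_circle_fun_cderiv:
  assumes "smooth_circle_fun u"
  shows "((\<lambda>t. u (pt t)) has_vector_derivative cderiv u (pt t)) (at t)"
    and "smooth_circle_fun (cderiv u)"
proof -
  have u: "inf_diff (\<lambda>t. u (pt t))" using assms unfolding smooth_circle_fun_def smooth_iff_inf_diff .
  have eq: "cderiv u (pt t) = vector_derivative (\<lambda>t. u (pt t)) (at t)" for t
    by (rule cderiv_pt_eqI[OF inf_diff_vector_derivative(1)[OF u]])
  show "((\<lambda>t. u (pt t)) has_vector_derivative cderiv u (pt t)) (at t)"
    unfolding eq by (rule inf_diff_vector_derivative(1)[OF u])
  show "smooth_circle_fun (cderiv u)"
    unfolding smooth_circle_fun_def smooth_iff_inf_diff eq
    by (rule inf_diff_vector_derivative(2)[OF u])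
qed

lemma smooth_imp_circle_cont: "smooth_circle_fun u \<Longrightarrow> circle_cont u"
  unfolding smooth_circle_fun_def smooth_iff_inf_diff by (rule inf_diff_continuous)

lemma smooth_circle_fun_add:
  "smooth_circle_fun u \<Longrightarrow> smooth_circle_fun v \<Longrightarrow> smooth_circle_fun (\<lambda>z. u z + v z)"
  unfolding smooth_circle_fun_def smooth_iff_inf_diff by (intro allI diff_times_add) blast+

lemma smooth_circle_fun_diff:
  "smooth_circle_fun u \<Longrightarrow> smooth_circle_fun v \<Longrightarrow> smooth_circle_fun (\<lambda>z. u z - v z)"
  unfolding smooth_circle_fun_def smooth_iff_inf_diff by (intro allI diff_times_diff) blast+

lemma smooth_circle_fun_mult:
  "smooth_circle_fun u \<Longrightarrow> smooth_circle_fun v \<Longrightarrow> smooth_circle_fun (\<lambda>z. u z * v z)"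
  unfolding smooth_circle_fun_def smooth_iff_inf_diff by (intro allI diff_times_mult) blast+

lemma smooth_circle_fun_const: "smooth_circle_fun (\<lambda>z. c)"
  unfolding smooth_circle_fun_def smooth_iff_inf_diff by (intro allI diff_times_const)

lemma smooth_circle_fun_sum:
  "(\<And>i. i \<in> I \<Longrightarrow> smooth_circle_fun (u i)) \<Longrightarrow> smooth_circle_fun (\<lambda>z. \<Sum>i\<in>I. u i z)"
  unfolding smooth_circle_fun_def smooth_iff_inf_diff by (intro allI diff_times_sum) blast+

lemma smooth_circle_fun_cnj:
  "smooth_circle_fun u \<Longrightarrow> smooth_circle_fun (\<lambda>z. cnj (u z))"
  unfolding smooth_circle_fun_def smooth_iff_inf_diff
  by (intro allI diff_times_linear[OF bounded_linear_cnj]) blast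

lemma smooth_circle_fun_chi: "smooth_circle_fun (chi n)"
proof -
  have "diff_times k (\<lambda>t. cis (of_int n * t))" for k
    by (rule diff_times_compose[OF diff_times_cis diff_times_cmult[OF diff_times_ident]])
  then show ?thesis unfolding smooth_circle_fun_def smooth_iff_inf_diff chi_pt by blast
qed

lemma cderiv_chi: "cderiv (chi n) z = \<i> * of_int n * chi n z"
proof -
  obtain t where t: "z = pt t" by (rule pt_surj)
  have "((\<lambda>t. cis (of_int n * t)) has_vector_derivative of_int n *\<^sub>R (\<i> * cis (of_int n * t))) (at t)"
  proof -
    have "((\<lambda>t. of_int n * t) has_vector_derivative real_of_int n) (at t)"
      by (auto intro!: derivative_eq_intros)
    from vector_diff_chain_at[OF this has_vector_derivative_cis] show ?thesis by (simp add: o_def)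
  qed
  then show ?thesis
    unfolding t by (intro cderiv_pt_eqI) (simp add: scaleR_conv_of_real mult.left_commute mult.assoc)
qed

lemma cderiv_mult:
  assumes "smooth_circle_fun u" "smooth_circle_fun v"
  shows "cderiv (\<lambda>z. u z * v z) z = u z * cderiv v z + cderiv u z * v z"
proof -
  obtain t where t: "z = pt t" by (rule pt_surj)
  show ?thesis unfolding t
    by (rule cderiv_pt_eqI,
        rule has_vector_derivative_mult[OF smooth_circle_fun_cderiv(1)[OF assms(1)]
          smooth_circle_fun_cderiv(1)[OF assms(2)]])
qed

text \<open>
  This is integration by parts on the circle: there are no boundary terms.
\<close>

lemma mean_cderiv:
  assumes "smooth_circle_fun u"
  shows "mean (cderiv u) = 0"
proof -
  have "((\<lambda>t. cderiv u (pt t)) has_integral u (pt (2 * pi)) - u (pt 0)) {0..2 * pi}"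
    by (rule fundamental_theorem_of_calculus, simp,
        rule has_vector_derivative_at_within, rule smooth_circle_fun_cderiv(1)[OF assms])
  from integral_unique[OF this] show ?thesis unfolding mean_def by simp
qed

lemma omega_eq_mean:
  assumes "smooth_circle_fun v"
  shows "omega u v = mean (\<lambda>z. u z * cderiv v z)"
  unfolding omega_def mean_def
  by (simp only: vector_derivative_at[OF smooth_circle_fun_cderiv(1)[OF assms]])

section \<open>Fourier coefficients\<close>

lemma circle_cont_chi: "circle_cont (chi n)"
  by (rule smooth_imp_circle_cont[OF smooth_circle_fun_chi])

lemma circle_cont_mult: "circle_cont u \<Longrightarrow> circle_cont v \<Longrightarrow> circle_cont (\<lambda>z. u z * v z)"
  by (rule continuous_on_mult)

lemma fourier_add:
  assumes "circle_cont u" "circle_cont v"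
  shows "fourier (\<lambda>z. u z + v z) n = fourier u n + fourier v n"
  unfolding fourier_eq_mean distrib_right
  by (rule mean_add; rule circle_cont_mult; rule assms circle_cont_chi)

lemma fourier_diff:
  assumes "circle_cont u" "circle_cont v"
  shows "fourier (\<lambda>z. u z - v z) n = fourier u n - fourier v n"
  unfolding fourier_eq_mean left_diff_distrib
  by (rule mean_diff; rule circle_cont_mult; rule assms circle_cont_chi)

lemma fourier_cmult [simp]: "fourier (\<lambda>z. c * u z) n = c * fourier u n"
  unfolding fourier_eq_mean mult.assoc by (rule mean_cmult)

lemma fourier_cnj: "fourier (\<lambda>z. cnj (u z)) n = cnj (fourier u (- n))"
  unfolding fourier_eq_mean mean_cnj[symmetric] by simp

lemma fourier_mult_chi: "fourier (\<lambda>z. u z * chi k z) n = fourier u (n - k)"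
  unfolding fourier_eq_mean mult.assoc chi_mult by simp

lemma fourier_0_eq_mean: "fourier u 0 = mean u"
  unfolding fourier_eq_mean by simp

lemma norm_fourier_le:
  assumes "circle_cont u" "\<And>z. norm (u z) \<le> B"
  shows "norm (fourier u n) \<le> B"
  unfolding fourier_eq_mean
proof (rule norm_mean_le)
  show "circle_cont (\<lambda>z. u z * chi (- n) z)" by (rule circle_cont_mult[OF assms(1) circle_cont_chi])
qed (simp add: norm_mult assms(2))

lemma fourier_cderiv:
  assumes "smooth_circle_fun u"
  shows "fourier (cderiv u) n = \<i> * of_int n * fourier u n"
proof -
  have s: "smooth_circle_fun (\<lambda>z. u z * chi (- n) z)"
    by (intro smooth_circle_fun_mult assms smooth_circle_fun_chi)
  have c: "circle_cont u" "circle_cont (cderiv u)"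
    using smooth_imp_circle_cont smooth_circle_fun_cderiv assms by auto
  have "0 = mean (cderiv (\<lambda>z. u z * chi (- n) z))" using mean_cderiv[OF s] by simp
  also have "cderiv (\<lambda>z. u z * chi (- n) z) =
      (\<lambda>z. cderiv u z * chi (- n) z - (\<i> * of_int n) * (u z * chi (- n) z))"
    by (rule ext) (simp add: cderiv_mult[OF assms smooth_circle_fun_chi] cderiv_chi)
  also have "mean \<dots> = fourier (cderiv u) n - \<i> * of_int n * fourier u n"
    by (subst mean_diff) (auto simp: fourier_eq_mean intro!: continuous_intros c)
  finally show ?thesis by (metis eq_iff_diff_eq_0)
qed

lemma mean_chi: "mean (chi n) = (if n = 0 then 1 else 0)"
proof (cases "n = 0")
  case True
  then show ?thesis using mean_const[of 1] by (simp add: chi_def)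
next
  case False
  have "\<i> * of_int n * mean (chi n) = mean (\<lambda>z. \<i> * of_int n * chi n z)" by simp
  also have "\<dots> = mean (cderiv (chi n))" by (simp add: cderiv_chi[abs_def])
  also have "\<dots> = 0" by (rule mean_cderiv[OF smooth_circle_fun_chi])
  finally have "mean (chi n) = 0" using False by (metis mult_eq_0_iff complex_i_not_zero of_int_eq_0_iff)
  then show ?thesis using False by simp
qed

lemma fourier_chi: "fourier (chi k) n = (if n = k then 1 else 0)"
proof -
  have "fourier (chi k) n = mean (chi (k + - n))" unfolding fourier_eq_mean chi_mult ..
  then show ?thesis unfolding mean_chi by simp
qed

lemma fourier_zero: "fourier (\<lambda>z. 0) n = 0"
  using fourier_cmult[of 0 "\<lambda>z. 0"] by simp

lemma fourier_sum:
  assumes "\<And>i. i \<in> I \<Longrightarrow> circle_cont (u i)"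
  shows "fourier (\<lambda>z. \<Sum>i\<in>I. u i z) n = (\<Sum>i\<in>I. fourier (u i) n)"
  using assms
proof (induction I rule: infinite_finite_induct)
  case (insert i I)
  have "circle_cont (\<lambda>z. \<Sum>i\<in>I. u i z)"
    using insert.prems by (intro continuous_on_sum) blast
  moreover have "circle_cont (u i)" using insert.prems by blast
  ultimately have "fourier (\<lambda>z. u i z + (\<Sum>i\<in>I. u i z)) n = fourier (u i) n + fourier (\<lambda>z. \<Sum>i\<in>I. u i z) n"
    by (intro fourier_add)
  also have "fourier (\<lambda>z. \<Sum>i\<in>I. u i z) n = (\<Sum>i\<in>I. fourier (u i) n)"
    using insert.prems by (intro insert.IH) blast
  finally show ?case using insert.hyps by simp
qed (simp_all add: fourier_zero)

text \<open>
  Two derivatives multiply the coefficient of index \<open>n\<close> by \<open>- n\<^sup>2\<close>, and the result is bounded.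
\<close>

lemma smooth_fourier_decay:
  assumes "smooth_circle_fun u"
  obtains B where "B > 0" "\<And>n. (real_of_int n)\<^sup>2 * norm (fourier u n) \<le> B"
proof -
  have s: "smooth_circle_fun (cderiv u)" "smooth_circle_fun (cderiv (cderiv u))"
    using smooth_circle_fun_cderiv assms by auto
  obtain B where B: "B > 0" "\<And>z. norm (cderiv (cderiv u) z) \<le> B"
    using circle_cont_bounded[OF smooth_imp_circle_cont[OF s(2)]] by blast
  have "(real_of_int n)\<^sup>2 * norm (fourier u n) \<le> B" for n
    using norm_fourier_le[OF smooth_imp_circle_cont[OF s(2)] B(2), of n]
    by (simp add: fourier_cderiv s assms norm_mult power2_eq_square mult.assoc)
  then show ?thesis using that B(1) by blast
qed

lemma summable_on_int_inverse_square:
  "(\<lambda>n::int. 1 / (real_of_int n)\<^sup>2) summable_on UNIV"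
proof -
  have "(\<lambda>n::nat. 1 / (real n)\<^sup>2) summable_on UNIV"
    by (rule summable_nonneg_imp_summable_on)
      (use inverse_power_summable[of 2, where 'a=real] in \<open>auto simp: inverse_eq_divide\<close>)
  then have 1: "(\<lambda>n::int. 1 / (real_of_int n)\<^sup>2) summable_on (range int)"
    and 2: "(\<lambda>n::int. 1 / (real_of_int n)\<^sup>2) summable_on (range (\<lambda>n. - int n))"
    by (simp_all add: summable_on_reindex o_def inj_on_def)
  have "n \<in> range int \<union> range (\<lambda>n. - int n)" for n
    by (cases n rule: int_cases2) auto
  then have "range int \<union> range (\<lambda>n. - int n) = UNIV" by blast
  then show ?thesis using summable_on_union[OF 1 2] by simp
qed

lemma smooth_fourier_abs_summable:
  assumes "smooth_circle_fun u"
  shows "(\<lambda>n. norm (fourier u n)) summable_on UNIV"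
proof -
  obtain B where B: "B > 0" "\<And>n. (real_of_int n)\<^sup>2 * norm (fourier u n) \<le> B"
    using smooth_fourier_decay[OF assms] by metis
  have "(\<lambda>n::int. B * (1 / (real_of_int n)\<^sup>2)) summable_on - {0}"
    by (intro summable_on_cmult_right summable_on_subset_banach[OF summable_on_int_inverse_square]) auto
  then have "(\<lambda>n. norm (fourier u n)) summable_on - {0}"
    by (rule summable_on_comparison) (use B in \<open>auto simp: field_simps\<close>)
  then have "(\<lambda>n. norm (fourier u n)) summable_on (- {0} \<union> {0})"
    by (rule summable_on_union) simp
  moreover have "- {0} \<union> {0} = (UNIV :: int set)" by blast
  ultimately show ?thesis by simp
qed

text \<open>
  Continuity in the angle is transferred to the circle as a subset of the plane, where the
  Stone-Weierstrass theorem applies.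
\<close>

lemma continuous_on_to_circle:
  assumes "circle_cont d"
  shows "continuous_on (sphere 0 1) (\<lambda>w. d (to_circle w))"
  unfolding continuous_on_eq_continuous_within
proof
  fix w0 :: complex assume w0: "w0 \<in> sphere 0 1"
  \<comment> \<open>The branch of the argument is rotated so that it is continuous near \<open>w0\<close>.\<close>
  define a where "a w = Arg (w / w0) + Arg w0" for w
  have nz: "w0 \<noteq> 0" using w0 by auto
  have eq: "d (to_circle w) = d (pt (a w))" if "w \<in> sphere 0 1" for w
  proof -
    have "cis (a w) = sgn (w / w0) * sgn w0"
    proof -
      have "w / w0 \<noteq> 0" using that nz by auto
      then show ?thesis using nz by (simp only: a_def cis_mult[symmetric] cis_Arg not_False_eq_True)
    qed
    also have "\<dots> = w" using that w0 nz by (simp add: sgn_eq norm_divide del: sgn_mult)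
    finally show ?thesis by (simp add: pt_def)
  qed
  have "isCont (\<lambda>w. w / w0) w0" using nz by (intro continuous_intros)
  moreover have "isCont Arg (w0 / w0)" using nz by (intro continuous_at_Arg) auto
  ultimately have "isCont (\<lambda>w. Arg (w / w0)) w0" by (rule isCont_o2)
  then have "isCont a w0" unfolding a_def by (intro isCont_add continuous_const)
  moreover have "isCont (\<lambda>t. d (pt t)) (a w0)"
    using assms by (simp add: continuous_on_eq_continuous_at)
  ultimately have "isCont (\<lambda>w. d (pt (a w))) w0" by (rule isCont_o2)
  then have "continuous (at w0 within sphere 0 1) (\<lambda>w. d (pt (a w)))"
    by (rule continuous_at_imp_continuous_at_within)
  then show "continuous (at w0 within sphere 0 1) (\<lambda>w. d (to_circle w))"
    by (rule continuous_transform_within[OF _ zero_less_one w0]) (use eq in auto)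
qed

text \<open>
  A real-linear function on the circle is a combination of \<open>z\<close> and its conjugate, so multiplication by
  it only shifts and combines Fourier coefficients. Hence the functions all of whose coefficients
  vanish are stable under multiplication by real polynomials.
\<close>

lemma fourier_zero_times_polynomial:
  assumes "real_polynomial_function p"
  shows "circle_cont h \<Longrightarrow> (\<And>n. fourier h n = 0) \<Longrightarrow>
    circle_cont (\<lambda>z. h z * of_real (p (of_circle z))) \<and>
    (\<forall>n. fourier (\<lambda>z. h z * of_real (p (of_circle z))) n = 0)"
  using assms
proof (induction p arbitrary: h rule: real_polynomial_function.induct)
  case (linear p)
  \<comment> \<open>The coefficient with \<open>p w = \<alpha> * w + cnj (\<alpha> * w)\<close>.\<close>
  define \<alpha> where "\<alpha> = (complex_of_real (p 1) - \<i> * of_real (p \<i>)) / 2"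
  have p: "of_real (p (of_circle z)) = \<alpha> * chi 1 z + cnj \<alpha> * chi (- 1) z" for z
  proof -
    have "p (of_circle z) = p (Re (of_circle z) *\<^sub>R 1 + Im (of_circle z) *\<^sub>R \<i>)"
      by (rule arg_cong[of _ _ p]) (simp add: complex_eq_iff)
    also have "\<dots> = Re (of_circle z) * p 1 + Im (of_circle z) * p \<i>"
      using linear(1) by (simp add: linear_simps)
    finally have "of_real (p (of_circle z)) =
        \<alpha> * of_circle z + cnj (\<alpha> * of_circle z)"
      by (simp add: complex_eq_iff \<alpha>_def field_simps)
    moreover have "of_circle z = chi 1 z" by (simp add: chi_def)
    ultimately show ?thesis by simp
  qed
  have c: "circle_cont (\<lambda>z. \<alpha> * (h z * chi 1 z))" "circle_cont (\<lambda>z. cnj \<alpha> * (h z * chi (- 1) z))"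
    using linear.prems(1) by (intro circle_cont_mult continuous_on_const circle_cont_chi; assumption)+
  have eq: "(\<lambda>z. h z * (\<alpha> * chi 1 z + cnj \<alpha> * chi (- 1) z)) =
      (\<lambda>z. \<alpha> * (h z * chi 1 z) + cnj \<alpha> * (h z * chi (- 1) z))"
    by (simp add: algebra_simps)
  have "circle_cont (\<lambda>z. h z * (\<alpha> * chi 1 z + cnj \<alpha> * chi (- 1) z))"
    by (intro circle_cont_mult[OF linear.prems(1)] continuous_on_add
        circle_cont_mult[OF continuous_on_const circle_cont_chi])
  then show ?case
    by (simp only: p eq fourier_add[OF c] fourier_cmult fourier_mult_chi linear.prems(2) simp_thms
        mult_zero_right add_0)
next
  case (const c)
  have eq: "(\<lambda>z. h z * of_real c) = (\<lambda>z. of_real c * h z)" by (simp add: mult.commute)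
  show ?case
    using circle_cont_mult[OF const(1) continuous_on_const] const(2) by (simp add: eq)
next
  case (add p q)
  note p = add.IH(1)[OF add.prems] and q = add.IH(2)[OF add.prems]
  show ?case
    using continuous_on_add[OF conjunct1[OF p] conjunct1[OF q]]
      fourier_add[OF conjunct1[OF p] conjunct1[OF q]] p q
    by (simp only: of_real_add distrib_left) simp
next
  case (mult p q)
  note p = mult.IH(1)[OF mult.prems]
  have "circle_cont (\<lambda>z. (h z * of_real (p (of_circle z))) * of_real (q (of_circle z))) \<and>
    (\<forall>n. fourier (\<lambda>z. (h z * of_real (p (of_circle z))) * of_real (q (of_circle z))) n = 0)"
    by (rule mult.IH(2)[OF conjunct1[OF p] spec[OF conjunct2[OF p]]])
  then show ?case by (simp only: of_real_mult mult.assoc simp_thms)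
qed

text \<open>
  The previous lemma gives the claim for polynomial \<open>r\<close>, and these are uniformly dense.
\<close>

lemma fourier_zero_imp_mean_mult_zero:
  fixes r :: "circle \<Rightarrow> real"
  assumes d: "circle_cont d" "\<And>n. fourier d n = 0" and r: "circle_cont (\<lambda>z. of_real (r z))"
  shows "mean (\<lambda>z. d z * of_real (r z)) = 0"
proof -
  obtain B where B: "B > 0" "\<And>z. norm (d z) \<le> B" using circle_cont_bounded[OF d(1)] by metis
  have "continuous_on (sphere 0 1) (\<lambda>w. r (to_circle w))"
    using continuous_on_Re[OF continuous_on_to_circle[OF r]] by simp
  have "norm (mean (\<lambda>z. d z * of_real (r z))) \<le> e" if "e > 0" for e
  proof -
    obtain p where p: "real_polynomial_function p"
      "\<And>w. w \<in> sphere 0 1 \<Longrightarrow> \<bar>r (to_circle w) - p w\<bar> < e / B"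
      by (rule Stone_Weierstrass_real_polynomial_function[OF compact_sphere
          \<open>continuous_on (sphere 0 1) (\<lambda>w. r (to_circle w))\<close> divide_pos_pos[OF \<open>e > 0\<close> B(1)]],
          rule that)
    have close: "\<bar>r z - p (of_circle z)\<bar> \<le> e / B" for z
      using p(2)[OF of_circle[of z]] by (simp add: of_circle_inverse)
    note dp = fourier_zero_times_polynomial[OF p(1) d]
    have cr: "circle_cont (\<lambda>z. d z * of_real (r z))" by (rule circle_cont_mult[OF d(1) r])
    have "mean (\<lambda>z. d z * of_real (r z)) =
        mean (\<lambda>z. d z * of_real (r z) - d z * of_real (p (of_circle z)))"
      unfolding mean_diff[OF cr conjunct1[OF dp]] using spec[OF conjunct2[OF dp], of 0]
      by (simp only: fourier_0_eq_mean diff_zero)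
    also have "norm \<dots> \<le> e"
    proof (rule norm_mean_le)
      show "circle_cont (\<lambda>z. d z * of_real (r z) - d z * of_real (p (of_circle z)))"
        using continuous_on_diff[OF cr conjunct1[OF dp]] .
      fix z
      have "norm (d z * of_real (r z) - d z * of_real (p (of_circle z))) = norm (d z) * \<bar>r z - p (of_circle z)\<bar>"
        by (simp only: right_diff_distrib[symmetric] of_real_diff[symmetric] norm_mult norm_of_real)
      also have "\<dots> \<le> B * (e / B)" using B close by (intro mult_mono) auto
      finally show "norm (d z * of_real (r z) - d z * of_real (p (of_circle z))) \<le> e" using B(1) by simp
    qed
    finally show ?thesis .
  qed
  then have "norm (mean (\<lambda>z. d z * of_real (r z))) \<le> 0"
    by (rule dense_ge)
  then show ?thesis by simp
qed

text \<open>
  The function is orthogonal to its own real and imaginary parts, so its square modulus has mean zero.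
\<close>

lemma fourier_zero_imp_zero:
  assumes d: "circle_cont d" "\<And>n. fourier d n = 0"
  shows "d z = 0"
proof -
  have cR: "circle_cont (\<lambda>z. of_real (Re (d z)))" and cI: "circle_cont (\<lambda>z. of_real (Im (d z)))"
    using d(1) by (auto intro!: continuous_intros)
  have "circle_cont (\<lambda>z. \<i> * (d z * of_real (Im (d z))))"
    by (rule circle_cont_mult[OF continuous_on_const circle_cont_mult[OF d(1) cI]])
  then have "mean (\<lambda>z. d z * of_real (Re (d z)) - \<i> * (d z * of_real (Im (d z)))) = 0"
    using fourier_zero_imp_mean_mult_zero[OF d cR] fourier_zero_imp_mean_mult_zero[OF d cI]
      circle_cont_mult[OF d(1) cR] by (simp add: mean_diff)
  moreover have "(\<lambda>z. d z * of_real (Re (d z)) - \<i> * (d z * of_real (Im (d z)))) =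
      (\<lambda>z. complex_of_real ((cmod (d z))\<^sup>2))"
    by (rule ext) (simp add: complex_eq_iff cmod_def power2_eq_square)
  ultimately have *: "integral {0..2 * pi} (\<lambda>t. complex_of_real ((cmod (d (pt t)))\<^sup>2)) = 0"
    by (simp add: mean_def)
  then have "integral {0..2 * pi} (\<lambda>t. (cmod (d (pt t)))\<^sup>2) = 0"
  proof -
    have "continuous_on {0..2 * pi} (\<lambda>t. complex_of_real ((cmod (d (pt t)))\<^sup>2))"
      by (intro continuous_intros continuous_on_subset[OF d(1)]) simp
    from integral_linear[OF integrable_continuous_real[OF this] bounded_linear_Re] * show ?thesis
      by (simp only: o_def Re_complex_of_real zero_complex.sel)
  qed
  moreover have "continuous_on {0..2 * pi} (\<lambda>t. (cmod (d (pt t)))\<^sup>2)"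
    by (intro continuous_intros continuous_on_subset[OF d(1)]) simp
  ultimately have zero: "\<forall>t\<in>{0..2 * pi}. (cmod (d (pt t)))\<^sup>2 = 0"
    by (subst (asm) integral_eq_0_iff) auto
  obtain t where "t \<in> {0..2 * pi}" "z = pt t" by (rule pt_surj_interval)
  then show ?thesis using zero by simp
qed

section \<open>Fourier inversion and the symplectic form\<close>

lemma symmetric_partial_sums_tendsto:
  fixes f :: "int \<Rightarrow> 'a::{comm_monoid_add, topological_space}"
  assumes "(f has_sum s) UNIV"
  shows "(\<lambda>N. \<Sum>n\<in>{- int N..int N}. f n) \<longlonglongrightarrow> s"
proof -
  have "filterlim (\<lambda>N. {- int N..int N}) (finite_subsets_at_top UNIV) sequentially"
    unfolding filterlim_finite_subsets_at_top
  proof (intro allI impI)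
    fix X :: "int set" assume X: "finite X \<and> X \<subseteq> UNIV"
    obtain K where K: "\<And>x. x \<in> X \<Longrightarrow> nat \<bar>x\<bar> \<le> K"
      using X finite_imageI[of X "\<lambda>x. nat \<bar>x\<bar>"] finite_nat_set_iff_bounded_le by auto
    have "X \<subseteq> {- int N..int N}" if "N \<ge> K" for N
      using K that by fastforce
    then show "\<forall>\<^sub>F N in sequentially. finite {- int N..int N} \<and> X \<subseteq> {- int N..int N} \<and> {- int N..int N} \<subseteq> UNIV"
      using eventually_sequentially by auto
  qed
  from filterlim_compose[OF assms[unfolded has_sum_def] this] show ?thesis .
qed

lemma trig_partial_chi: "trig_partial a N = (\<lambda>z. \<Sum>n\<in>{- int N..int N}. a n * chi n z)"
  by (simp add: trig_partial_def chi_def)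

lemma smooth_trig_partial: "smooth_circle_fun (trig_partial a N)"
  unfolding trig_partial_chi
  by (rule smooth_circle_fun_sum, rule smooth_circle_fun_mult[OF smooth_circle_fun_const smooth_circle_fun_chi])

lemma fourier_trig_partial:
  "fourier (trig_partial a N) m = (if m \<in> {- int N..int N} then a m else 0)"
proof -
  have "fourier (trig_partial a N) m = (\<Sum>n\<in>{- int N..int N}. fourier (\<lambda>z. a n * chi n z) m)"
    unfolding trig_partial_chi
    by (rule fourier_sum, rule circle_cont_mult[OF continuous_on_const circle_cont_chi])
  also have "\<dots> = (\<Sum>n\<in>{- int N..int N}. if n = m then a n else 0)"
    by (rule sum.cong) (auto simp: fourier_chi)
  finally show ?thesis by simp
qed

text \<open>
  The Fourier series of a smooth function converges absolutely. Its sum is continuous and has the same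
  coefficients, so it is the function itself; the tail of the series of moduli is a uniform rate.
\<close>

lemma smooth_fourier_uniform:
  assumes u: "smooth_circle_fun u"
  obtains \<epsilon> where "\<epsilon> \<longlonglongrightarrow> 0" "\<And>N z. norm (u z - trig_partial (fourier u) N z) \<le> \<epsilon> N"
proof -
  let ?I = "\<lambda>N. {- int N..int N}"
  define s where "s z = (\<Sum>\<^sub>\<infinity>n. fourier u n * chi n z)" for z
  define \<epsilon> where "\<epsilon> N = (\<Sum>\<^sub>\<infinity>n. norm (fourier u n)) - (\<Sum>n\<in>?I N. norm (fourier u n))" for N
  have sn: "(\<lambda>n. norm (fourier u n)) summable_on UNIV" by (rule smooth_fourier_abs_summable[OF u])
  then have "(\<lambda>n. norm (fourier u n * chi n z)) summable_on UNIV" for z by (simp add: norm_mult)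
  then have sc: "(\<lambda>n. fourier u n * chi n z) summable_on UNIV" for z by (rule abs_summable_summable)
  have "(\<lambda>N. \<Sum>n\<in>?I N. norm (fourier u n)) \<longlonglongrightarrow> (\<Sum>\<^sub>\<infinity>n. norm (fourier u n))"
    by (rule symmetric_partial_sums_tendsto[OF has_sum_infsum[OF sn]])
  from tendsto_diff[OF tendsto_const[of "\<Sum>\<^sub>\<infinity>n. norm (fourier u n)"] this] have \<epsilon>0: "\<epsilon> \<longlonglongrightarrow> 0" unfolding \<epsilon>_def by simp
  have close: "norm (s z - trig_partial (fourier u) N z) \<le> \<epsilon> N" for N z
  proof -
    have "s z - trig_partial (fourier u) N z = (\<Sum>\<^sub>\<infinity>n\<in>UNIV - ?I N. fourier u n * chi n z)"
      using infsum_Diff[OF sc[of z], of "?I N"] by (simp add: s_def trig_partial_chi)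
    also have "norm \<dots> \<le> (\<Sum>\<^sub>\<infinity>n\<in>UNIV - ?I N. norm (fourier u n * chi n z))"
      by (rule norm_infsum_bound)
        (simp add: norm_mult, rule summable_on_subset_banach[OF sn], simp)
    also have "\<dots> = \<epsilon> N"
      using infsum_Diff[OF sn, of "?I N"] by (simp add: \<epsilon>_def norm_mult)
    finally show ?thesis .
  qed
  have cs: "circle_cont s"
  proof (rule uniform_limit_theorem[where F=sequentially and f = "\<lambda>N t. trig_partial (fourier u) N (pt t)"])
    show "\<forall>\<^sub>F N in sequentially. circle_cont (trig_partial (fourier u) N)"
      using smooth_imp_circle_cont[OF smooth_trig_partial] by (simp add: always_eventually)
    show "uniform_limit UNIV (\<lambda>N t. trig_partial (fourier u) N (pt t)) (\<lambda>t. s (pt t)) sequentially"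
    proof (rule uniform_limitI)
      fix e :: real assume "e > 0"
      with \<epsilon>0 have "\<forall>\<^sub>F N in sequentially. \<epsilon> N < e" by (rule order_tendstoD)
      then show "\<forall>\<^sub>F N in sequentially. \<forall>t\<in>UNIV. dist (trig_partial (fourier u) N (pt t)) (s (pt t)) < e"
        by eventually_elim (use close in \<open>auto simp: dist_norm norm_minus_commute intro: le_less_trans\<close>)
    qed
  qed simp
  have cu: "circle_cont u" by (rule smooth_imp_circle_cont[OF u])
  have fs: "fourier s m = fourier u m" for m
  proof -
    have "norm (fourier s m - fourier u m) \<le> \<epsilon> N" if "N \<ge> nat \<bar>m\<bar>" for N
    proof -
      have "fourier u m = fourier (trig_partial (fourier u) N) m"
        using that by (auto simp: fourier_trig_partial)
      then have "fourier s m - fourier u m = fourier (\<lambda>z. s z - trig_partial (fourier u) N z) m"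
        by (simp add: fourier_diff[OF cs smooth_imp_circle_cont[OF smooth_trig_partial]])
      also have "norm \<dots> \<le> \<epsilon> N"
        by (rule norm_fourier_le[OF continuous_on_diff[OF cs smooth_imp_circle_cont[OF smooth_trig_partial]] close])
      finally show ?thesis .
    qed
    then have "norm (fourier s m - fourier u m) \<le> 0"
      by (intro tendsto_lowerbound[OF \<epsilon>0]) (auto simp: eventually_sequentially)
    then show ?thesis by simp
  qed
  have "s z - u z = 0" for z
    using fourier_zero_imp_zero[of "\<lambda>z. s z - u z"] continuous_on_diff[OF cs cu]
    by (simp add: fourier_diff[OF cs cu] fs)
  then have "s = u" by auto
  then show ?thesis using that[OF \<epsilon>0] close by simp
qed

lemma omega_chi_left:
  assumes "smooth_circle_fun v"
  shows "omega (chi n) v = - (\<i> * of_int n * fourier v (- n))"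
  using fourier_cderiv[OF assms, of "- n"]
  by (simp add: omega_eq_mean[OF assms] fourier_eq_mean mult.commute)

lemma omega_diff_left:
  assumes "circle_cont u" "circle_cont u'" "smooth_circle_fun v"
  shows "omega (\<lambda>z. u z - u' z) v = omega u v - omega u' v"
proof -
  have "circle_cont (cderiv v)" using smooth_circle_fun_cderiv(2)[OF assms(3)] by (rule smooth_imp_circle_cont)
  then show ?thesis
    unfolding omega_eq_mean[OF assms(3)] left_diff_distrib
    by (intro mean_diff circle_cont_mult assms)
qed

lemma mean_sum:
  assumes "\<And>i. i \<in> I \<Longrightarrow> circle_cont (u i)"
  shows "mean (\<lambda>z. \<Sum>i\<in>I. u i z) = (\<Sum>i\<in>I. mean (u i))"
  using fourier_sum[of I u 0, OF assms] unfolding fourier_0_eq_mean .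

lemma omega_trig_partial_left:
  assumes "smooth_circle_fun v"
  shows "omega (trig_partial a N) v = (\<Sum>n\<in>{- int N..int N}. - (\<i> * of_int n * a n * fourier v (- n)))"
proof -
  have cv: "circle_cont (cderiv v)" using smooth_circle_fun_cderiv(2)[OF assms] by (rule smooth_imp_circle_cont)
  have "omega (trig_partial a N) v = mean (\<lambda>z. \<Sum>n\<in>{- int N..int N}. a n * (chi n z * cderiv v z))"
    by (simp add: omega_eq_mean[OF assms] trig_partial_chi sum_distrib_right mult.assoc)
  also have "\<dots> = (\<Sum>n\<in>{- int N..int N}. mean (\<lambda>z. a n * (chi n z * cderiv v z)))"
    by (rule mean_sum, rule circle_cont_mult[OF continuous_on_const circle_cont_mult[OF circle_cont_chi cv]])
  also have "\<dots> = (\<Sum>n\<in>{- int N..int N}. - (\<i> * of_int n * a n * fourier v (- n)))"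
    unfolding mean_cmult omega_chi_left[OF assms, unfolded omega_eq_mean[OF assms]]
    by (rule sum.cong) (simp_all only: mult_minus_right mult.assoc mult.left_commute)
  finally show ?thesis .
qed

text \<open>
  The form \<open>\<omega>\<close> in Fourier coordinates, by integrating the uniformly convergent series of \<open>u\<close> against the
  derivative of \<open>v\<close>.
\<close>

lemma omega_has_sum:
  assumes u: "smooth_circle_fun u" and v: "smooth_circle_fun v"
  shows "((\<lambda>n. - (\<i> * of_int n * fourier u n * fourier v (- n))) has_sum omega u v) UNIV"
proof -
  let ?f = "\<lambda>n. - (\<i> * of_int n * fourier u n * fourier v (- n))"
  have cv: "circle_cont (cderiv v)" using smooth_circle_fun_cderiv(2)[OF v] by (rule smooth_imp_circle_cont)
  obtain B where B: "B > 0" "\<And>z. norm (cderiv v z) \<le> B" using circle_cont_bounded[OF cv] by metis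
  have "norm (?f n) \<le> B * norm (fourier u n)" for n
  proof -
    have "norm (?f n) = norm (fourier u n) * norm (fourier (cderiv v) (- n))"
      by (simp add: fourier_cderiv[OF v] norm_mult)
    also have "\<dots> \<le> norm (fourier u n) * B"
      by (intro mult_left_mono norm_fourier_le cv B) simp
    finally show ?thesis by (simp add: mult.commute)
  qed
  moreover have "(\<lambda>n. B * norm (fourier u n)) summable_on UNIV"
    by (rule summable_on_cmult_right[OF smooth_fourier_abs_summable[OF u]])
  ultimately have "(\<lambda>n. norm (?f n)) summable_on UNIV"
    by (intro summable_on_comparison[where f = "\<lambda>n. norm (?f n)"]) auto
  then have f: "?f summable_on UNIV" by (rule abs_summable_summable)
  obtain \<epsilon> where \<epsilon>: "\<epsilon> \<longlonglongrightarrow> 0" "\<And>N z. norm (u z - trig_partial (fourier u) N z) \<le> \<epsilon> N"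
    using smooth_fourier_uniform[OF u] by metis
  have cu: "circle_cont u" and ct: "\<And>N. circle_cont (trig_partial (fourier u) N)"
    using smooth_imp_circle_cont[OF u] smooth_imp_circle_cont[OF smooth_trig_partial] by auto
  have "norm (omega u v - omega (trig_partial (fourier u) N) v) \<le> \<epsilon> N * B" for N
  proof -
    have "omega u v - omega (trig_partial (fourier u) N) v =
        mean (\<lambda>z. (u z - trig_partial (fourier u) N z) * cderiv v z)"
      by (rule trans[OF omega_diff_left[OF cu ct v, symmetric] omega_eq_mean[OF v]])
    also have "norm \<dots> \<le> \<epsilon> N * B"
    proof (rule norm_mean_le[OF circle_cont_mult[OF continuous_on_diff[OF cu ct] cv]])
      fix z
      have "0 \<le> \<epsilon> N" using order_trans[OF norm_ge_zero \<epsilon>(2)] .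
      then show "norm ((u z - trig_partial (fourier u) N z) * cderiv v z) \<le> \<epsilon> N * B"
        unfolding norm_mult by (intro mult_mono \<epsilon>(2) B(2) norm_ge_zero)
    qed
    finally show ?thesis .
  qed
  then have "(\<lambda>N. omega u v - omega (trig_partial (fourier u) N) v) \<longlonglongrightarrow> 0"
    using tendsto_mult_left_zero[OF \<epsilon>(1)]
    by (rule Lim_null_comparison[OF always_eventually[OF allI]])
  from tendsto_diff[OF tendsto_const[of "omega u v"] this]
  have "(\<lambda>N. omega (trig_partial (fourier u) N) v) \<longlonglongrightarrow> omega u v" by simp
  then have "(\<lambda>N. \<Sum>n\<in>{- int N..int N}. ?f n) \<longlonglongrightarrow> omega u v"
    by (simp add: omega_trig_partial_left[OF v])
  moreover have "(\<lambda>N. \<Sum>n\<in>{- int N..int N}. ?f n) \<longlonglongrightarrow> infsum ?f UNIV"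
    by (rule symmetric_partial_sums_tendsto[OF has_sum_infsum[OF f]])
  ultimately have "omega u v = infsum ?f UNIV" by (rule LIMSEQ_unique)
  then show ?thesis using has_sum_infsum[OF f] by simp
qed

section \<open>The energy norm\<close>

lemma H_S1_smooth: "u \<in> H_S1 \<Longrightarrow> smooth_circle_fun u" by (simp add: H_S1_def)
lemma H_S1_cont: "u \<in> H_S1 \<Longrightarrow> circle_cont u" by (rule smooth_imp_circle_cont[OF H_S1_smooth])
lemma H_S1_fourier_0: "u \<in> H_S1 \<Longrightarrow> fourier u 0 = 0" by (simp add: H_S1_def fourier_0_eq_mean)

lemma H_S1_I: "smooth_circle_fun u \<Longrightarrow> fourier u 0 = 0 \<Longrightarrow> u \<in> H_S1"
  by (simp add: H_S1_def fourier_0_eq_mean)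

lemma H_S1_add: "u \<in> H_S1 \<Longrightarrow> v \<in> H_S1 \<Longrightarrow> (\<lambda>z. u z + v z) \<in> H_S1"
  by (rule H_S1_I) (simp_all add: smooth_circle_fun_add H_S1_smooth fourier_add H_S1_cont H_S1_fourier_0)

lemma H_S1_cmult: "u \<in> H_S1 \<Longrightarrow> (\<lambda>z. c * u z) \<in> H_S1"
  by (rule H_S1_I) (simp_all add: smooth_circle_fun_mult smooth_circle_fun_const H_S1_smooth H_S1_fourier_0)

lemma H_S1_zero: "(\<lambda>z. 0) \<in> H_S1"
  by (rule H_S1_I) (simp_all add: smooth_circle_fun_const fourier_zero)

lemma H_S1_diff: "u \<in> H_S1 \<Longrightarrow> v \<in> H_S1 \<Longrightarrow> (\<lambda>z. u z - v z) \<in> H_S1"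
  by (rule H_S1_I) (simp_all add: smooth_circle_fun_diff H_S1_smooth fourier_diff H_S1_cont H_S1_fourier_0)

lemma H_S1_cnj: "u \<in> H_S1 \<Longrightarrow> (\<lambda>z. cnj (u z)) \<in> H_S1"
  by (rule H_S1_I) (simp_all add: smooth_circle_fun_cnj H_S1_smooth fourier_cnj H_S1_fourier_0)

lemma H_S1_chi: "n \<noteq> 0 \<Longrightarrow> chi n \<in> H_S1"
  by (rule H_S1_I) (simp_all add: smooth_circle_fun_chi fourier_chi)

lemma H_S1_trig_partial: "a 0 = 0 \<Longrightarrow> trig_partial a N \<in> H_S1"
  by (rule H_S1_I) (simp_all add: smooth_trig_partial fourier_trig_partial)

abbreviation energy_density :: "(int \<Rightarrow> complex) \<Rightarrow> int \<Rightarrow> real" where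
  "energy_density a n \<equiv> real_of_int \<bar>n\<bar> * (cmod (a n))\<^sup>2"

lemma norm_H_omega_square: "(norm_H_omega a)\<^sup>2 = infsum (energy_density a) UNIV"
  unfolding norm_H_omega_def by (rule real_sqrt_pow2) (rule infsum_nonneg, simp)

lemma norm_H_omega_nonneg: "0 \<le> norm_H_omega a"
  unfolding norm_H_omega_def by (rule real_sqrt_ge_zero, rule infsum_nonneg) simp

lemma H_omega_sum_le:
  "a \<in> H_omega \<Longrightarrow> finite F \<Longrightarrow> sum (energy_density a) F \<le> (norm_H_omega a)\<^sup>2"
  unfolding norm_H_omega_square H_omega_def by (rule finite_sum_le_infsum) auto

lemma int_finite_subset:
  assumes "finite (F :: int set)"
  obtains N where "F \<subseteq> {- int N..int N}"
proof -
  obtain K where K: "\<And>x. x \<in> F \<Longrightarrow> nat \<bar>x\<bar> \<le> K"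
    using finite_imageI[OF assms, of "\<lambda>x. nat \<bar>x\<bar>"] finite_nat_set_iff_bounded_le by auto
  have "F \<subseteq> {- int K..int K}" using K by fastforce
  then show ?thesis by (rule that)
qed

lemma H_omegaI:
  assumes "\<And>N. sum (energy_density a) {- int N..int N} \<le> K" "a 0 = 0"
  shows "a \<in> H_omega" "(norm_H_omega a)\<^sup>2 \<le> K"
proof -
  have le: "sum (energy_density a) F \<le> K" if "finite F" for F
  proof -
    obtain N where N: "F \<subseteq> {- int N..int N}" using int_finite_subset[OF \<open>finite F\<close>] by metis
    have "sum (energy_density a) F \<le> sum (energy_density a) {- int N..int N}"
      by (rule sum_mono2) (use N in auto)
    then show ?thesis using assms(1)[of N] by linarith
  qed
  have s: "energy_density a summable_on UNIV"
    by (rule nonneg_bdd_above_summable_on, simp, rule bdd_aboveI2[where M = K], rule le, simp)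
  then show "a \<in> H_omega" using assms(2) by (simp add: H_omega_def)
  show "(norm_H_omega a)\<^sup>2 \<le> K"
    unfolding norm_H_omega_square by (rule infsum_le_finite_sums[OF s]) (rule le)
qed

lemma fourier_in_H_omega:
  assumes "u \<in> H_S1"
  shows "fourier u \<in> H_omega"
proof -
  have s: "smooth_circle_fun u" using assms by (rule H_S1_smooth)
  obtain B where B: "B > 0" "\<And>n. (real_of_int n)\<^sup>2 * norm (fourier u n) \<le> B"
    using smooth_fourier_decay[OF s] by metis
  have "energy_density (fourier u) n \<le> B * cmod (fourier u n)" for n
  proof -
    have "real_of_int \<bar>n\<bar> \<le> (real_of_int n)\<^sup>2"
    proof (cases "n = 0")
      case False
      then have "\<bar>real_of_int n\<bar> * 1 \<le> \<bar>real_of_int n\<bar> * \<bar>real_of_int n\<bar>"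
        by (intro mult_left_mono) linarith+
      then show ?thesis by (simp add: power2_eq_square)
    qed simp
    then have "real_of_int \<bar>n\<bar> * cmod (fourier u n) \<le> (real_of_int n)\<^sup>2 * cmod (fourier u n)"
      by (rule mult_right_mono) simp
    then have "real_of_int \<bar>n\<bar> * cmod (fourier u n) * cmod (fourier u n) \<le> B * cmod (fourier u n)"
      using B(2)[of n] by (intro mult_right_mono) auto
    then show ?thesis by (simp add: power2_eq_square mult.assoc)
  qed
  then have "energy_density (fourier u) summable_on UNIV"
    by (intro summable_on_comparison[OF summable_on_cmult_right[OF smooth_fourier_abs_summable[OF s], of B]]) auto
  then show ?thesis using H_S1_fourier_0[OF assms] by (simp add: H_omega_def)
qed

lemma norm_omega_sum_le:
  "u \<in> H_S1 \<Longrightarrow> finite F \<Longrightarrow> sum (energy_density (fourier u)) F \<le> (norm_omega u)\<^sup>2"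
  unfolding norm_omega_def by (rule H_omega_sum_le[OF fourier_in_H_omega])

lemma norm_omega_nonneg: "0 \<le> norm_omega u"
  unfolding norm_omega_def by (rule norm_H_omega_nonneg)

lemma norm_omega_trig_partial:
  "(norm_omega (trig_partial a N))\<^sup>2 = sum (energy_density a) {- int N..int N}"
proof -
  have "(norm_omega (trig_partial a N))\<^sup>2 = infsum (energy_density a) {- int N..int N}"
    unfolding norm_omega_def norm_H_omega_square
    by (rule infsum_cong_neutral) (auto simp: fourier_trig_partial)
  then show ?thesis by simp
qed

lemma norm_omega_trig_partial_le:
  "a \<in> H_omega \<Longrightarrow> (norm_omega (trig_partial a N))\<^sup>2 \<le> (norm_H_omega a)\<^sup>2"
  unfolding norm_omega_trig_partial by (rule H_omega_sum_le) auto

lemma norm_omega_cnj: "norm_omega (\<lambda>z. cnj (u z)) = norm_omega u"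
proof -
  have "(\<Sum>\<^sub>\<infinity>n. energy_density (fourier (\<lambda>z. cnj (u z))) n) = (\<Sum>\<^sub>\<infinity>n. energy_density (fourier u) n)"
    by (rule infsum_reindex_bij_witness[of _ uminus uminus]) (simp_all add: fourier_cnj)
  then show ?thesis by (simp add: norm_omega_def norm_H_omega_def)
qed

lemma omega_antisym:
  assumes "smooth_circle_fun u" "smooth_circle_fun v"
  shows "omega u v = - omega v u"
proof -
  have c: "circle_cont (\<lambda>z. u z * cderiv v z)" "circle_cont (\<lambda>z. cderiv u z * v z)"
    using assms by (auto intro: circle_cont_mult smooth_imp_circle_cont smooth_circle_fun_cderiv(2))
  have "0 = mean (cderiv (\<lambda>z. u z * v z))" using mean_cderiv[OF smooth_circle_fun_mult[OF assms]] by simp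
  also have "cderiv (\<lambda>z. u z * v z) = (\<lambda>z. u z * cderiv v z + cderiv u z * v z)"
    by (rule ext) (rule cderiv_mult[OF assms])
  also have "mean \<dots> = omega u v + omega v u"
    using mean_add[OF c] by (simp add: omega_eq_mean assms mult.commute)
  finally show ?thesis by (simp add: eq_neg_iff_add_eq_0)
qed

lemma omega_chi_right:
  "smooth_circle_fun u \<Longrightarrow> omega u (chi (- m)) = - (\<i> * of_int m * fourier u m)"
  using omega_antisym[OF _ smooth_circle_fun_chi, of u "- m"] omega_chi_left[of u "- m"] by simp

lemma cauchy_schwarz_energy:
  "(\<Sum>n\<in>F. real_of_int \<bar>n\<bar> * (cmod (a n) * cmod (b n)))\<^sup>2
    \<le> sum (energy_density a) F * sum (energy_density b) F"
proof -
  let ?s = "\<lambda>n. sqrt (real_of_int \<bar>n\<bar>)"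
  have "(\<Sum>n\<in>F. (?s n * cmod (a n)) * (?s n * cmod (b n)))\<^sup>2
      \<le> (\<Sum>n\<in>F. (?s n * cmod (a n))\<^sup>2) * (\<Sum>n\<in>F. (?s n * cmod (b n))\<^sup>2)"
    by (rule Cauchy_Schwarz_ineq_sum)
  moreover have "?s n * x * (?s n * y) = real_of_int \<bar>n\<bar> * (x * y)" for n x y
  proof -
    have "?s n * x * (?s n * y) = (?s n * ?s n) * (x * y)" by (simp only: ac_simps)
    then show ?thesis by (simp only: real_sqrt_mult_self of_int_abs abs_abs)
  qed
  moreover have "(?s n)\<^sup>2 = real_of_int \<bar>n\<bar>" for n by simp
  ultimately show ?thesis by (simp only: power_mult_distrib)
qed

lemma omega_le_norm_omega:
  assumes u: "u \<in> H_S1" and v: "v \<in> H_S1"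
  shows "cmod (omega u v) \<le> norm_omega u * norm_omega v"
proof -
  let ?f = "\<lambda>n. - (\<i> * of_int n * fourier u n * fourier v (- n))"
  have "cmod (\<Sum>n\<in>{- int N..int N}. ?f n) \<le> norm_omega u * norm_omega v" for N
  proof (rule power2_le_imp_le)
    let ?I = "{- int N..int N}"
    have "cmod (\<Sum>n\<in>?I. ?f n) \<le> (\<Sum>n\<in>?I. real_of_int \<bar>n\<bar> * (cmod (fourier u n) * cmod (fourier v (- n))))"
      by (rule order_trans[OF norm_sum]) (simp add: norm_mult mult.assoc)
    then have "(cmod (\<Sum>n\<in>?I. ?f n))\<^sup>2 \<le> (\<Sum>n\<in>?I. real_of_int \<bar>n\<bar> * (cmod (fourier u n) * cmod (fourier v (- n))))\<^sup>2"
      by (rule power_mono) simp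
    also have "\<dots> \<le> sum (energy_density (fourier u)) ?I * sum (energy_density (\<lambda>n. fourier v (- n))) ?I"
      by (rule cauchy_schwarz_energy)
    also have "sum (energy_density (\<lambda>n. fourier v (- n))) ?I = sum (energy_density (fourier v)) ?I"
      by (rule sum.reindex_bij_witness[of _ uminus uminus]) auto
    also have "sum (energy_density (fourier u)) ?I * \<dots> \<le> (norm_omega u)\<^sup>2 * (norm_omega v)\<^sup>2"
      by (intro mult_mono norm_omega_sum_le u v) (auto intro: sum_nonneg)
    finally show "(cmod (\<Sum>n\<in>?I. ?f n))\<^sup>2 \<le> (norm_omega u * norm_omega v)\<^sup>2"
      by (simp add: power_mult_distrib)
  qed (simp add: norm_omega_nonneg)
  moreover have "(\<lambda>N. cmod (\<Sum>n\<in>{- int N..int N}. ?f n)) \<longlonglongrightarrow> cmod (omega u v)"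
    by (rule tendsto_norm[OF symmetric_partial_sums_tendsto[OF omega_has_sum[OF H_S1_smooth[OF u] H_S1_smooth[OF v]]]])
  ultimately show ?thesis by (intro LIMSEQ_le_const2) auto
qed

text \<open>
  The norm is attained by duality: up to a factor of modulus one, \<open>\<omega>(w, v)\<close> is the truncated energy of
  \<open>w\<close> when \<open>v\<close> is the truncation of \<open>J (cnj w)\<close>. Truncating avoids having to show that
  \<open>J\<close> preserves smoothness.
\<close>

lemma norm_omega_le_dual:
  assumes w: "w \<in> H_S1" and K: "K \<ge> 0" "\<And>v. v \<in> H_S1 \<Longrightarrow> cmod (omega w v) \<le> K * norm_omega v"
  shows "norm_omega w \<le> K"
proof (rule power2_le_imp_le[OF _ K(1)])
  \<comment> \<open>Coefficients of \<open>J (cnj w)\<close> up to a constant factor.\<close>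
  define b where "b n = of_int (sgn (- n)) * cnj (fourier w (- n))" for n
  have "sum (energy_density (fourier w)) {- int N..int N} \<le> K\<^sup>2" for N
  proof -
    let ?I = "{- int N..int N}"
    define S where "S = sum (energy_density (fourier w)) ?I"
    have S0: "S \<ge> 0" unfolding S_def by (rule sum_nonneg) simp
    have v: "trig_partial b N \<in> H_S1" by (rule H_S1_trig_partial) (simp add: b_def)
    have "omega w (trig_partial b N) = - omega (trig_partial b N) w"
      by (rule omega_antisym[OF H_S1_smooth[OF w] smooth_trig_partial])
    also have "\<dots> = (\<Sum>n\<in>?I. \<i> * of_int n * b n * fourier w (- n))"
      by (simp add: omega_trig_partial_left[OF H_S1_smooth[OF w]] sum_negf)
    also have "\<dots> = (\<Sum>n\<in>?I. - (\<i> * of_real (energy_density (fourier w) (- n))))"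
    proof (rule sum.cong[OF refl])
      fix n
      have *: "of_int n * of_int (sgn (- n)) = - complex_of_real (real_of_int \<bar>n\<bar>)"
        by (auto simp: sgn_if)
      then show "\<i> * of_int n * b n * fourier w (- n) = - (\<i> * of_real (energy_density (fourier w) (- n)))"
      proof -
        have "\<i> * of_int n * b n * fourier w (- n) =
            \<i> * (of_int n * of_int (sgn (- n))) * (fourier w (- n) * cnj (fourier w (- n)))"
          unfolding b_def by (simp only: ac_simps)
        also have "\<dots> = \<i> * - complex_of_real (real_of_int \<bar>n\<bar>) * complex_of_real ((cmod (fourier w (- n)))\<^sup>2)"
          unfolding * complex_norm_square ..
        finally show ?thesis by simp
      qed
    qed
    also have "\<dots> = - (\<i> * of_real (\<Sum>n\<in>?I. energy_density (fourier w) (- n)))"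
      by (simp add: sum_negf sum_distrib_left)
    also have "(\<Sum>n\<in>?I. energy_density (fourier w) (- n)) = S"
      unfolding S_def by (rule sum.reindex_bij_witness[of _ uminus uminus]) auto
    finally have "cmod (omega w (trig_partial b N)) = S" using S0 by (simp add: norm_mult)
    moreover have "sum (energy_density b) ?I = S"
      unfolding S_def
      by (rule sum.reindex_bij_witness[of _ uminus uminus]) (auto simp: b_def norm_mult sgn_if)
    then have "norm_omega (trig_partial b N) = sqrt S"
      using norm_omega_trig_partial[of b N] norm_omega_nonneg by (metis real_sqrt_unique)
    ultimately have "S \<le> K * sqrt S" using K(2)[OF v] by simp
    then have "sqrt S * sqrt S \<le> K * sqrt S" using S0 by simp
    then have "sqrt S \<le> K"
      using S0 K(1) mult_right_le_imp_le[of "sqrt S" "sqrt S" K] by (cases "S = 0") auto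
    then have "(sqrt S)\<^sup>2 \<le> K\<^sup>2" using S0 by (intro power_mono) auto
    then show ?thesis using S0 by (simp add: S_def)
  qed
  then show "(norm_omega w)\<^sup>2 \<le> K\<^sup>2"
    unfolding norm_omega_def by (rule H_omegaI(2)) (rule H_S1_fourier_0[OF w])
qed

section \<open>Operators on \<open>H_S1\<close> and their matrices\<close>

definition H_linear :: "((circle \<Rightarrow> complex) \<Rightarrow> (circle \<Rightarrow> complex)) \<Rightarrow> bool" where
  "H_linear A \<longleftrightarrow> (\<forall>u\<in>H_S1. A u \<in> H_S1) \<and> linear_on_H A"

definition matrix_entry :: "((circle \<Rightarrow> complex) \<Rightarrow> (circle \<Rightarrow> complex)) \<Rightarrow> int \<Rightarrow> int \<Rightarrow> complex" where
  "matrix_entry A m n = fourier (A (chi n)) m"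

lemma H_linear_maps: "H_linear A \<Longrightarrow> u \<in> H_S1 \<Longrightarrow> A u \<in> H_S1"
  by (simp add: H_linear_def)

lemma H_linear_add: "H_linear A \<Longrightarrow> u \<in> H_S1 \<Longrightarrow> v \<in> H_S1 \<Longrightarrow> A (\<lambda>z. u z + v z) = (\<lambda>z. A u z + A v z)"
  by (simp add: H_linear_def linear_on_H_def)

lemma H_linear_cmult: "H_linear A \<Longrightarrow> u \<in> H_S1 \<Longrightarrow> A (\<lambda>z. c * u z) = (\<lambda>z. c * A u z)"
  by (simp add: H_linear_def linear_on_H_def)

lemma H_linear_zero: "H_linear A \<Longrightarrow> A (\<lambda>z. 0) = (\<lambda>z. 0)"
  using H_linear_cmult[of A "\<lambda>z. 0" 0] H_S1_zero by simp

lemma H_linear_diff: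
  assumes "H_linear A" "u \<in> H_S1" "v \<in> H_S1"
  shows "A (\<lambda>z. u z - v z) = (\<lambda>z. A u z - A v z)"
  using H_linear_add[OF assms(1,2) H_S1_cmult[OF assms(3), of "- 1"]] H_linear_cmult[OF assms(1,3), of "- 1"]
  by simp

lemma H_linear_sum:
  assumes A: "H_linear A" and "finite I" "\<And>i. i \<in> I \<Longrightarrow> u i \<in> H_S1"
  shows "(\<lambda>z. \<Sum>i\<in>I. u i z) \<in> H_S1 \<and> A (\<lambda>z. \<Sum>i\<in>I. u i z) = (\<lambda>z. \<Sum>i\<in>I. A (u i) z)"
  using assms(2,3)
proof (induction I)
  case empty
  show ?case by (simp add: H_S1_zero H_linear_zero[OF A])
next
  case (insert i I)
  then have IH: "(\<lambda>z. \<Sum>i\<in>I. u i z) \<in> H_S1" "A (\<lambda>z. \<Sum>i\<in>I. u i z) = (\<lambda>z. \<Sum>i\<in>I. A (u i) z)"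
    and i: "u i \<in> H_S1" by auto
  show ?case
    using insert.hyps H_S1_add[OF i IH(1)] H_linear_add[OF A i IH(1)] by (simp add: IH(2))
qed

text \<open>
  The entry in column \<open>0\<close> has no meaning, as the constant \<open>chi 0\<close> is not in \<open>H_S1\<close>; the condition
  \<open>a 0 = 0\<close> makes it irrelevant.
\<close>

lemma fourier_op_trig_partial:
  assumes A: "H_linear A" and a: "a 0 = 0"
  shows "fourier (A (trig_partial a N)) m = (\<Sum>n\<in>{- int N..int N}. a n * matrix_entry A m n)"
proof -
  let ?I = "{- int N..int N} - {0}"
  have mem: "(\<lambda>z. a n * chi n z) \<in> H_S1" if "n \<in> ?I" for n
    using that by (intro H_S1_cmult H_S1_chi) auto
  have "trig_partial a N = (\<lambda>z. \<Sum>n\<in>?I. a n * chi n z)"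
    unfolding trig_partial_chi by (rule ext) (rule sum.mono_neutral_right, auto simp: a)
  then have "fourier (A (trig_partial a N)) m = fourier (\<lambda>z. \<Sum>n\<in>?I. A (\<lambda>z. a n * chi n z) z) m"
    using H_linear_sum[OF A, of ?I "\<lambda>n z. a n * chi n z"] mem by simp
  also have "\<dots> = (\<Sum>n\<in>?I. fourier (A (\<lambda>z. a n * chi n z)) m)"
    by (rule fourier_sum) (rule H_S1_cont[OF H_linear_maps[OF A mem]])
  also have "\<dots> = (\<Sum>n\<in>?I. a n * matrix_entry A m n)"
    by (rule sum.cong) (auto simp: H_linear_cmult[OF A H_S1_chi] matrix_entry_def)
  also have "\<dots> = (\<Sum>n\<in>{- int N..int N}. a n * matrix_entry A m n)"
    by (rule sum.mono_neutral_left) (auto simp: a)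
  finally show ?thesis .
qed

lemma bounded_on_H_iff:
  "bounded_on_H A \<longleftrightarrow> (\<exists>K\<ge>0. \<forall>u\<in>H_S1. (norm_omega (A u))\<^sup>2 \<le> K * (norm_omega u)\<^sup>2)"
proof
  assume "bounded_on_H A"
  then obtain C where C: "\<And>u. u \<in> H_S1 \<Longrightarrow> norm_omega (A u) \<le> C * norm_omega u"
    unfolding bounded_on_H_def by blast
  have "(norm_omega (A u))\<^sup>2 \<le> C\<^sup>2 * (norm_omega u)\<^sup>2" if "u \<in> H_S1" for u
    using power_mono[OF C[OF that] norm_omega_nonneg, of 2] by (simp add: power_mult_distrib)
  then show "\<exists>K\<ge>0. \<forall>u\<in>H_S1. (norm_omega (A u))\<^sup>2 \<le> K * (norm_omega u)\<^sup>2"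
    by (intro exI[of _ "C\<^sup>2"]) auto
next
  assume "\<exists>K\<ge>0. \<forall>u\<in>H_S1. (norm_omega (A u))\<^sup>2 \<le> K * (norm_omega u)\<^sup>2"
  then obtain K where K: "K \<ge> 0" "\<And>u. u \<in> H_S1 \<Longrightarrow> (norm_omega (A u))\<^sup>2 \<le> K * (norm_omega u)\<^sup>2"
    by blast
  have "norm_omega (A u) \<le> sqrt K * norm_omega u" if "u \<in> H_S1" for u
    by (rule power2_le_imp_le) (use K that in \<open>auto simp: power_mult_distrib norm_omega_nonneg\<close>)
  then show "bounded_on_H A" unfolding bounded_on_H_def by blast
qed

text \<open>
  For finite \<open>P\<close> and \<open>Q\<close>, the squared Hilbert-Schmidt norm of the corresponding finite submatrix. The
  weights \<open>\<bar>m\<bar>\<close> and \<open>1 / \<bar>k\<bar>\<close> come from normalising the exponentials in the energy norm.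
\<close>

definition block_sum :: "((circle \<Rightarrow> complex) \<Rightarrow> (circle \<Rightarrow> complex)) \<Rightarrow> int set \<Rightarrow> int set \<Rightarrow> real" where
  "block_sum A P Q =
     (\<Sum>k\<in>P. (\<Sum>m\<in>Q. real_of_int \<bar>m\<bar> * (cmod (matrix_entry A m k))\<^sup>2) / real_of_int \<bar>k\<bar>)"

definition HS_bounded :: "((circle \<Rightarrow> complex) \<Rightarrow> (circle \<Rightarrow> complex)) \<Rightarrow> bool" where
  "HS_bounded A \<longleftrightarrow> (\<exists>K. \<forall>P Q. finite P \<longrightarrow> P \<subseteq> {..<0} \<longrightarrow> finite Q \<longrightarrow> Q \<subseteq> {0<..} \<longrightarrow>
     block_sum A P Q \<le> K)"

lemma basis_vec_H_omega: "k \<noteq> 0 \<Longrightarrow> basis_vec k \<in> H_omega"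
proof -
  assume "k \<noteq> 0"
  have "(\<lambda>n. energy_density (basis_vec k) n) summable_on {k}" by simp
  then have "(\<lambda>n. energy_density (basis_vec k) n) summable_on UNIV"
    by (rule summable_on_cong_neutral[THEN iffD1, rotated -1]) (auto simp: basis_vec_def)
  then show ?thesis using \<open>k \<noteq> 0\<close> by (simp add: H_omega_def basis_vec_def)
qed

lemma extension_zero:
  assumes "H_linear A"
  shows "extension A (\<lambda>n. 0) = (\<lambda>m. 0)"
proof -
  have "trig_partial (\<lambda>n. 0) N = (\<lambda>z. 0)" for N by (simp add: trig_partial_def)
  then show ?thesis
    by (simp add: extension_def H_omega_def H_linear_zero[OF assms] fourier_zero)
qed

lemma extension_basis_vec:
  assumes A: "H_linear A" and k: "k \<noteq> 0"
  shows "extension A (basis_vec k) m = of_real (1 / sqrt (of_int \<bar>k\<bar>)) * matrix_entry A m k"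
proof -
  have "fourier (A (trig_partial (basis_vec k) N)) m = of_real (1 / sqrt (of_int \<bar>k\<bar>)) * matrix_entry A m k"
    if "N \<ge> nat \<bar>k\<bar>" for N
  proof -
    have "fourier (A (trig_partial (basis_vec k) N)) m =
        (\<Sum>n\<in>{- int N..int N}. basis_vec k n * matrix_entry A m n)"
      by (rule fourier_op_trig_partial[OF A]) (use k in \<open>simp add: basis_vec_def\<close>)
    also have "\<dots> =
        (\<Sum>n\<in>{- int N..int N}. if n = k then of_real (1 / sqrt (of_int \<bar>k\<bar>)) * matrix_entry A m k else 0)"
      by (rule sum.cong) (simp_all add: basis_vec_def)
    moreover have "k \<in> {- int N..int N}" using that by auto
    ultimately show ?thesis by simp
  qed
  then have "(\<lambda>N. fourier (A (trig_partial (basis_vec k) N)) m) \<longlonglongrightarrow>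
      of_real (1 / sqrt (of_int \<bar>k\<bar>)) * matrix_entry A m k"
    by (intro tendsto_eventually eventually_sequentiallyI)
  then show ?thesis using basis_vec_H_omega[OF k] by (simp add: extension_def limI)
qed

lemma matrix_column_H_omega:
  assumes "H_linear A" "k \<noteq> 0"
  shows "(\<lambda>m. matrix_entry A m k) \<in> H_omega"
  unfolding matrix_entry_def using fourier_in_H_omega[OF H_linear_maps[OF assms(1) H_S1_chi[OF assms(2)]]] .

lemma proj_pos_H_omega:
  assumes "a \<in> H_omega"
  shows "proj_pos a \<in> H_omega"
proof -
  have "energy_density (proj_pos a) summable_on UNIV"
    by (rule summable_on_comparison[of "energy_density a"]) (use assms in \<open>auto simp: H_omega_def proj_pos_def mult_le_0_iff\<close>)
  then show ?thesis by (simp add: H_omega_def proj_pos_def)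
qed

text \<open>
  On a basis vector the sequence that defines the continuous extension is eventually constant, with the
  image under the operator itself as its value. So the Hilbert-Schmidt norm becomes a double sum over matrix entries. Uniform bounds on finite blocks
  are easier to carry through limits than iterated infinite sums.
\<close>

lemma hilbert_schmidt_iff_HS_bounded:
  assumes A: "H_linear A"
  shows "hilbert_schmidt (\<lambda>a. proj_pos (extension A (proj_neg a))) \<longleftrightarrow> HS_bounded A"
proof -
  define col where "col k = proj_pos (\<lambda>m. matrix_entry A m k)" for k
  define c where "c k = (norm_H_omega (col k))\<^sup>2 / real_of_int \<bar>k\<bar>" for k
  define r where "r k Q = (\<Sum>m\<in>Q. real_of_int \<bar>m\<bar> * (cmod (matrix_entry A m k))\<^sup>2) / real_of_int \<bar>k\<bar>" for k Q
  have c0: "0 \<le> c k" for k by (simp add: c_def)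
  have colH: "col k \<in> H_omega" if "k \<noteq> 0" for k
    unfolding col_def by (rule proj_pos_H_omega[OF matrix_column_H_omega[OF A that]])
  have neg: "(norm_H_omega (proj_pos (extension A (proj_neg (basis_vec k)))))\<^sup>2 = c k" if "k < 0" for k
  proof -
    have pn: "proj_neg (basis_vec k) = basis_vec k" using that by (auto simp: proj_neg_def basis_vec_def)
    have "energy_density (proj_pos (extension A (basis_vec k))) m = energy_density (col k) m / real_of_int \<bar>k\<bar>" for m
      using that by (auto simp: proj_pos_def col_def extension_basis_vec[OF A] norm_mult norm_divide power_mult_distrib power_divide)
    then show ?thesis
      unfolding pn norm_H_omega_square c_def by (simp only: infsum_cmult_left' divide_inverse)
  qed
  have pos: "(norm_H_omega (proj_pos (extension A (proj_neg (basis_vec k)))))\<^sup>2 = 0" if "k > 0" for k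
  proof -
    have "proj_neg (basis_vec k) = (\<lambda>n. 0)" using that by (auto simp: proj_neg_def basis_vec_def)
    then show ?thesis by (simp add: extension_zero[OF A] norm_H_omega_square proj_pos_def)
  qed
  have "hilbert_schmidt (\<lambda>a. proj_pos (extension A (proj_neg a))) \<longleftrightarrow> c summable_on {..<0}"
    unfolding hilbert_schmidt_def
    by (rule summable_on_cong_neutral) (use neg pos in \<open>auto simp: not_less order_less_le\<close>)
  also have "\<dots> \<longleftrightarrow> HS_bounded A"
  proof
    assume s: "c summable_on {..<0}"
    have "block_sum A P Q \<le> infsum c {..<0}" if "finite P" "P \<subseteq> {..<0}" "finite Q" "Q \<subseteq> {0<..}" for P Q
    proof -
      have "r k Q \<le> c k" if "k \<in> P" for k
      proof -
        have "k \<noteq> 0" using that \<open>P \<subseteq> {..<0}\<close> by auto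
        have "(\<Sum>m\<in>Q. real_of_int \<bar>m\<bar> * (cmod (matrix_entry A m k))\<^sup>2) = sum (energy_density (col k)) Q"
          by (rule sum.cong) (use \<open>Q \<subseteq> {0<..}\<close> in \<open>auto simp: col_def proj_pos_def\<close>)
        also have "\<dots> \<le> (norm_H_omega (col k))\<^sup>2" by (rule H_omega_sum_le[OF colH[OF \<open>k \<noteq> 0\<close>] \<open>finite Q\<close>])
        finally show ?thesis unfolding r_def c_def by (rule divide_right_mono) simp
      qed
      then have "(\<Sum>k\<in>P. r k Q) \<le> (\<Sum>k\<in>P. c k)" by (rule sum_mono)
      also have "\<dots> \<le> infsum c {..<0}"
        by (rule finite_sum_le_infsum[OF s that(1,2)]) (rule c0)
      finally show ?thesis by (simp only: block_sum_def r_def)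
    qed
    then show "HS_bounded A" unfolding HS_bounded_def by blast
  next
    assume "HS_bounded A"
    then obtain K where "\<And>P Q. finite P \<Longrightarrow> P \<subseteq> {..<0} \<Longrightarrow> finite Q \<Longrightarrow> Q \<subseteq> {0<..} \<Longrightarrow> block_sum A P Q \<le> K"
      unfolding HS_bounded_def by blast
    then have K: "(\<Sum>k\<in>P. r k Q) \<le> K"
      if "finite P" "P \<subseteq> {..<0}" "finite Q" "Q \<subseteq> {0<..}" for P Q
      using that by (simp add: block_sum_def r_def)
    have "sum c P \<le> K" if P: "finite P" "P \<subseteq> {..<0}" for P
    proof (rule LIMSEQ_le_const2)
      have lim: "(\<lambda>N. r k {0<..int N}) \<longlonglongrightarrow> c k" if "k \<in> P" for k
      proof -
        have "k \<noteq> 0" using that P(2) by auto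
        then have "(energy_density (col k) has_sum (norm_H_omega (col k))\<^sup>2) UNIV"
          using colH unfolding norm_H_omega_square H_omega_def by simp
        from symmetric_partial_sums_tendsto[OF this]
        have "(\<lambda>N. sum (energy_density (col k)) {- int N..int N}) \<longlonglongrightarrow> (norm_H_omega (col k))\<^sup>2" .
        moreover have "sum (energy_density (col k)) {- int N..int N} =
            (\<Sum>m\<in>{0<..int N}. real_of_int \<bar>m\<bar> * (cmod (matrix_entry A m k))\<^sup>2)" for N
          by (rule sum.mono_neutral_cong_right) (auto simp: col_def proj_pos_def)
        ultimately have "(\<lambda>N. \<Sum>m\<in>{0<..int N}. real_of_int \<bar>m\<bar> * (cmod (matrix_entry A m k))\<^sup>2)
            \<longlonglongrightarrow> (norm_H_omega (col k))\<^sup>2" by (simp only:)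
        then show ?thesis
          unfolding r_def c_def by (rule tendsto_divide[OF _ tendsto_const]) (use \<open>k \<noteq> 0\<close> in simp)
      qed
      then show "(\<lambda>N. \<Sum>k\<in>P. r k {0<..int N}) \<longlonglongrightarrow> sum c P" by (rule tendsto_sum)
      show "\<exists>N. \<forall>n\<ge>N. (\<Sum>k\<in>P. r k {0<..int n}) \<le> K"
        by (rule exI[of _ 0]) (intro allI impI K P, auto)
    qed
    then show "c summable_on {..<0}"
      by (intro nonneg_bdd_above_summable_on bdd_aboveI2[where M = K]) (auto simp: c0)
  qed
  finally show ?thesis .
qed

section \<open>The group \<open>Sp_infinity\<close>\<close>

abbreviation real_op :: "((circle \<Rightarrow> complex) \<Rightarrow> (circle \<Rightarrow> complex)) \<Rightarrow> bool" where
  "real_op A \<equiv> \<forall>u\<in>H_S1. A u = conj_op A u"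

abbreviation symplectic :: "((circle \<Rightarrow> complex) \<Rightarrow> (circle \<Rightarrow> complex)) \<Rightarrow> bool" where
  "symplectic A \<equiv> \<forall>u\<in>H_S1. \<forall>v\<in>H_S1. omega (A u) (A v) = omega u v"

lemma Sp_infinity_carrier:
  "A \<in> carrier Sp_infinity \<longleftrightarrow>
     A \<in> Bij H_S1 \<and> H_linear A \<and> bounded_on_H A \<and> real_op A \<and> symplectic A \<and> HS_bounded A"
proof -
  have "A \<in> Bij H_S1 \<Longrightarrow> linear_on_H A \<longleftrightarrow> H_linear A"
    using Bij_imp_funcset[of A H_S1] by (auto simp: H_linear_def)
  then show ?thesis
    unfolding Sp_infinity_def using hilbert_schmidt_iff_HS_bounded[of A] by auto
qed

definition omega_adjoint ::
  "((circle \<Rightarrow> complex) \<Rightarrow> (circle \<Rightarrow> complex)) \<Rightarrow> ((circle \<Rightarrow> complex) \<Rightarrow> (circle \<Rightarrow> complex)) \<Rightarrow> bool" where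
  "omega_adjoint A A' \<longleftrightarrow> (\<forall>u\<in>H_S1. \<forall>v\<in>H_S1. omega (A' u) v = omega u (A v))"

lemma symplectic_inverse_adjoint:
  assumes "symplectic A" "\<And>u. u \<in> H_S1 \<Longrightarrow> A' u \<in> H_S1" "\<And>u. u \<in> H_S1 \<Longrightarrow> A (A' u) = u"
  shows "omega_adjoint A A'"
  unfolding omega_adjoint_def using assms by metis

text \<open>
  Pairing with exponentials reads off Fourier coefficients, so passing to the \<open>\<omega>\<close>-adjoint transposes
  the matrix and changes the signs of both indices. In particular rows \<open>m > 0\<close> and columns \<open>k < 0\<close>
  correspond to rows \<open>- k > 0\<close> and columns \<open>- m < 0\<close> of the same kind.
\<close>

lemma omega_adjoint_matrix:
  assumes adj: "omega_adjoint A A'" and A: "H_linear A" and A': "H_linear A'" and nz: "k \<noteq> 0" "m \<noteq> 0"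
  shows "of_int m * matrix_entry A' m k = of_int k * matrix_entry A (- k) (- m)"
proof -
  have c: "chi k \<in> H_S1" "chi (- m) \<in> H_S1" using nz by (auto intro: H_S1_chi)
  have "- (\<i> * of_int m * fourier (A' (chi k)) m) = omega (A' (chi k)) (chi (- m))"
    by (rule omega_chi_right[OF H_S1_smooth[OF H_linear_maps[OF A' c(1)]], symmetric])
  also have "\<dots> = omega (chi k) (A (chi (- m)))"
    using adj c by (simp add: omega_adjoint_def)
  also have "\<dots> = - (\<i> * of_int k * fourier (A (chi (- m))) (- k))"
    by (rule omega_chi_left[OF H_S1_smooth[OF H_linear_maps[OF A c(2)]]])
  finally have "\<i> * (of_int m * matrix_entry A' m k) = \<i> * (of_int k * matrix_entry A (- k) (- m))"
    by (simp add: matrix_entry_def)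
  then show ?thesis by (metis complex_i_not_zero mult_left_cancel)
qed

lemma omega_adjoint_bounded:
  assumes adj: "omega_adjoint A A'" and A: "H_linear A" and A': "H_linear A'" and b: "bounded_on_H A"
  shows "bounded_on_H A'"
proof -
  obtain K where K: "K \<ge> 0" "\<And>u. u \<in> H_S1 \<Longrightarrow> (norm_omega (A u))\<^sup>2 \<le> K * (norm_omega u)\<^sup>2"
    using b unfolding bounded_on_H_iff by blast
  have bA: "norm_omega (A v) \<le> sqrt K * norm_omega v" if "v \<in> H_S1" for v
    by (rule power2_le_imp_le) (use K that in \<open>auto simp: power_mult_distrib norm_omega_nonneg\<close>)
  have "norm_omega (A' u) \<le> sqrt K * norm_omega u" if u: "u \<in> H_S1" for u
  proof (rule norm_omega_le_dual[OF H_linear_maps[OF A' u]])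
    show "0 \<le> sqrt K * norm_omega u" using K(1) by (simp add: norm_omega_nonneg)
    fix v assume v: "v \<in> H_S1"
    have "cmod (omega (A' u) v) = cmod (omega u (A v))" using adj u v by (simp add: omega_adjoint_def)
    also have "\<dots> \<le> norm_omega u * norm_omega (A v)" by (rule omega_le_norm_omega[OF u H_linear_maps[OF A v]])
    also have "\<dots> \<le> norm_omega u * (sqrt K * norm_omega v)" by (rule mult_left_mono[OF bA[OF v] norm_omega_nonneg])
    finally show "cmod (omega (A' u) v) \<le> sqrt K * norm_omega u * norm_omega v" by (simp add: ac_simps)
  qed
  then show ?thesis unfolding bounded_on_H_def by blast
qed

text \<open>
  By the previous reflection the block of \<open>A'\<close> is a rearrangement of the block of \<open>A\<close>, and the weights
  agree because \<open>m\<^sup>2 \<bar>A'\<^sub>m\<^sub>k\<bar>\<^sup>2\<close> equals \<open>k\<^sup>2\<close> times the reflected entry squared.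
\<close>

lemma omega_adjoint_HS_bounded:
  assumes adj: "omega_adjoint A A'" and A: "H_linear A" and A': "H_linear A'" and HS: "HS_bounded A"
  shows "HS_bounded A'"
proof -
  obtain K where K: "\<And>P Q. finite P \<Longrightarrow> P \<subseteq> {..<0} \<Longrightarrow> finite Q \<Longrightarrow> Q \<subseteq> {0<..} \<Longrightarrow>
     block_sum A P Q \<le> K"
    using HS unfolding HS_bounded_def by blast
  have "block_sum A' P Q \<le> K"
    if P: "finite P" "P \<subseteq> {..<0}" and Q: "finite Q" "Q \<subseteq> {0<..}" for P Q
  proof -
    have entry: "real_of_int \<bar>m\<bar> * (cmod (matrix_entry A' m k))\<^sup>2 / real_of_int \<bar>k\<bar> =
        real_of_int \<bar>- k\<bar> * (cmod (matrix_entry A (- k) (- m)))\<^sup>2 / real_of_int \<bar>- m\<bar>"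
      if "k \<in> P" "m \<in> Q" for k m
    proof -
      have nz: "k \<noteq> 0" "m \<noteq> 0" using that P Q by auto
      have "cmod (of_int m * matrix_entry A' m k) = cmod (of_int k * matrix_entry A (- k) (- m))"
        by (simp add: omega_adjoint_matrix[OF adj A A' nz])
      then have "\<bar>real_of_int m\<bar> * cmod (matrix_entry A' m k) = \<bar>real_of_int k\<bar> * cmod (matrix_entry A (- k) (- m))"
        by (simp add: norm_mult)
      then have "\<bar>real_of_int m\<bar>\<^sup>2 * (cmod (matrix_entry A' m k))\<^sup>2 =
          \<bar>real_of_int k\<bar>\<^sup>2 * (cmod (matrix_entry A (- k) (- m)))\<^sup>2"
        by (metis power_mult_distrib)
      then show ?thesis using nz by (simp add: power2_eq_square field_simps)
    qed
    have "block_sum A' P Q =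
        (\<Sum>k\<in>P. \<Sum>m\<in>Q. real_of_int \<bar>- k\<bar> * (cmod (matrix_entry A (- k) (- m)))\<^sup>2 / real_of_int \<bar>- m\<bar>)"
      unfolding block_sum_def sum_divide_distrib by (intro sum.cong refl entry)
    also have "\<dots> = (\<Sum>m\<in>Q. \<Sum>k\<in>P. real_of_int \<bar>- k\<bar> * (cmod (matrix_entry A (- k) (- m)))\<^sup>2 / real_of_int \<bar>- m\<bar>)"
      by (rule sum.swap)
    also have "\<dots> = block_sum A (uminus ` Q) (uminus ` P)"
      unfolding block_sum_def sum_divide_distrib
      by (simp only: sum.reindex[OF inj_on_subset[OF inj_uminus subset_UNIV]] o_def)
    also have "\<dots> \<le> K"
      by (rule K) (use P Q in auto)
    finally show ?thesis .
  qed
  then show ?thesis unfolding HS_bounded_def by blast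
qed

lemma truncated_op_bound:
  assumes A: "H_linear A" and K: "\<And>u. u \<in> H_S1 \<Longrightarrow> (norm_omega (A u))\<^sup>2 \<le> K * (norm_omega u)\<^sup>2"
    and a: "a 0 = 0" and Q: "finite Q"
  shows "(\<Sum>m\<in>Q. real_of_int \<bar>m\<bar> * (cmod (\<Sum>n\<in>{- int N..int N}. a n * matrix_entry A m n))\<^sup>2)
     \<le> K * sum (energy_density a) {- int N..int N}"
  using order_trans[OF norm_omega_sum_le[OF H_linear_maps[OF A H_S1_trig_partial[of a, OF a]] Q] K[OF H_S1_trig_partial[of a, OF a]]]
  by (simp only: fourier_op_trig_partial[OF A, of a, OF a] norm_omega_trig_partial)

text \<open>
  A bounded operator is determined by its matrix: the truncation error of \<open>w\<close> tends to zero in the energy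
  norm, hence so does each Fourier coefficient of its image.
\<close>

lemma op_matrix_expansion:
  assumes A: "H_linear A" and b: "bounded_on_H A" and w: "w \<in> H_S1" and m: "m \<noteq> 0"
  shows "(\<lambda>N. \<Sum>n\<in>{- int N..int N}. fourier w n * matrix_entry A m n) \<longlonglongrightarrow> fourier (A w) m"
proof -
  obtain K where K: "K \<ge> 0" "\<And>u. u \<in> H_S1 \<Longrightarrow> (norm_omega (A u))\<^sup>2 \<le> K * (norm_omega u)\<^sup>2"
    using b unfolding bounded_on_H_iff by blast
  let ?I = "\<lambda>N. {- int N..int N}"
  have t: "trig_partial (fourier w) N \<in> H_S1" for N
    by (rule H_S1_trig_partial[of "fourier w", OF H_S1_fourier_0[OF w]])
  have d: "(\<lambda>z. w z - trig_partial (fourier w) N z) \<in> H_S1" for N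
    by (rule H_S1_diff[OF w t])
  define R where "R N = (norm_omega w)\<^sup>2 - sum (energy_density (fourier w)) (?I N)" for N
  have wH: "energy_density (fourier w) summable_on UNIV"
    using fourier_in_H_omega[OF w] by (simp add: H_omega_def)
  have "(\<lambda>N. sum (energy_density (fourier w)) (?I N)) \<longlonglongrightarrow> (norm_omega w)\<^sup>2"
    unfolding norm_omega_def norm_H_omega_square
    by (rule symmetric_partial_sums_tendsto[OF has_sum_infsum[OF wH]])
  from tendsto_diff[OF tendsto_const[of "(norm_omega w)\<^sup>2"] this] have R0: "R \<longlonglongrightarrow> 0" unfolding R_def by simp
  have nd: "(norm_omega (\<lambda>z. w z - trig_partial (fourier w) N z))\<^sup>2 = R N" for N
  proof -
    have "(norm_omega (\<lambda>z. w z - trig_partial (fourier w) N z))\<^sup>2 = infsum (energy_density (fourier w)) (UNIV - ?I N)"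
      unfolding norm_omega_def norm_H_omega_square
      by (rule infsum_cong_neutral) (auto simp: fourier_diff H_S1_cont w t fourier_trig_partial)
    also have "\<dots> = R N"
      using infsum_Diff[OF wH, of "?I N"] by (simp add: R_def norm_omega_def norm_H_omega_square)
    finally show ?thesis .
  qed
  have close: "(cmod (fourier (A w) m - (\<Sum>n\<in>?I N. fourier w n * matrix_entry A m n)))\<^sup>2 \<le> K * R N" for N
  proof -
    have e: "fourier (A w) m - (\<Sum>n\<in>?I N. fourier w n * matrix_entry A m n) =
        fourier (A (\<lambda>z. w z - trig_partial (fourier w) N z)) m"
      by (simp only: H_linear_diff[OF A w t] fourier_diff[OF H_S1_cont[OF H_linear_maps[OF A w]] H_S1_cont[OF H_linear_maps[OF A t]]]
         fourier_op_trig_partial[OF A, of "fourier w", OF H_S1_fourier_0[OF w]])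
    let ?x = "fourier (A (\<lambda>z. w z - trig_partial (fourier w) N z)) m"
    have "1 * (cmod ?x)\<^sup>2 \<le> real_of_int \<bar>m\<bar> * (cmod ?x)\<^sup>2"
      using m by (intro mult_right_mono) auto
    also have "\<dots> \<le> (norm_omega (A (\<lambda>z. w z - trig_partial (fourier w) N z)))\<^sup>2"
      using norm_omega_sum_le[OF H_linear_maps[OF A d[of N]], of "{m}"] by simp
    also have "\<dots> \<le> K * R N" using K(2)[OF d[of N]] by (simp only: nd)
    finally show ?thesis unfolding e by simp
  qed
  have "(\<lambda>N. K * R N) \<longlonglongrightarrow> 0" using tendsto_mult_right_zero[OF R0] .
  then have "(\<lambda>N. (cmod (fourier (A w) m - (\<Sum>n\<in>?I N. fourier w n * matrix_entry A m n)))\<^sup>2) \<longlonglongrightarrow> 0"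
    by (rule Lim_null_comparison[rotated]) (use close in \<open>auto intro: always_eventually\<close>)
  from tendsto_real_sqrt[OF this]
  have "(\<lambda>N. fourier (A w) m - (\<Sum>n\<in>?I N. fourier w n * matrix_entry A m n)) \<longlonglongrightarrow> 0"
    by (simp add: tendsto_norm_zero_iff)
  from tendsto_diff[OF tendsto_const[of "fourier (A w) m"] this] show ?thesis by simp
qed

text \<open>
  The entry of \<open>A B\<close> in row \<open>m\<close> and column \<open>k\<close> is split according to the sign of the summation index.
  The part \<open>X\<close> with positive index applies the bounded operator \<open>A\<close> to the positive part of a column
  of \<open>B\<close>. In the part with negative index both matrices are replaced by those of their adjoints, which
  turns it into \<open>k / m\<close> times \<open>Y\<close>, where the bounded operator \<open>B'\<close> acts on the positive part of a
  column of \<open>A'\<close>. All sums are truncated at \<open>N\<close>, with bounds that are uniform in \<open>N\<close>.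
\<close>

lemma HS_bounded_compose:
  assumes A: "H_linear A" and B: "H_linear B" and A': "H_linear A'" and B': "H_linear B'"
    and adjA: "omega_adjoint A A'" and adjB: "omega_adjoint B B'"
    and bA: "bounded_on_H A" and bB': "bounded_on_H B'"
    and HSB: "HS_bounded B" and HSA': "HS_bounded A'"
    and C: "\<And>u. u \<in> H_S1 \<Longrightarrow> C u = A (B u)"
  shows "HS_bounded C"
proof -
  obtain KA where KA: "KA \<ge> 0" "\<And>u. u \<in> H_S1 \<Longrightarrow> (norm_omega (A u))\<^sup>2 \<le> KA * (norm_omega u)\<^sup>2"
    using bA unfolding bounded_on_H_iff by blast
  obtain KB where KB: "KB \<ge> 0" "\<And>u. u \<in> H_S1 \<Longrightarrow> (norm_omega (B' u))\<^sup>2 \<le> KB * (norm_omega u)\<^sup>2"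
    using bB' unfolding bounded_on_H_iff by blast
  obtain HB where HB: "\<And>P Q. finite P \<Longrightarrow> P \<subseteq> {..<0} \<Longrightarrow> finite Q \<Longrightarrow> Q \<subseteq> {0<..} \<Longrightarrow> block_sum B P Q \<le> HB"
    using HSB unfolding HS_bounded_def by blast
  obtain HA where HA: "\<And>P Q. finite P \<Longrightarrow> P \<subseteq> {..<0} \<Longrightarrow> finite Q \<Longrightarrow> Q \<subseteq> {0<..} \<Longrightarrow> block_sum A' P Q \<le> HA"
    using HSA' unfolding HS_bounded_def by blast
  define X where "X N m k = (\<Sum>n\<in>{- int N..int N}. proj_pos (\<lambda>n. matrix_entry B n k) n * matrix_entry A m n)" for N m k
  define Y where "Y N m k = (\<Sum>j\<in>{- int N..int N}. proj_pos (\<lambda>j. matrix_entry A' j (- m)) j * matrix_entry B' (- k) j)" for N m k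
  have split: "(\<Sum>n\<in>{- int N..int N}. fourier (B (chi k)) n * matrix_entry A m n) =
      X N m k + of_int k / of_int m * Y N m k" if k: "k < 0" and m: "m > 0" for N m k
  proof -
    have term_eq: "fourier (B (chi k)) n * matrix_entry A m n =
        proj_pos (\<lambda>n. matrix_entry B n k) n * matrix_entry A m n +
        of_int k / of_int m * (proj_pos (\<lambda>j. matrix_entry A' j (- m)) (- n) * matrix_entry B' (- k) (- n))" for n
    proof (cases "n < 0")
      case False
      then show ?thesis
        using H_S1_fourier_0[OF H_linear_maps[OF B H_S1_chi]] k
        by (cases "n = 0") (auto simp: proj_pos_def matrix_entry_def)
    next
      case True
      then have nz: "of_int n \<noteq> (0::complex)" "of_int m \<noteq> (0::complex)" using m by auto
      have "of_int n * matrix_entry B n k = of_int k * matrix_entry B' (- k) (- n)"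
        using omega_adjoint_matrix[OF adjB B B', of "- n" "- k"] True k by simp
      then have "fourier (B (chi k)) n = of_int k * matrix_entry B' (- k) (- n) / of_int n"
        using nz by (simp add: matrix_entry_def field_simps)
      moreover have "of_int m * matrix_entry A m n = of_int n * matrix_entry A' (- n) (- m)"
        using omega_adjoint_matrix[OF adjA A A', of "- m" "- n"] True m by simp
      then have "matrix_entry A m n = of_int n * matrix_entry A' (- n) (- m) / of_int m"
        using nz by (simp add: field_simps)
      ultimately show ?thesis using True nz by (simp add: proj_pos_def)
    qed
    have "Y N m k = (\<Sum>n\<in>{- int N..int N}. proj_pos (\<lambda>j. matrix_entry A' j (- m)) (- n) * matrix_entry B' (- k) (- n))"
      unfolding Y_def by (rule sum.reindex_bij_witness[of _ uminus uminus]) auto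
    then show ?thesis
      unfolding term_eq sum.distrib X_def by (simp only: sum_distrib_left)
  qed
  have trunc: "sum (energy_density (proj_pos a)) {- int N..int N} = (\<Sum>n\<in>{0<..int N}. real_of_int \<bar>n\<bar> * (cmod (a n))\<^sup>2)" for a N
    by (rule sum.mono_neutral_cong_right) (auto simp: proj_pos_def)
  have Xbound: "(\<Sum>k\<in>P. (\<Sum>m\<in>Q. real_of_int \<bar>m\<bar> * (cmod (X N m k))\<^sup>2) / real_of_int \<bar>k\<bar>) \<le> KA * HB"
    if P: "finite P" "P \<subseteq> {..<0}" and Q: "finite Q" "Q \<subseteq> {0<..}" for P Q N
  proof -
    have "(\<Sum>k\<in>P. (\<Sum>m\<in>Q. real_of_int \<bar>m\<bar> * (cmod (X N m k))\<^sup>2) / real_of_int \<bar>k\<bar>) \<le>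
        (\<Sum>k\<in>P. KA * sum (energy_density (proj_pos (\<lambda>n. matrix_entry B n k))) {- int N..int N} / real_of_int \<bar>k\<bar>)"
      unfolding X_def
      by (intro sum_mono divide_right_mono truncated_op_bound[OF A KA(2)] Q(1)) (simp_all add: proj_pos_def)
    also have "\<dots> = KA * block_sum B P {0<..int N}"
      unfolding trunc block_sum_def by (simp add: sum_distrib_left)
    also have "\<dots> \<le> KA * HB" by (intro mult_left_mono HB P KA(1)) auto
    finally show ?thesis .
  qed
  have Ybound: "(\<Sum>m\<in>Q. (\<Sum>k\<in>P. real_of_int \<bar>k\<bar> * (cmod (Y N m k))\<^sup>2) / real_of_int \<bar>m\<bar>) \<le> KB * HA"
    if P: "finite P" "P \<subseteq> {..<0}" and Q: "finite Q" "Q \<subseteq> {0<..}" for P Q N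
  proof -
    have "(\<Sum>m\<in>Q. (\<Sum>k\<in>P. real_of_int \<bar>k\<bar> * (cmod (Y N m k))\<^sup>2) / real_of_int \<bar>m\<bar>) \<le>
        (\<Sum>m\<in>Q. KB * sum (energy_density (proj_pos (\<lambda>j. matrix_entry A' j (- m)))) {- int N..int N} / real_of_int \<bar>m\<bar>)"
    proof (intro sum_mono divide_right_mono)
      fix m
      have "(\<Sum>k\<in>P. real_of_int \<bar>k\<bar> * (cmod (Y N m k))\<^sup>2) = (\<Sum>k\<in>uminus ` P. real_of_int \<bar>k\<bar> *
          (cmod (\<Sum>j\<in>{- int N..int N}. proj_pos (\<lambda>j. matrix_entry A' j (- m)) j * matrix_entry B' k j))\<^sup>2)"
        unfolding Y_def by (simp add: sum.reindex[OF inj_on_subset[OF inj_uminus subset_UNIV]])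
      also have "\<dots> \<le> KB * sum (energy_density (proj_pos (\<lambda>j. matrix_entry A' j (- m)))) {- int N..int N}"
        by (rule truncated_op_bound[OF B' KB(2)]) (use P in \<open>simp_all add: proj_pos_def\<close>)
      finally show "(\<Sum>k\<in>P. real_of_int \<bar>k\<bar> * (cmod (Y N m k))\<^sup>2) \<le>
        KB * sum (energy_density (proj_pos (\<lambda>j. matrix_entry A' j (- m)))) {- int N..int N}" .
    qed simp
    also have "\<dots> = KB * block_sum A' (uminus ` Q) {0<..int N}"
      unfolding trunc block_sum_def
      by (simp add: sum_distrib_left sum.reindex[OF inj_on_subset[OF inj_uminus subset_UNIV]])
    also have "\<dots> \<le> KB * HA" by (intro mult_left_mono HA KB(1)) (use Q in auto)
    finally show ?thesis .
  qed
  define S where "S N m k = (\<Sum>n\<in>{- int N..int N}. fourier (B (chi k)) n * matrix_entry A m n)" for N m k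
  have Sbound: "(\<Sum>k\<in>P. (\<Sum>m\<in>Q. real_of_int \<bar>m\<bar> * (cmod (S N m k))\<^sup>2) / real_of_int \<bar>k\<bar>) \<le> 2 * (KA * HB) + 2 * (KB * HA)"
    if P: "finite P" "P \<subseteq> {..<0}" and Q: "finite Q" "Q \<subseteq> {0<..}" for P Q N
  proof -
    have term_le: "real_of_int \<bar>m\<bar> * (cmod (S N m k))\<^sup>2 / real_of_int \<bar>k\<bar> \<le>
        2 * (real_of_int \<bar>m\<bar> * (cmod (X N m k))\<^sup>2 / real_of_int \<bar>k\<bar>) +
        2 * (real_of_int \<bar>k\<bar> * (cmod (Y N m k))\<^sup>2 / real_of_int \<bar>m\<bar>)" if "k \<in> P" "m \<in> Q" for k m
    proof -
      have km: "k < 0" "m > 0" using that P Q by auto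
      let ?y = "of_int k / of_int m * Y N m k"
      have "(cmod (S N m k))\<^sup>2 \<le> (cmod (X N m k) + cmod ?y)\<^sup>2"
        unfolding S_def split[OF km] by (intro power_mono norm_triangle_ineq norm_ge_zero)
      also have "\<dots> \<le> 2 * (cmod (X N m k))\<^sup>2 + 2 * (cmod ?y)\<^sup>2"
        using sum_squares_ge_zero[of "cmod (X N m k) - cmod ?y" 0] by (simp add: power2_eq_square algebra_simps)
      finally have "real_of_int \<bar>m\<bar> / real_of_int \<bar>k\<bar> * (cmod (S N m k))\<^sup>2 \<le>
          real_of_int \<bar>m\<bar> / real_of_int \<bar>k\<bar> * (2 * (cmod (X N m k))\<^sup>2 + 2 * (cmod ?y)\<^sup>2)"
        by (rule mult_left_mono) simp
      moreover have "(cmod ?y)\<^sup>2 = (real_of_int \<bar>k\<bar>)\<^sup>2 / (real_of_int \<bar>m\<bar>)\<^sup>2 * (cmod (Y N m k))\<^sup>2"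
        by (simp add: norm_mult norm_divide power_mult_distrib power_divide)
      moreover have "real_of_int \<bar>m\<bar> / real_of_int \<bar>k\<bar> * (2 * x + 2 * ((real_of_int \<bar>k\<bar>)\<^sup>2 / (real_of_int \<bar>m\<bar>)\<^sup>2 * y)) =
          2 * (real_of_int \<bar>m\<bar> * x / real_of_int \<bar>k\<bar>) + 2 * (real_of_int \<bar>k\<bar> * y / real_of_int \<bar>m\<bar>)" for x y
        using km by (simp add: field_simps power2_eq_square)
      ultimately show ?thesis by simp
    qed
    have "(\<Sum>k\<in>P. (\<Sum>m\<in>Q. real_of_int \<bar>m\<bar> * (cmod (S N m k))\<^sup>2) / real_of_int \<bar>k\<bar>) \<le>
      (\<Sum>k\<in>P. \<Sum>m\<in>Q. 2 * (real_of_int \<bar>m\<bar> * (cmod (X N m k))\<^sup>2 / real_of_int \<bar>k\<bar>) +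
        2 * (real_of_int \<bar>k\<bar> * (cmod (Y N m k))\<^sup>2 / real_of_int \<bar>m\<bar>))"
      unfolding sum_divide_distrib by (intro sum_mono term_le)
    also have "\<dots> = 2 * (\<Sum>k\<in>P. (\<Sum>m\<in>Q. real_of_int \<bar>m\<bar> * (cmod (X N m k))\<^sup>2) / real_of_int \<bar>k\<bar>) +
        2 * (\<Sum>k\<in>P. \<Sum>m\<in>Q. real_of_int \<bar>k\<bar> * (cmod (Y N m k))\<^sup>2 / real_of_int \<bar>m\<bar>)"
      by (simp only: sum.distrib sum_distrib_left sum_divide_distrib)
    also have "(\<Sum>k\<in>P. \<Sum>m\<in>Q. real_of_int \<bar>k\<bar> * (cmod (Y N m k))\<^sup>2 / real_of_int \<bar>m\<bar>) =
        (\<Sum>m\<in>Q. (\<Sum>k\<in>P. real_of_int \<bar>k\<bar> * (cmod (Y N m k))\<^sup>2) / real_of_int \<bar>m\<bar>)"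
      unfolding sum_divide_distrib by (rule sum.swap)
    also have "2 * (\<Sum>k\<in>P. (\<Sum>m\<in>Q. real_of_int \<bar>m\<bar> * (cmod (X N m k))\<^sup>2) / real_of_int \<bar>k\<bar>) + 2 * \<dots>
        \<le> 2 * (KA * HB) + 2 * (KB * HA)"
      by (intro add_mono mult_left_mono Xbound Ybound P Q) auto
    finally show ?thesis .
  qed
  have "block_sum C P Q \<le> 2 * (KA * HB) + 2 * (KB * HA)"
    if P: "finite P" "P \<subseteq> {..<0}" and Q: "finite Q" "Q \<subseteq> {0<..}" for P Q
  proof (rule LIMSEQ_le_const2)
    have "(\<lambda>N. S N m k) \<longlonglongrightarrow> matrix_entry C m k" if "k \<in> P" "m \<in> Q" for k m
    proof -
      have k: "chi k \<in> H_S1" and "m \<noteq> 0" using that P Q by (auto intro: H_S1_chi)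
      then show ?thesis
        unfolding S_def matrix_entry_def[of C] C[OF k] by (intro op_matrix_expansion[OF A bA] H_linear_maps[OF B])
    qed
    then show "(\<lambda>N. \<Sum>k\<in>P. (\<Sum>m\<in>Q. real_of_int \<bar>m\<bar> * (cmod (S N m k))\<^sup>2) / real_of_int \<bar>k\<bar>) \<longlonglongrightarrow> block_sum C P Q"
      unfolding block_sum_def
      by (intro tendsto_sum tendsto_divide tendsto_mult tendsto_const tendsto_power tendsto_norm) (use P in auto)
    show "\<exists>N. \<forall>n\<ge>N. (\<Sum>k\<in>P. (\<Sum>m\<in>Q. real_of_int \<bar>m\<bar> * (cmod (S n m k))\<^sup>2) / real_of_int \<bar>k\<bar>) \<le> 2 * (KA * HB) + 2 * (KB * HA)"
      by (rule exI[of _ 0]) (intro allI impI Sbound P Q)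
  qed
  then show ?thesis unfolding HS_bounded_def by blast
qed

lemma Sp_infinity_inverse:
  assumes A: "A \<in> carrier Sp_infinity"
  defines "A' \<equiv> \<lambda>u\<in>H_S1. inv_into H_S1 A u"
  shows "A' \<in> carrier Sp_infinity" "omega_adjoint A A'"
proof -
  have bij: "A \<in> Bij H_S1" and lin: "H_linear A" and bd: "bounded_on_H A" and re: "real_op A"
    and sy: "symplectic A" and HS: "HS_bounded A"
    using A unfolding Sp_infinity_carrier by auto
  have bb: "bij_betw A H_S1 H_S1" using bij by (simp add: Bij_def)
  have A'H: "A' u \<in> H_S1" if "u \<in> H_S1" for u
    using Bij_inv_into_mem[OF bij that] that by (simp add: A'_def)
  have AA': "A (A' u) = u" if "u \<in> H_S1" for u
    using bij_betw_inv_into_right[OF bb that] that by (simp add: A'_def)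
  have A'A: "A' (A u) = u" if "u \<in> H_S1" for u
    using bij_betw_inv_into_left[OF bb that] H_linear_maps[OF lin that] by (simp add: A'_def)
  have lin': "H_linear A'"
    unfolding H_linear_def linear_on_H_def
  proof (intro conjI ballI allI A'H)
    fix u v assume uv: "u \<in> H_S1" "v \<in> H_S1"
    have "A' (\<lambda>z. A (A' u) z + A (A' v) z) = (\<lambda>z. A' u z + A' v z)"
      using A'A[OF H_S1_add[OF A'H[OF uv(1)] A'H[OF uv(2)]]] H_linear_add[OF lin A'H[OF uv(1)] A'H[OF uv(2)]] by simp
    then show "A' (\<lambda>z. u z + v z) = (\<lambda>z. A' u z + A' v z)" using uv by (simp add: AA')
  next
    fix c u assume u: "u \<in> H_S1"
    have "A' (\<lambda>z. c * A (A' u) z) = (\<lambda>z. c * A' u z)"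
      using A'A[OF H_S1_cmult[OF A'H[OF u]]] H_linear_cmult[OF lin A'H[OF u]] by simp
    then show "A' (\<lambda>z. c * u z) = (\<lambda>z. c * A' u z)" using u by (simp add: AA')
  qed
  show adj: "omega_adjoint A A'" by (rule symplectic_inverse_adjoint[OF sy A'H AA'])
  have "A' u = conj_op A' u" if u: "u \<in> H_S1" for u
  proof -
    let ?c = "\<lambda>u z. cnj (u z)"
    have cu: "?c u \<in> H_S1" by (rule H_S1_cnj[OF u])
    have w: "?c (A' (?c u)) \<in> H_S1" by (rule H_S1_cnj[OF A'H[OF cu]])
    have "A (?c (A' (?c u))) = ?c (A (A' (?c u)))"
      using re w by (simp add: conj_op_def)
    also have "\<dots> = u" by (simp add: AA'[OF cu])
    finally have "A' u = ?c (A' (?c u))" using A'A[OF w] by simp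
    then show ?thesis by (simp add: conj_op_def)
  qed
  moreover have "symplectic A'" using sy A'H AA' by metis
  moreover have "A' \<in> Bij H_S1" unfolding A'_def by (rule restrict_inv_into_Bij[OF bij])
  ultimately show "A' \<in> carrier Sp_infinity"
    unfolding Sp_infinity_carrier
    using lin' omega_adjoint_bounded[OF adj lin lin' bd] omega_adjoint_HS_bounded[OF adj lin lin' HS] by blast
qed

lemma Sp_infinity_compose:
  assumes A: "A \<in> carrier Sp_infinity" and B: "B \<in> carrier Sp_infinity"
  shows "compose H_S1 A B \<in> carrier Sp_infinity"
proof -
  let ?C = "compose H_S1 A B"
  have C: "?C u = A (B u)" if "u \<in> H_S1" for u using that by (simp add: compose_def)
  note a = A[unfolded Sp_infinity_carrier] and b = B[unfolded Sp_infinity_carrier]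
  have linA: "H_linear A" and linB: "H_linear B" using a b by auto
  have BH: "B u \<in> H_S1" if "u \<in> H_S1" for u by (rule H_linear_maps[OF linB that])
  define A' where "A' = (\<lambda>u\<in>H_S1. inv_into H_S1 A u)"
  define B' where "B' = (\<lambda>u\<in>H_S1. inv_into H_S1 B u)"
  note a' = Sp_infinity_inverse[OF A, folded A'_def] and b' = Sp_infinity_inverse[OF B, folded B'_def]
  note a'' = a'(1)[unfolded Sp_infinity_carrier] and b'' = b'(1)[unfolded Sp_infinity_carrier]
  have "H_linear ?C"
    unfolding H_linear_def linear_on_H_def
    by (auto simp: C H_S1_add H_S1_cmult BH H_linear_add[OF linB] H_linear_add[OF linA]
        H_linear_cmult[OF linB] H_linear_cmult[OF linA] H_linear_maps[OF linA])
  moreover have "bounded_on_H ?C"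
  proof -
    obtain K where K: "K \<ge> 0" "\<And>u. u \<in> H_S1 \<Longrightarrow> (norm_omega (A u))\<^sup>2 \<le> K * (norm_omega u)\<^sup>2"
      using a unfolding bounded_on_H_iff by blast
    obtain L where L: "L \<ge> 0" "\<And>u. u \<in> H_S1 \<Longrightarrow> (norm_omega (B u))\<^sup>2 \<le> L * (norm_omega u)\<^sup>2"
      using b unfolding bounded_on_H_iff by blast
    have "(norm_omega (?C u))\<^sup>2 \<le> (K * L) * (norm_omega u)\<^sup>2" if "u \<in> H_S1" for u
      using order_trans[OF K(2)[OF BH[OF that]] mult_left_mono[OF L(2)[OF that] K(1)]] that
      by (simp add: C mult.assoc)
    then show ?thesis unfolding bounded_on_H_iff using K(1) L(1) by (intro exI[of _ "K * L"]) auto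
  qed
  moreover have "real_op ?C"
  proof
    fix u assume u: "u \<in> H_S1"
    have "A (B u) = conj_op A (B u)" "B u = conj_op B u" using a b u BH by blast+
    then show "?C u = conj_op ?C u"
      using u by (simp add: C conj_op_def H_S1_cnj)
  qed
  moreover have "symplectic ?C"
  proof (intro ballI)
    fix u v assume uv: "u \<in> H_S1" "v \<in> H_S1"
    have "omega (A (B u)) (A (B v)) = omega (B u) (B v)" using a BH uv by blast
    also have "\<dots> = omega u v" using b uv by blast
    finally show "omega (?C u) (?C v) = omega u v" using uv by (simp only: C)
  qed
  moreover have "HS_bounded ?C"
    by (rule HS_bounded_compose[OF linA linB _ _ a'(2) b'(2) _ _ _ _ C]) (use a b a'' b'' in auto)
  moreover have "?C \<in> Bij H_S1" using a b by (intro compose_Bij) auto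
  ultimately show ?thesis unfolding Sp_infinity_carrier by blast
qed

lemma HS_bounded_scalar:
  assumes "\<And>u. u \<in> H_S1 \<Longrightarrow> A u = (\<lambda>z. c * u z)"
  shows "HS_bounded A"
proof -
  have "block_sum A P Q \<le> 0" if "P \<subseteq> {..<0}" "Q \<subseteq> {0<..}" for P Q
  proof -
    have "matrix_entry A m k = 0" if "k \<in> P" "m \<in> Q" for k m
    proof -
      have "k < 0" "m > 0" using that \<open>P \<subseteq> {..<0}\<close> \<open>Q \<subseteq> {0<..}\<close> by auto
      then have "k \<noteq> 0" "m \<noteq> k" by auto
      then show ?thesis by (simp add: matrix_entry_def assms[OF H_S1_chi] fourier_chi)
    qed
    then have "block_sum A P Q = 0" unfolding block_sum_def by (intro sum.neutral ballI) simp
    then show ?thesis by simp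
  qed
  then show ?thesis unfolding HS_bounded_def by blast
qed

lemma scalar_in_Sp_infinity:
  assumes c: "c = 1 \<or> c = - 1"
  shows "(\<lambda>u\<in>H_S1. \<lambda>z. c * u z) \<in> carrier Sp_infinity"
proof -
  let ?A = "\<lambda>u\<in>H_S1. \<lambda>z. c * u z"
  have cc: "c * (c * x) = x" for x using c by auto
  have om: "omega (\<lambda>z. c * u z) (\<lambda>z. c * v z) = omega u v" if "u \<in> H_S1" "v \<in> H_S1" for u v
  proof -
    have "cderiv (\<lambda>z. c * v z) z = c * cderiv v z" for z
    proof -
      obtain t where t: "z = pt t" by (rule pt_surj)
      show ?thesis unfolding t
        by (rule cderiv_pt_eqI, rule has_vector_derivative_mult_right,
            rule smooth_circle_fun_cderiv(1)[OF H_S1_smooth[OF that(2)]])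
    qed
    then have "omega (\<lambda>z. c * u z) (\<lambda>z. c * v z) = mean (\<lambda>z. c * (c * (u z * cderiv v z)))"
      by (simp only: omega_eq_mean[OF H_S1_smooth[OF H_S1_cmult[OF that(2)]]] ac_simps)
    then show ?thesis by (simp only: cc omega_eq_mean[OF H_S1_smooth[OF that(2)]])
  qed
  have "bij_betw ?A H_S1 H_S1"
    by (rule bij_betw_byWitness[where f' = ?A]) (auto simp: cc H_S1_cmult)
  then have "?A \<in> Bij H_S1" by (simp add: Bij_def)
  moreover have "H_linear ?A"
    unfolding H_linear_def linear_on_H_def by (auto simp: H_S1_cmult H_S1_add distrib_left mult.left_commute)
  moreover have "bounded_on_H ?A"
    unfolding bounded_on_H_def norm_omega_def norm_H_omega_def
    by (rule exI[of _ 1]) (use c in \<open>auto simp: norm_mult\<close>)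
  moreover have "real_op ?A" using c by (auto simp: conj_op_def H_S1_cnj)
  moreover have "symplectic ?A" by (simp add: om)
  moreover have "HS_bounded ?A" by (rule HS_bounded_scalar[of _ c]) simp
  ultimately show ?thesis unfolding Sp_infinity_carrier by blast
qed

lemma group_Sp_infinity: "group Sp_infinity"
proof -
  have sub: "carrier Sp_infinity \<subseteq> Bij H_S1" using Sp_infinity_carrier by blast
  have one: "\<one>\<^bsub>BijGroup H_S1\<^esub> \<in> carrier Sp_infinity"
    using scalar_in_Sp_infinity[of 1] by (simp add: BijGroup_def)
  have mult: "A \<otimes>\<^bsub>BijGroup H_S1\<^esub> B \<in> carrier Sp_infinity" if "A \<in> carrier Sp_infinity" "B \<in> carrier Sp_infinity" for A B
    using Sp_infinity_compose[OF that] sub that by (auto simp: BijGroup_def)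
  have inv: "inv\<^bsub>BijGroup H_S1\<^esub> A \<in> carrier Sp_infinity" if "A \<in> carrier Sp_infinity" for A
    using Sp_infinity_inverse(1)[OF that] sub that by (auto simp: inv_BijGroup)
  have "subgroup (carrier Sp_infinity) (BijGroup H_S1)"
    by (rule group.subgroupI[OF group_BijGroup]) (use sub one mult inv in \<open>auto simp: BijGroup_def\<close>)
  then have "group ((BijGroup H_S1)\<lparr>carrier := carrier Sp_infinity\<rparr>)"
    by (rule group.subgroup_imp_group[OF group_BijGroup])
  moreover have "(BijGroup H_S1)\<lparr>carrier := carrier Sp_infinity\<rparr> = Sp_infinity"
    by (simp add: Sp_infinity_def)
  ultimately show ?thesis by simp
qed

section \<open>Boundedness from the off-diagonal block\<close>

lemma signed_energy_has_sum:
  assumes "u \<in> H_S1"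
  shows "((\<lambda>n. of_int n * (cmod (fourier u n))\<^sup>2) has_sum Re (\<i> * omega u (\<lambda>z. cnj (u z)))) UNIV"
proof -
  have "((\<lambda>n. \<i> * (- (\<i> * of_int n * fourier u n * fourier (\<lambda>z. cnj (u z)) (- n)))) has_sum
      \<i> * omega u (\<lambda>z. cnj (u z))) UNIV"
    by (intro has_sum_cmult_right omega_has_sum H_S1_smooth H_S1_cnj assms)
  from has_sum_Re[OF this] show ?thesis
    by (simp only: fourier_cnj minus_minus mult.assoc complex_norm_square[symmetric]) simp
qed

text \<open>
  For a real operator, \<open>\<omega>(A u, cnj (A u)) = \<omega>(A u, A (cnj u))\<close>.
\<close>

lemma signed_energy_preserved:
  assumes A: "H_linear A" "real_op A" "symplectic A" and u: "u \<in> H_S1"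
  shows "(\<Sum>\<^sub>\<infinity>n. of_int n * (cmod (fourier (A u) n))\<^sup>2) = (\<Sum>\<^sub>\<infinity>n. of_int n * (cmod (fourier u n))\<^sup>2)"
proof -
  have cu: "(\<lambda>z. cnj (u z)) \<in> H_S1" by (rule H_S1_cnj[OF u])
  have "A (\<lambda>z. cnj (u z)) = conj_op A (\<lambda>z. cnj (u z))" using A(2) cu by blast
  then have "A (\<lambda>z. cnj (u z)) = (\<lambda>z. cnj (A u z))" by (simp add: conj_op_def)
  then have "omega (A u) (\<lambda>z. cnj (A u z)) = omega u (\<lambda>z. cnj (u z))"
    using A(3) u cu by metis
  then show ?thesis
    using infsumI[OF signed_energy_has_sum[OF u]] infsumI[OF signed_energy_has_sum[OF H_linear_maps[OF A(1) u]]]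
    by simp
qed

text \<open>
  The Hilbert-Schmidt block bounds the positive-frequency energy of the image by \<open>K\<close> times the energy
  of the argument. The signed energy of the argument is minus its energy and is preserved, so the
  negative-frequency energy of the image exceeds the positive one by exactly that amount.
\<close>

lemma norm_omega_trig_partial_negative_le:
  assumes A: "H_linear A" "real_op A" "symplectic A"
    and K: "\<And>P Q. finite P \<Longrightarrow> P \<subseteq> {..<0} \<Longrightarrow> finite Q \<Longrightarrow> Q \<subseteq> {0<..} \<Longrightarrow> block_sum A P Q \<le> K"
    and b: "\<And>n. n \<ge> 0 \<Longrightarrow> b n = 0"
  shows "(norm_omega (A (trig_partial b N)))\<^sup>2 \<le> (2 * K + 1) * (norm_omega (trig_partial b N))\<^sup>2"
proof -
  let ?I = "{- int N..<0}"
  define u where "u = trig_partial b N"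
  define v where "v = fourier (A u)"
  define E where "E = sum (energy_density b) ?I"
  have uH: "u \<in> H_S1" unfolding u_def by (rule H_S1_trig_partial) (simp add: b)
  have AuH: "A u \<in> H_S1" by (rule H_linear_maps[OF A(1) uH])
  have E: "(norm_omega u)\<^sup>2 = E"
    unfolding u_def norm_omega_trig_partial E_def
    by (rule sum.mono_neutral_right) (use b in auto)
  have E0: "E \<ge> 0" unfolding E_def by (intro sum_nonneg mult_nonneg_nonneg) auto
  have pos: "(\<Sum>m\<in>Q. real_of_int \<bar>m\<bar> * (cmod (v m))\<^sup>2) \<le> K * E" if Q: "finite Q" "Q \<subseteq> {0<..}" for Q
  proof -
    have vm: "(cmod (v m))\<^sup>2 \<le> E * (\<Sum>n\<in>?I. (cmod (matrix_entry A m n))\<^sup>2 / real_of_int \<bar>n\<bar>)" for m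
    proof -
      let ?c = "\<lambda>n. sqrt (real_of_int \<bar>n\<bar>) * cmod (b n)"
      let ?d = "\<lambda>n. cmod (matrix_entry A m n) / sqrt (real_of_int \<bar>n\<bar>)"
      have "v m = (\<Sum>n\<in>{- int N..int N}. b n * matrix_entry A m n)"
        unfolding v_def u_def by (rule fourier_op_trig_partial[OF A(1)]) (simp add: b)
      also have "\<dots> = (\<Sum>n\<in>?I. b n * matrix_entry A m n)"
        by (rule sum.mono_neutral_right) (use b in auto)
      finally have "cmod (v m) \<le> (\<Sum>n\<in>?I. cmod (b n * matrix_entry A m n))"
        by (simp only: norm_sum)
      also have "\<dots> = (\<Sum>n\<in>?I. ?c n * ?d n)"
        by (rule sum.cong) (auto simp: norm_mult)
      finally have "(cmod (v m))\<^sup>2 \<le> (\<Sum>n\<in>?I. ?c n * ?d n)\<^sup>2" by (rule power_mono) simp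
      also have "\<dots> \<le> (\<Sum>n\<in>?I. (?c n)\<^sup>2) * (\<Sum>n\<in>?I. (?d n)\<^sup>2)" by (rule Cauchy_Schwarz_ineq_sum)
      also have "(\<Sum>n\<in>?I. (?c n)\<^sup>2) = E" unfolding E_def by (simp add: power_mult_distrib)
      also have "(\<Sum>n\<in>?I. (?d n)\<^sup>2) = (\<Sum>n\<in>?I. (cmod (matrix_entry A m n))\<^sup>2 / real_of_int \<bar>n\<bar>)"
        by (simp add: power_divide)
      finally show ?thesis .
    qed
    have "(\<Sum>m\<in>Q. real_of_int \<bar>m\<bar> * (cmod (v m))\<^sup>2) \<le>
        (\<Sum>m\<in>Q. real_of_int \<bar>m\<bar> * (E * (\<Sum>n\<in>?I. (cmod (matrix_entry A m n))\<^sup>2 / real_of_int \<bar>n\<bar>)))"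
      by (intro sum_mono mult_left_mono vm) simp
    also have "\<dots> = E * (\<Sum>m\<in>Q. \<Sum>n\<in>?I. real_of_int \<bar>m\<bar> * (cmod (matrix_entry A m n))\<^sup>2 / real_of_int \<bar>n\<bar>)"
      by (simp add: sum_distrib_left mult.left_commute)
    also have "(\<Sum>m\<in>Q. \<Sum>n\<in>?I. real_of_int \<bar>m\<bar> * (cmod (matrix_entry A m n))\<^sup>2 / real_of_int \<bar>n\<bar>) = block_sum A ?I Q"
      unfolding block_sum_def sum_divide_distrib by (rule sum.swap)
    also have "E * block_sum A ?I Q \<le> E * K"
      by (intro mult_left_mono K E0) (use Q in auto)
    finally show ?thesis by (simp add: mult.commute)
  qed
  have vH: "energy_density v summable_on UNIV"
    using fourier_in_H_omega[OF AuH] by (simp add: v_def H_omega_def)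
  have sv: "(\<lambda>n. real_of_int n * (cmod (v n))\<^sup>2) summable_on UNIV"
    using signed_energy_has_sum[OF AuH] unfolding v_def by (rule has_sum_imp_summable)
  \<comment> \<open>The energy is twice its positive-frequency part minus the preserved signed energy.\<close>
  let ?p = "\<lambda>n. real_of_int (\<bar>n\<bar> + n) * (cmod (v n))\<^sup>2"
  have sp: "?p summable_on UNIV"
    using summable_on_add[OF vH sv] by (simp add: distrib_right)
  have "infsum ?p UNIV \<le> 2 * (K * E)"
  proof (rule infsum_le_finite_sums[OF sp])
    fix F :: "int set" assume F: "finite F"
    have "sum ?p F = sum ?p (F \<inter> {0<..})"
      by (rule sum.mono_neutral_right) (use F in auto)
    also have "\<dots> = 2 * (\<Sum>m\<in>F \<inter> {0<..}. real_of_int \<bar>m\<bar> * (cmod (v m))\<^sup>2)"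
      unfolding sum_distrib_left by (rule sum.cong) auto
    also have "\<dots> \<le> 2 * (K * E)" using pos[of "F \<inter> {0<..}"] F by simp
    finally show "sum ?p F \<le> 2 * (K * E)" .
  qed
  moreover have "infsum (energy_density v) UNIV + (\<Sum>\<^sub>\<infinity>n. real_of_int n * (cmod (v n))\<^sup>2) = infsum ?p UNIV"
    using infsum_add[OF vH sv] by (simp add: distrib_right)
  moreover have "(\<Sum>\<^sub>\<infinity>n. real_of_int n * (cmod (v n))\<^sup>2) = - E"
  proof -
    have "(\<Sum>\<^sub>\<infinity>n. real_of_int n * (cmod (v n))\<^sup>2) = (\<Sum>\<^sub>\<infinity>n. real_of_int n * (cmod (fourier u n))\<^sup>2)"
      unfolding v_def by (rule signed_energy_preserved[OF A uH])
    also have "\<dots> = (\<Sum>\<^sub>\<infinity>n\<in>?I. - energy_density b n)"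
      by (rule infsum_cong_neutral) (auto simp: u_def fourier_trig_partial b)
    also have "\<dots> = - E" by (simp add: E_def sum_negf)
    finally show ?thesis .
  qed
  moreover have "(norm_omega (A u))\<^sup>2 = infsum (energy_density v) UNIV"
    by (simp add: norm_omega_def norm_H_omega_square v_def)
  ultimately have "(norm_omega (A u))\<^sup>2 \<le> (2 * K + 1) * E" by (simp add: algebra_simps)
  then show ?thesis using E by (simp add: u_def)
qed

lemma norm_omega_add_le:
  assumes "u \<in> H_S1" "v \<in> H_S1"
  shows "(norm_omega (\<lambda>z. u z + v z))\<^sup>2 \<le> 2 * (norm_omega u)\<^sup>2 + 2 * (norm_omega v)\<^sup>2"
proof -
  let ?w = "\<lambda>z. u z + v z"
  have "energy_density (fourier ?w) n \<le> 2 * energy_density (fourier u) n + 2 * energy_density (fourier v) n" for n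
  proof -
    let ?x = "cmod (fourier u n)" and ?y = "cmod (fourier v n)"
    have "(cmod (fourier ?w n))\<^sup>2 \<le> (?x + ?y)\<^sup>2"
      unfolding fourier_add[OF H_S1_cont[OF assms(1)] H_S1_cont[OF assms(2)]]
      by (intro power_mono norm_triangle_ineq norm_ge_zero)
    also have "\<dots> \<le> 2 * ?x\<^sup>2 + 2 * ?y\<^sup>2"
      using sum_squares_ge_zero[of "?x - ?y" 0] by (simp add: power2_eq_square algebra_simps)
    finally have "real_of_int \<bar>n\<bar> * (cmod (fourier ?w n))\<^sup>2 \<le> real_of_int \<bar>n\<bar> * (2 * ?x\<^sup>2 + 2 * ?y\<^sup>2)"
      by (rule mult_left_mono) simp
    then show ?thesis by (simp add: algebra_simps)
  qed
  then have "sum (energy_density (fourier ?w)) F \<le>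
      2 * sum (energy_density (fourier u)) F + 2 * sum (energy_density (fourier v)) F" for F
    unfolding sum_distrib_left sum.distrib[symmetric] by (rule sum_mono)
  then have "sum (energy_density (fourier ?w)) {- int N..int N} \<le> 2 * (norm_omega u)\<^sup>2 + 2 * (norm_omega v)\<^sup>2" for N
    using norm_omega_sum_le[OF assms(1), of "{- int N..int N}"] norm_omega_sum_le[OF assms(2), of "{- int N..int N}"]
    by (smt (verit) finite_atLeastAtMost_int)
  then show ?thesis
    unfolding norm_omega_def by (rule H_omegaI(2)) (rule H_S1_fourier_0[OF H_S1_add[OF assms]])
qed

lemma cnj_trig_partial: "cnj (trig_partial b N z) = trig_partial (\<lambda>n. cnj (b (- n))) N z"
  unfolding trig_partial_chi by (simp, rule sum.reindex_bij_witness[of _ uminus uminus]) auto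

text \<open>
  Positive frequencies reduce to negative ones by conjugation, since the operator is real.
\<close>

lemma HS_bounded_imp_bounded_trig_partial:
  assumes A: "H_linear A" "real_op A" "symplectic A" and HS: "HS_bounded A"
  obtains K where "K \<ge> 0" "\<And>a N. a 0 = 0 \<Longrightarrow>
    (norm_omega (A (trig_partial a N)))\<^sup>2 \<le> K * (norm_omega (trig_partial a N))\<^sup>2"
proof -
  obtain K where K: "\<And>P Q. finite P \<Longrightarrow> P \<subseteq> {..<0} \<Longrightarrow> finite Q \<Longrightarrow> Q \<subseteq> {0<..} \<Longrightarrow> block_sum A P Q \<le> K"
    using HS unfolding HS_bounded_def by blast
  have K0: "K \<ge> 0" using K[of "{}" "{}"] by (simp add: block_sum_def)
  \<comment> \<open>One factor two comes from the parallelogram inequality, the other from adding the two frequency parts.\<close>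
  have "(norm_omega (A (trig_partial a N)))\<^sup>2 \<le> (4 * (2 * K + 1)) * (norm_omega (trig_partial a N))\<^sup>2"
    if a: "a 0 = 0" for a N
  proof -
    let ?p = "trig_partial (proj_pos a) N" and ?n = "trig_partial (proj_neg a) N"
    let ?q = "trig_partial (\<lambda>n. cnj (proj_pos a (- n))) N"
    have pH: "?p \<in> H_S1" and nH: "?n \<in> H_S1"
      by (auto intro!: H_S1_trig_partial simp: proj_pos_def proj_neg_def)
    have split: "trig_partial a N = (\<lambda>z. ?p z + ?n z)"
      unfolding trig_partial_def sum.distrib[symmetric]
      by (rule ext, rule sum.cong) (use a in \<open>auto simp: proj_pos_def proj_neg_def not_less\<close>)
    have le: "(norm_omega ?p)\<^sup>2 \<le> (norm_omega (trig_partial a N))\<^sup>2"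
      "(norm_omega ?n)\<^sup>2 \<le> (norm_omega (trig_partial a N))\<^sup>2"
      unfolding norm_omega_trig_partial
      by (intro sum_mono mult_left_mono; simp add: proj_pos_def proj_neg_def)+
    have An: "(norm_omega (A ?n))\<^sup>2 \<le> (2 * K + 1) * (norm_omega ?n)\<^sup>2"
      by (rule norm_omega_trig_partial_negative_le[OF A K]) (auto simp: proj_neg_def)
    have Aq: "(norm_omega (A ?q))\<^sup>2 \<le> (2 * K + 1) * (norm_omega ?q)\<^sup>2"
      by (rule norm_omega_trig_partial_negative_le[OF A K]) (auto simp: proj_pos_def)
    have q: "?q = (\<lambda>z. cnj (?p z))" by (simp add: cnj_trig_partial)
    have "A ?p = conj_op A ?p" using A(2) pH by blast
    then have "A ?p = (\<lambda>z. cnj (A ?q z))" unfolding conj_op_def q .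
    then have Ap: "(norm_omega (A ?p))\<^sup>2 \<le> (2 * K + 1) * (norm_omega ?p)\<^sup>2"
      using Aq by (simp add: norm_omega_cnj q)
    have "(norm_omega (A (trig_partial a N)))\<^sup>2 \<le> 2 * (norm_omega (A ?p))\<^sup>2 + 2 * (norm_omega (A ?n))\<^sup>2"
      unfolding split H_linear_add[OF A(1) pH nH]
      by (rule norm_omega_add_le[OF H_linear_maps[OF A(1) pH] H_linear_maps[OF A(1) nH]])
    also have "\<dots> \<le> 2 * ((2 * K + 1) * (norm_omega (trig_partial a N))\<^sup>2) + 2 * ((2 * K + 1) * (norm_omega (trig_partial a N))\<^sup>2)"
      by (intro add_mono mult_left_mono order_trans[OF Ap] order_trans[OF An] le) (use K0 in auto)
    finally show ?thesis by (simp add: algebra_simps)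
  qed
  then show ?thesis using that[of "4 * (2 * K + 1)"] K0 by simp
qed

section \<open>Pullback along a diffeomorphism\<close>

text \<open>
  With \<open>\<eta>\<close> the inverse of \<open>\<psi>\<close> this is the action of \<open>\<psi>\<close>. Working with \<open>\<eta>\<close> keeps the inverse out
  of the analytic estimates.
\<close>

definition pullback :: "(circle \<Rightarrow> circle) \<Rightarrow> (circle \<Rightarrow> complex) \<Rightarrow> circle \<Rightarrow> complex" where
  "pullback \<eta> u = (\<lambda>z. u (\<eta> z) - mean (\<lambda>w. u (\<eta> w)))"

lemma Phi_eq_pullback: "Phi \<psi> = (\<lambda>u\<in>H_S1. pullback (inv_into UNIV \<psi>) u)"
  by (simp add: Phi_def pullback_def)

lemma smooth_compose_Diff:
  "\<eta> \<in> carrier Diff_S1 \<Longrightarrow> smooth_circle_fun u \<Longrightarrow> smooth_circle_fun (\<lambda>z. u (\<eta> z))"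
  using smooth_circle_fun_compose Diff_S1_carrier by blast

lemma pullback_H_S1:
  assumes "\<eta> \<in> carrier Diff_S1" "u \<in> H_S1"
  shows "pullback \<eta> u \<in> H_S1"
proof -
  have s: "smooth_circle_fun (\<lambda>z. u (\<eta> z))" by (rule smooth_compose_Diff[OF assms(1) H_S1_smooth[OF assms(2)]])
  show ?thesis
    unfolding pullback_def H_S1_def
    using smooth_circle_fun_diff[OF s smooth_circle_fun_const] mean_diff[OF smooth_imp_circle_cont[OF s] continuous_on_const]
    by simp
qed

lemma fourier_pullback:
  assumes "\<eta> \<in> carrier Diff_S1" "smooth_circle_fun u" "m \<noteq> 0"
  shows "fourier (pullback \<eta> u) m = fourier (\<lambda>z. u (\<eta> z)) m"
proof -
  have s: "circle_cont (\<lambda>z. u (\<eta> z))" by (rule smooth_imp_circle_cont[OF smooth_compose_Diff[OF assms(1,2)]])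
  have "fourier (\<lambda>z. c) m = 0" for c
    using fourier_cmult[of c "chi 0" m] assms(3) by (simp add: fourier_chi)
  then show ?thesis unfolding pullback_def using fourier_diff[OF s continuous_on_const, of _ m] by simp
qed

lemma pullback_H_linear:
  assumes "\<eta> \<in> carrier Diff_S1"
  shows "H_linear (pullback \<eta>)"
proof -
  have c: "circle_cont (\<lambda>z. u (\<eta> z))" if "u \<in> H_S1" for u
    by (rule smooth_imp_circle_cont[OF smooth_compose_Diff[OF assms H_S1_smooth[OF that]]])
  show ?thesis
    unfolding H_linear_def linear_on_H_def
  proof (intro conjI ballI allI)
    fix u assume u: "u \<in> H_S1"
    show "pullback \<eta> u \<in> H_S1" by (rule pullback_H_S1[OF assms u])
    fix a
    show "pullback \<eta> (\<lambda>z. a * u z) = (\<lambda>z. a * pullback \<eta> u z)"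
      by (simp add: pullback_def right_diff_distrib)
  next
    fix u v assume uv: "u \<in> H_S1" "v \<in> H_S1"
    show "pullback \<eta> (\<lambda>z. u z + v z) = (\<lambda>z. pullback \<eta> u z + pullback \<eta> v z)"
      unfolding pullback_def mean_add[OF c[OF uv(1)] c[OF uv(2)]] by (simp add: algebra_simps)
  qed
qed

lemma pullback_real: "real_op (pullback \<eta>)"
  by (simp add: pullback_def conj_op_def mean_cnj)

text \<open>
  An antiderivative \<open>G\<close> of the periodic integrand gains the same amount over every period, so only the
  degree of \<open>\<phi>\<close> enters.
\<close>

lemma integral_circle_substitution:
  assumes g: "circle_cont g" and \<phi>: "inf_diff \<phi>" "\<And>t. \<phi> (t + 2 * pi) = \<phi> t + 2 * pi"
  shows "integral {0..2 * pi} (\<lambda>t. vector_derivative \<phi> (at t) *\<^sub>R g (pt (\<phi> t))) = integral {0..2 * pi} (\<lambda>t. g (pt t))"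
proof -
  have "isCont (\<lambda>t. g (pt t)) t" for t using g by (simp add: continuous_on_eq_continuous_at)
  then have "\<exists>G. \<forall>t. (G has_vector_derivative g (pt t)) (at t)"
    using einterval_antiderivative[of "-\<infinity>" "\<infinity>" "\<lambda>t. g (pt t)"] by simp
  then obtain G where G: "\<And>t. (G has_vector_derivative g (pt t)) (at t)" by blast
  have "((\<lambda>t. G (t + 2 * pi) - G t) has_vector_derivative 0) (at t)" for t
  proof -
    have "((\<lambda>t. t + 2 * pi) has_vector_derivative 1) (at t)" by (auto intro!: derivative_eq_intros)
    from vector_diff_chain_at[OF this G]
    have "((\<lambda>t. G (t + 2 * pi)) has_vector_derivative g (pt t)) (at t)" by (simp add: o_def)
    from has_vector_derivative_diff[OF this G] show ?thesis by simp
  qed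
  then obtain c where c: "\<And>t. G (t + 2 * pi) - G t = c"
    using has_vector_derivative_zero_constant[of UNIV "\<lambda>t. G (t + 2 * pi) - G t"] by auto
  have "((\<lambda>t. vector_derivative \<phi> (at t) *\<^sub>R g (pt (\<phi> t))) has_integral G (\<phi> (2 * pi)) - G (\<phi> 0)) {0..2 * pi}"
    by (rule fundamental_theorem_of_calculus, simp, rule has_vector_derivative_at_within)
      (rule vector_diff_chain_at[OF inf_diff_vector_derivative(1)[OF \<phi>(1)] G, unfolded o_def])
  moreover have "G (\<phi> (2 * pi)) - G (\<phi> 0) = c"
    using \<phi>(2)[of 0] c[of "\<phi> 0"] by simp
  moreover have "((\<lambda>t. g (pt t)) has_integral G (2 * pi) - G 0) {0..2 * pi}"
    by (rule fundamental_theorem_of_calculus, simp, rule has_vector_derivative_at_within) (rule G)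
  moreover have "G (2 * pi) - G 0 = c" using c[of 0] by simp
  ultimately show ?thesis by (metis integral_unique)
qed

text \<open>
  The subtracted mean contributes a multiple of the mean of a derivative, which vanishes; the rest is
  substitution along the lift.
\<close>

lemma pullback_symplectic:
  assumes \<eta>: "\<eta> \<in> carrier Diff_S1"
  shows "symplectic (pullback \<eta>)"
proof (intro ballI)
  fix u v assume u: "u \<in> H_S1" and v: "v \<in> H_S1"
  obtain \<phi> where \<phi>: "inf_diff \<phi>" "\<And>t. \<eta> (pt t) = pt (\<phi> t)" "\<And>t. \<phi> (t + 2 * pi) = \<phi> t + 2 * pi"
    using diffeo_lift[OF \<eta>] by metis
  let ?v = "\<lambda>z. v (\<eta> z)" and ?u = "\<lambda>z. u (\<eta> z)"
  have su: "smooth_circle_fun ?u" and sv: "smooth_circle_fun ?v"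
    using smooth_compose_Diff[OF \<eta>] H_S1_smooth u v by auto
  have dv: "cderiv (pullback \<eta> v) (pt t) = vector_derivative \<phi> (at t) *\<^sub>R cderiv v (pt (\<phi> t))" for t
  proof (rule cderiv_pt_eqI)
    have "((\<lambda>t. v (pt (\<phi> t))) has_vector_derivative vector_derivative \<phi> (at t) *\<^sub>R cderiv v (pt (\<phi> t))) (at t)"
      using vector_diff_chain_at[OF inf_diff_vector_derivative(1)[OF \<phi>(1)] smooth_circle_fun_cderiv(1)[OF H_S1_smooth[OF v]]]
      by (simp add: o_def)
    from has_vector_derivative_diff[OF this has_vector_derivative_const]
    show "((\<lambda>t. pullback \<eta> v (pt t)) has_vector_derivative vector_derivative \<phi> (at t) *\<^sub>R cderiv v (pt (\<phi> t))) (at t)"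
      by (simp add: pullback_def \<phi>(2))
  qed
  have pv: "smooth_circle_fun (pullback \<eta> v)" by (rule H_S1_smooth[OF pullback_H_S1[OF \<eta> v]])
  have cd: "circle_cont (cderiv (pullback \<eta> v))"
    by (rule smooth_imp_circle_cont[OF smooth_circle_fun_cderiv(2)[OF pv]])
  have cg: "circle_cont (\<lambda>z. u z * cderiv v z)"
    by (rule circle_cont_mult[OF H_S1_cont[OF u] smooth_imp_circle_cont[OF smooth_circle_fun_cderiv(2)[OF H_S1_smooth[OF v]]]])
  have "omega (pullback \<eta> u) (pullback \<eta> v) =
      mean (\<lambda>z. ?u z * cderiv (pullback \<eta> v) z - mean ?u * cderiv (pullback \<eta> v) z)"
    unfolding omega_eq_mean[OF pv] by (simp add: pullback_def[of \<eta> u] left_diff_distrib)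
  also have "\<dots> = mean (\<lambda>z. ?u z * cderiv (pullback \<eta> v) z)"
    using mean_diff[OF circle_cont_mult[OF smooth_imp_circle_cont[OF su] cd] circle_cont_mult[OF continuous_on_const cd]]
      mean_cderiv[OF pv] by simp
  also have "\<dots> = 1 / (2 * of_real pi) * integral {0..2 * pi} (\<lambda>t. vector_derivative \<phi> (at t) *\<^sub>R (u (pt (\<phi> t)) * cderiv v (pt (\<phi> t))))"
    unfolding mean_def dv \<phi>(2) by simp
  also have "\<dots> = omega u v"
    unfolding integral_circle_substitution[OF cg \<phi>(1,3)] omega_eq_mean[OF H_S1_smooth[OF v]] mean_def ..
  finally show "omega (pullback \<eta> u) (pullback \<eta> v) = omega u v" .
qed

text \<open>
  Composition does not increase the supremum norm, so the Fourier coefficients of the images of the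
  partial sums converge to those of the image of \<open>u\<close>. The bound for trigonometric polynomials passes
  to the limit on every finite set of frequencies.
\<close>

lemma pullback_bounded:
  assumes \<eta>: "\<eta> \<in> carrier Diff_S1" and HS: "HS_bounded (pullback \<eta>)"
  shows "bounded_on_H (pullback \<eta>)"
proof -
  have lin: "H_linear (pullback \<eta>)" by (rule pullback_H_linear[OF \<eta>])
  obtain K where K: "K \<ge> 0" "\<And>a N. a 0 = 0 \<Longrightarrow>
      (norm_omega (pullback \<eta> (trig_partial a N)))\<^sup>2 \<le> K * (norm_omega (trig_partial a N))\<^sup>2"
    using HS_bounded_imp_bounded_trig_partial[OF lin pullback_real pullback_symplectic[OF \<eta>] HS] by metis
  have "(norm_omega (pullback \<eta> u))\<^sup>2 \<le> K * (norm_omega u)\<^sup>2" if u: "u \<in> H_S1" for u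
  proof -
    let ?t = "trig_partial (fourier u)"
    have t: "?t N \<in> H_S1" for N by (rule H_S1_trig_partial[of "fourier u", OF H_S1_fourier_0[OF u]])
    have du: "(\<lambda>z. u z - ?t N z) \<in> H_S1" for N by (rule H_S1_diff[OF u t])
    obtain \<epsilon> where \<epsilon>: "\<epsilon> \<longlonglongrightarrow> 0" "\<And>N z. norm (u z - ?t N z) \<le> \<epsilon> N"
      using smooth_fourier_uniform[OF H_S1_smooth[OF u]] by metis
    have lim: "(\<lambda>N. fourier (pullback \<eta> (?t N)) m) \<longlonglongrightarrow> fourier (pullback \<eta> u) m" for m
    proof (cases "m = 0")
      case True
      then show ?thesis using H_S1_fourier_0[OF pullback_H_S1[OF \<eta> t]] H_S1_fourier_0[OF pullback_H_S1[OF \<eta> u]] by simp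
    next
      case False
      have "norm (fourier (pullback \<eta> u) m - fourier (pullback \<eta> (?t N)) m) \<le> \<epsilon> N" for N
      proof -
        have "fourier (pullback \<eta> u) m - fourier (pullback \<eta> (?t N)) m =
            fourier (pullback \<eta> (\<lambda>z. u z - ?t N z)) m"
          by (simp only: H_linear_diff[OF lin u t]
              fourier_diff[OF H_S1_cont[OF pullback_H_S1[OF \<eta> u]] H_S1_cont[OF pullback_H_S1[OF \<eta> t]]])
        also have "\<dots> = fourier (\<lambda>z. u (\<eta> z) - ?t N (\<eta> z)) m"
          by (rule fourier_pullback[OF \<eta> H_S1_smooth[OF du] False])
        also have "norm \<dots> \<le> \<epsilon> N"
          by (rule norm_fourier_le[OF smooth_imp_circle_cont[OF smooth_compose_Diff[OF \<eta> H_S1_smooth[OF du]]] \<epsilon>(2)])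
        finally show ?thesis .
      qed
      then have "(\<lambda>N. fourier (pullback \<eta> u) m - fourier (pullback \<eta> (?t N)) m) \<longlonglongrightarrow> 0"
        using \<epsilon>(1) by (rule Lim_null_comparison[OF always_eventually[OF allI]])
      from tendsto_diff[OF tendsto_const[of "fourier (pullback \<eta> u) m"] this] show ?thesis by simp
    qed
    have "sum (energy_density (fourier (pullback \<eta> u))) {- int M..int M} \<le> K * (norm_omega u)\<^sup>2" for M
    proof (rule LIMSEQ_le_const2)
      show "(\<lambda>N. sum (energy_density (fourier (pullback \<eta> (?t N)))) {- int M..int M}) \<longlonglongrightarrow>
          sum (energy_density (fourier (pullback \<eta> u))) {- int M..int M}"
        by (intro tendsto_sum tendsto_mult tendsto_const tendsto_power tendsto_norm lim)
      have "sum (energy_density (fourier (pullback \<eta> (?t N)))) {- int M..int M} \<le> K * (norm_omega u)\<^sup>2" for N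
      proof -
        have "sum (energy_density (fourier (pullback \<eta> (?t N)))) {- int M..int M} \<le> (norm_omega (pullback \<eta> (?t N)))\<^sup>2"
          by (rule norm_omega_sum_le[OF pullback_H_S1[OF \<eta> t]]) simp
        also have "\<dots> \<le> K * (norm_omega (?t N))\<^sup>2" by (rule K(2)[of "fourier u", OF H_S1_fourier_0[OF u]])
        also have "\<dots> \<le> K * (norm_omega u)\<^sup>2"
          using norm_omega_trig_partial_le[OF fourier_in_H_omega[OF u], of N] K(1)
          by (intro mult_left_mono) (simp_all add: norm_omega_def)
        finally show ?thesis .
      qed
      then show "\<exists>N. \<forall>n\<ge>N. sum (energy_density (fourier (pullback \<eta> (?t n)))) {- int M..int M} \<le> K * (norm_omega u)\<^sup>2"
        by blast
    qed
    then show ?thesis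
      unfolding norm_omega_def[of "pullback \<eta> u"]
      by (rule H_omegaI(2)) (rule H_S1_fourier_0[OF pullback_H_S1[OF \<eta> u]])
  qed
  then show ?thesis unfolding bounded_on_H_iff using K(1) by blast
qed

section \<open>Non-stationary phase\<close>

lemma vector_derivative_periodic:
  fixes f :: "real \<Rightarrow> 'a::real_normed_vector"
  assumes "inf_diff f" "\<And>t. f (t + c) = f t + d"
  shows "vector_derivative f (at (t + c)) = vector_derivative f (at t)"
proof -
  have "((\<lambda>t. t + c) has_vector_derivative 1) (at t)" by (auto intro!: derivative_eq_intros)
  from vector_diff_chain_at[OF this inf_diff_vector_derivative(1)[OF assms(1)]]
  have "((\<lambda>t. f (t + c)) has_vector_derivative vector_derivative f (at (t + c))) (at t)"
    by (simp add: o_def)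
  moreover have "((\<lambda>t. f t + d) has_vector_derivative vector_derivative f (at t)) (at t)"
    using has_vector_derivative_add[OF inf_diff_vector_derivative(1)[OF assms(1), of t] has_vector_derivative_const[of d]] by simp
  ultimately show ?thesis unfolding assms(2) using vector_derivative_unique_at by blast
qed

lemma continuous_on_interval_abs_bounded:
  fixes f :: "real \<Rightarrow> real"
  assumes "continuous_on {a..b} f"
  obtains B where "B > 0" "\<And>t. t \<in> {a..b} \<Longrightarrow> \<bar>f t\<bar> \<le> B"
proof -
  have "bounded (f ` {a..b})" by (rule compact_imp_bounded[OF compact_continuous_image[OF assms]]) simp
  then obtain B where "B > 0" "\<And>x. x \<in> f ` {a..b} \<Longrightarrow> norm x \<le> B" unfolding bounded_pos by blast
  then show ?thesis using that by (metis imageI real_norm_def)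
qed

text \<open>
  For \<open>k < 0 < m\<close> the phase has derivative \<open>p = k \<phi>' - m\<close>, which is at most \<open>- c (m - k)\<close> for
  \<open>c = min 1 (min \<phi>')\<close>. Each integration by parts gains a factor \<open>1 / p\<close>; boundary terms cancel by
  periodicity.
\<close>

lemma nonstationary_phase:
  assumes \<phi>: "inf_diff \<phi>" "\<And>t. \<phi> (t + 2 * pi) = \<phi> t + 2 * pi" "\<And>t. vector_derivative \<phi> (at t) > 0"
  obtains C where "C \<ge> 0"
    "\<And>k m. k < 0 \<Longrightarrow> m > 0 \<Longrightarrow>
       cmod (integral {0..2 * pi} (\<lambda>t. cis (of_int k * \<phi> t - of_int m * t))) \<le> C / (of_int (m - k))\<^sup>2"
proof -
  define \<phi>1 where "\<phi>1 t = vector_derivative \<phi> (at t)" for t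
  define \<phi>2 where "\<phi>2 t = vector_derivative \<phi>1 (at t)" for t
  define \<phi>3 where "\<phi>3 t = vector_derivative \<phi>2 (at t)" for t
  have s1: "inf_diff \<phi>1" unfolding \<phi>1_def by (rule inf_diff_vector_derivative(2)[OF \<phi>(1)])
  have s2: "inf_diff \<phi>2" unfolding \<phi>2_def by (rule inf_diff_vector_derivative(2)[OF s1])
  have s3: "inf_diff \<phi>3" unfolding \<phi>3_def by (rule inf_diff_vector_derivative(2)[OF s2])
  have d0: "(\<phi> has_real_derivative \<phi>1 t) (at t)" for t
    using inf_diff_vector_derivative(1)[OF \<phi>(1)] by (simp add: \<phi>1_def has_real_derivative_iff_has_vector_derivative)
  have d1: "(\<phi>1 has_real_derivative \<phi>2 t) (at t)" for t
    using inf_diff_vector_derivative(1)[OF s1] by (simp add: \<phi>2_def has_real_derivative_iff_has_vector_derivative)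
  have d2: "(\<phi>2 has_real_derivative \<phi>3 t) (at t)" for t
    using inf_diff_vector_derivative(1)[OF s2] by (simp add: \<phi>3_def has_real_derivative_iff_has_vector_derivative)
  have per1: "\<phi>1 (t + 2 * pi) = \<phi>1 t" for t
    unfolding \<phi>1_def by (rule vector_derivative_periodic[OF \<phi>(1,2)])
  have per2: "\<phi>2 (t + 2 * pi) = \<phi>2 t" for t
    unfolding \<phi>2_def by (rule vector_derivative_periodic[OF s1, of _ 0]) (simp add: per1)
  obtain B where B: "B > 0" "\<And>t. t \<in> {0..2 * pi} \<Longrightarrow> \<bar>\<phi>2 t\<bar> \<le> B"
    using continuous_on_interval_abs_bounded[OF inf_diff_continuous[OF s2]] by metis
  obtain D where D: "D > 0" "\<And>t. t \<in> {0..2 * pi} \<Longrightarrow> \<bar>\<phi>3 t\<bar> \<le> D"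
    using continuous_on_interval_abs_bounded[OF inf_diff_continuous[OF s3]] by metis
  obtain t0 where t0: "t0 \<in> {0..2 * pi}" "\<And>t. t \<in> {0..2 * pi} \<Longrightarrow> \<phi>1 t0 \<le> \<phi>1 t"
    using continuous_attains_inf[of "{0..2 * pi}" \<phi>1] inf_diff_continuous[OF s1] by fastforce
  define c where "c = min 1 (\<phi>1 t0)"
  have c: "c > 0" "c \<le> 1" "\<And>t. t \<in> {0..2 * pi} \<Longrightarrow> c \<le> \<phi>1 t"
    using \<phi>(3)[of t0] min.coboundedI2[OF t0(2)] unfolding c_def \<phi>1_def by auto
  define C where "C = 2 * pi * (D / c ^ 3 + 3 * B\<^sup>2 / c ^ 4)"
  have "cmod (integral {0..2 * pi} (\<lambda>t. cis (of_int k * \<phi> t - of_int m * t))) \<le> C / (of_int (m - k))\<^sup>2"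
    if k: "k < 0" and m: "m > 0" for k m :: int
  proof -
    define S where "S = real_of_int (m - k)"
    define \<theta> where "\<theta> t = of_int k * \<phi> t - of_int m * t" for t
    define p where "p t = of_int k * \<phi>1 t - of_int m" for t
    have S: "S > 0" "\<bar>real_of_int k\<bar> \<le> S" using k m by (auto simp: S_def)
    have p_neg: "p t < 0" for t
    proof -
      have "of_int k * \<phi>1 t < 0" using k \<phi>(3)[of t] by (simp add: \<phi>1_def mult_neg_pos)
      then show ?thesis using m by (simp add: p_def)
    qed
    have p_le: "p t \<le> - (c * S)" if "t \<in> {0..2 * pi}" for t
    proof -
      have "of_int k * \<phi>1 t \<le> of_int k * c" using k c(3)[OF that] by (intro mult_left_mono_neg) auto
      moreover have "of_int m * c \<le> of_int m * 1" using m c(2) by (intro mult_left_mono) auto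
      ultimately show ?thesis by (simp add: p_def S_def algebra_simps)
    qed
    \<comment> \<open>Chosen so that \<open>p * q\<close> equals the derivative of \<open>1 / p\<close>.\<close>
    define q where "q t = - (of_int k * \<phi>2 t) / p t ^ 3" for t
    define q' where "q' t = - (of_int k * \<phi>3 t) / p t ^ 3 + 3 * (of_int k * \<phi>2 t)\<^sup>2 / p t ^ 4" for t
    have dp: "(p has_real_derivative of_int k * \<phi>2 t) (at t)" for t
      unfolding p_def by (auto intro!: derivative_eq_intros d1)
    have d\<theta>: "(\<theta> has_real_derivative p t) (at t)" for t
      unfolding \<theta>_def p_def by (auto intro!: derivative_eq_intros d0)
    have dq: "(q has_real_derivative q' t) (at t)" for t
    proof -
      have n: "((\<lambda>t. - (of_int k * \<phi>2 t)) has_real_derivative - (of_int k * \<phi>3 t)) (at t)"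
        by (auto intro!: derivative_eq_intros d2)
      have e: "((\<lambda>t. p t ^ 3) has_real_derivative 3 * (p t)\<^sup>2 * (of_int k * \<phi>2 t)) (at t)"
        by (auto intro!: derivative_eq_intros dp)
      have "p t \<noteq> 0" using p_neg[of t] by simp
      then have "(- (of_int k * \<phi>3 t) * p t ^ 3 - - (of_int k * \<phi>2 t) * (3 * (p t)\<^sup>2 * (of_int k * \<phi>2 t))) /
          (p t ^ 3 * p t ^ 3) = q' t"
        unfolding q'_def by (simp add: divide_simps) (simp add: power2_eq_square eval_nat_numeral algebra_simps)
      then show ?thesis
        unfolding q_def using DERIV_divide[OF n e] \<open>p t \<noteq> 0\<close> by simp
    qed
    have dr: "((\<lambda>t. 1 / p t) has_real_derivative - (of_int k * \<phi>2 t) / (p t)\<^sup>2) (at t)" for t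
      using DERIV_divide[OF DERIV_const[of 1] dp] p_neg[of t] by (simp add: power2_eq_square)
    \<comment> \<open>Two integrations by parts at once: the derivative of \<open>F\<close> is the integrand up to the factor \<open>1 + q'\<close>.\<close>
    define F where "F t = cis (\<theta> t) * (of_real (q t) - \<i> * of_real (1 / p t))" for t
    have dF: "(F has_vector_derivative cis (\<theta> t) * (1 + of_real (q' t))) (at t)" for t
    proof -
      have e: "((\<lambda>t. cis (\<theta> t)) has_vector_derivative p t *\<^sub>R (\<i> * cis (\<theta> t))) (at t)"
        using vector_diff_chain_at[OF d\<theta>[unfolded has_real_derivative_iff_has_vector_derivative] has_vector_derivative_cis]
        by (simp add: o_def)
      have "((\<lambda>t. of_real (q t) - \<i> * of_real (1 / p t)) has_vector_derivative
          of_real (q' t) - \<i> * of_real (- (of_int k * \<phi>2 t) / (p t)\<^sup>2)) (at t)"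
        by (intro has_vector_derivative_diff has_vector_derivative_mult_right has_vector_derivative_of_real
            dq dr)
      from has_vector_derivative_mult[OF e this]
      have "(F has_vector_derivative cis (\<theta> t) * (of_real (q' t) - \<i> * of_real (- (of_int k * \<phi>2 t) / (p t)\<^sup>2)) +
          p t *\<^sub>R (\<i> * cis (\<theta> t)) * (of_real (q t) - \<i> * of_real (1 / p t))) (at t)"
        unfolding F_def .
      moreover have "cis (\<theta> t) * (of_real (q' t) - \<i> * of_real (- (of_int k * \<phi>2 t) / (p t)\<^sup>2)) +
          p t *\<^sub>R (\<i> * cis (\<theta> t)) * (of_real (q t) - \<i> * of_real (1 / p t)) =
          cis (\<theta> t) * (1 + of_real (q' t))"
      proof -
        have 1: "p t * q t = - (of_int k * \<phi>2 t) / (p t)\<^sup>2"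
          using p_neg[of t] by (simp add: q_def field_simps power2_eq_square eval_nat_numeral)
        have 2: "p t * (1 / p t) = 1" using p_neg[of t] by simp
        have "of_real (q' t) - \<i> * of_real (- (of_int k * \<phi>2 t) / (p t)\<^sup>2) +
            of_real (p t) * \<i> * (of_real (q t) - \<i> * of_real (1 / p t)) =
            of_real (q' t) - \<i> * of_real (- (of_int k * \<phi>2 t) / (p t)\<^sup>2) + \<i> * of_real (p t * q t) + of_real (p t * (1 / p t))"
          by (simp only: right_diff_distrib of_real_mult) (simp add: mult_ac)
        also have "\<dots> = 1 + of_real (q' t)" unfolding 1 2 by simp
        finally have "cis (\<theta> t) * (of_real (q' t) - \<i> * of_real (- (of_int k * \<phi>2 t) / (p t)\<^sup>2) +
            of_real (p t) * \<i> * (of_real (q t) - \<i> * of_real (1 / p t))) = cis (\<theta> t) * (1 + of_real (q' t))" by simp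
        then show ?thesis by (simp only: scaleR_conv_of_real distrib_left mult.assoc mult.left_commute mult.commute)
      qed
      ultimately show ?thesis by simp
    qed
    have "F (2 * pi) = F 0"
    proof -
      have "\<theta> (2 * pi) = \<theta> 0 + 2 * pi * of_int (k - m)"
        using \<phi>(2)[of 0] by (simp add: \<theta>_def algebra_simps)
      then have "cis (\<theta> (2 * pi)) = cis (\<theta> 0)" unfolding cis_eq_iff by blast
      then show ?thesis using per1[of 0] per2[of 0] by (simp add: F_def q_def p_def)
    qed
    then have iF: "((\<lambda>t. cis (\<theta> t) * (1 + of_real (q' t))) has_integral 0) {0..2 * pi}"
      using fundamental_theorem_of_calculus[of 0 "2 * pi" F "\<lambda>t. cis (\<theta> t) * (1 + of_real (q' t))"]
        has_vector_derivative_at_within[OF dF] by simp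
    have c\<theta>: "continuous_on {0..2 * pi} (\<lambda>t. cis (\<theta> t))"
      using d\<theta> by (intro continuous_on_compose2[OF continuous_on_cis[OF continuous_on_id], of _ \<theta>] DERIV_continuous_on) (auto intro: has_field_derivative_at_within)
    have ig: "(\<lambda>t. cis (\<theta> t)) integrable_on {0..2 * pi}" by (rule integrable_continuous_real[OF c\<theta>])
    have "((\<lambda>t. cis (\<theta> t) * (1 + of_real (q' t)) - cis (\<theta> t)) has_integral 0 - integral {0..2 * pi} (\<lambda>t. cis (\<theta> t))) {0..2 * pi}"
      by (rule has_integral_diff[OF iF integrable_integral[OF ig]])
    then have iq: "((\<lambda>t. cis (\<theta> t) * of_real (q' t)) has_integral - integral {0..2 * pi} (\<lambda>t. cis (\<theta> t))) {0..2 * pi}"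
      by (simp add: distrib_left)
    have q'_bound: "\<bar>q' t\<bar> \<le> (D / c ^ 3 + 3 * B\<^sup>2 / c ^ 4) / S\<^sup>2" if t: "t \<in> {0..2 * pi}" for t
    proof -
      have cS: "c * S > 0" using c S by simp
      have pa: "c * S \<le> \<bar>p t\<bar>" using p_le[OF t] cS by linarith
      have "\<bar>of_int k * \<phi>3 t\<bar> \<le> S * D" unfolding abs_mult using S D(2)[OF t] by (intro mult_mono) auto
      then have 1: "\<bar>of_int k * \<phi>3 t / p t ^ 3\<bar> \<le> S * D / (c * S) ^ 3"
        unfolding abs_divide power_abs using pa cS S D(1) by (intro frac_le power_mono) auto
      have "\<bar>of_int k * \<phi>2 t\<bar> \<le> S * B" unfolding abs_mult using S B(2)[OF t] by (intro mult_mono) auto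
      then have "(of_int k * \<phi>2 t)\<^sup>2 \<le> (S * B)\<^sup>2" by (metis abs_ge_zero power2_abs power_mono)
      then have 2: "\<bar>3 * (of_int k * \<phi>2 t)\<^sup>2 / p t ^ 4\<bar> \<le> 3 * (S * B)\<^sup>2 / (c * S) ^ 4"
        unfolding abs_divide power_abs using pa cS S B(1) by (intro frac_le power_mono) auto
      have "\<bar>q' t\<bar> \<le> S * D / (c * S) ^ 3 + 3 * (S * B)\<^sup>2 / (c * S) ^ 4"
      proof -
        have "q' t = - (of_int k * \<phi>3 t / p t ^ 3) + 3 * (of_int k * \<phi>2 t)\<^sup>2 / p t ^ 4" by (simp add: q'_def)
        then show ?thesis using 1 2 by linarith
      qed
      also have "\<dots> = (D / c ^ 3 + 3 * B\<^sup>2 / c ^ 4) / S\<^sup>2"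
        using S c by (simp add: field_simps eval_nat_numeral)
      finally show ?thesis .
    qed
    have iq': "((\<lambda>t. cis (\<theta> t) * of_real (q' t)) has_integral - integral {0..2 * pi} (\<lambda>t. cis (\<theta> t))) (cbox 0 (2 * pi))"
      using iq by simp
    have "cmod (- integral {0..2 * pi} (\<lambda>t. cis (\<theta> t))) \<le> (D / c ^ 3 + 3 * B\<^sup>2 / c ^ 4) / S\<^sup>2 * measure lborel (cbox 0 (2 * pi))"
      by (rule has_integral_bound[OF _ iq'])
        (use q'_bound c B D in \<open>auto simp: norm_mult\<close>)
    then show ?thesis by (simp add: C_def S_def \<theta>_def mult_ac)
  qed
  moreover have "C \<ge> 0" using c B D by (simp add: C_def)
  ultimately show ?thesis using that by blast
qed

lemma matrix_entry_pullback:
  assumes \<eta>: "\<eta> \<in> carrier Diff_S1" "\<And>t. \<eta> (pt t) = pt (\<phi> t)" and m: "m \<noteq> 0"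
  shows "matrix_entry (pullback \<eta>) m k =
    1 / (2 * of_real pi) * integral {0..2 * pi} (\<lambda>t. cis (of_int k * \<phi> t - of_int m * t))"
  unfolding matrix_entry_def fourier_pullback[OF \<eta>(1) smooth_circle_fun_chi m]
  by (simp add: fourier_def \<eta>(2) cis_mult)

text \<open>
  Writing \<open>S = m - k\<close>, one has \<open>m / (\<bar>k\<bar> S\<^sup>4) \<le> 1 / (k\<^sup>2 m\<^sup>2)\<close> because \<open>\<bar>k\<bar>\<close> and \<open>m\<close> are at most \<open>S\<close>.
  So the weighted square of the bound \<open>C / S\<^sup>2\<close> is dominated by a product of convergent series.
\<close>

lemma pullback_HS_bounded:
  assumes \<eta>: "\<eta> \<in> carrier Diff_S1"
  shows "HS_bounded (pullback \<eta>)"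
proof -
  obtain \<phi> where \<phi>: "inf_diff \<phi>" "\<And>t. \<eta> (pt t) = pt (\<phi> t)" "\<And>t. \<phi> (t + 2 * pi) = \<phi> t + 2 * pi"
    "\<And>t. vector_derivative \<phi> (at t) > 0"
    using diffeo_lift[OF \<eta>] by metis
  obtain C where C: "C \<ge> 0" "\<And>k m. k < 0 \<Longrightarrow> m > 0 \<Longrightarrow>
      cmod (integral {0..2 * pi} (\<lambda>t. cis (of_int k * \<phi> t - of_int m * t))) \<le> C / (of_int (m - k))\<^sup>2"
    using nonstationary_phase[OF \<phi>(1,3,4)] by metis
  define z where "z n = 1 / (real_of_int n)\<^sup>2" for n
  have "z summable_on UNIV" using summable_on_int_inverse_square by (simp add: z_def[abs_def])
  then have z: "sum z F \<le> infsum z UNIV" if "finite F" for F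
    using that by (intro finite_sum_le_infsum) (auto simp: z_def)
  have Z: "infsum z UNIV \<ge> 0" by (rule infsum_nonneg) (simp add: z_def)
  have term_le: "real_of_int \<bar>m\<bar> * (cmod (matrix_entry (pullback \<eta>) m k))\<^sup>2 / real_of_int \<bar>k\<bar> \<le> C\<^sup>2 * (z k * z m)"
    if k: "k < 0" and m: "m > 0" for k m :: int
  proof -
    define x y S where "x = real_of_int \<bar>k\<bar>" and "y = real_of_int \<bar>m\<bar>" and "S = real_of_int (m - k)"
    have xy: "x > 0" "y > 0" "x \<le> S" "y \<le> S" "S > 0" using k m by (auto simp: x_def y_def S_def)
    have "cmod (matrix_entry (pullback \<eta>) m k) =
        1 / (2 * pi) * cmod (integral {0..2 * pi} (\<lambda>t. cis (of_int k * \<phi> t - of_int m * t)))"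
      using m by (simp add: matrix_entry_pullback[OF \<eta> \<phi>(2)] norm_mult norm_divide)
    also have "\<dots> \<le> 1 * (C / S\<^sup>2)"
      unfolding S_def using pi_ge_two by (intro mult_mono C(2) k m) (auto simp: field_simps)
    finally have "(cmod (matrix_entry (pullback \<eta>) m k))\<^sup>2 \<le> (C / S\<^sup>2)\<^sup>2" by (intro power_mono) auto
    then have "y * (cmod (matrix_entry (pullback \<eta>) m k))\<^sup>2 / x \<le> y * (C / S\<^sup>2)\<^sup>2 / x"
      using xy by (intro divide_right_mono mult_left_mono) auto
    also have "\<dots> \<le> C\<^sup>2 * (1 / x\<^sup>2 * (1 / y\<^sup>2))"
    proof -
      have "x * y ^ 3 \<le> S * S ^ 3" using xy by (intro mult_mono power_mono) auto
      then have "y / (x * S ^ 4) \<le> 1 / (x\<^sup>2 * y\<^sup>2)"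
        using xy by (simp add: divide_simps) (simp add: eval_nat_numeral algebra_simps)
      then have "C\<^sup>2 * (y / (x * S ^ 4)) \<le> C\<^sup>2 * (1 / (x\<^sup>2 * y\<^sup>2))" by (rule mult_left_mono) simp
      then show ?thesis by (simp add: power_divide mult_ac flip: power_mult)
    qed
    finally show ?thesis by (simp add: x_def y_def z_def)
  qed
  have "block_sum (pullback \<eta>) P Q \<le> C\<^sup>2 * (infsum z UNIV * infsum z UNIV)"
    if P: "finite P" "P \<subseteq> {..<0}" and Q: "finite Q" "Q \<subseteq> {0<..}" for P Q
  proof -
    have "block_sum (pullback \<eta>) P Q \<le> (\<Sum>k\<in>P. \<Sum>m\<in>Q. C\<^sup>2 * (z k * z m))"
      unfolding block_sum_def sum_divide_distrib by (intro sum_mono term_le) (use P Q in auto)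
    also have "\<dots> = C\<^sup>2 * (sum z P * sum z Q)" by (subst sum_product) (simp only: sum_distrib_left)
    also have "\<dots> \<le> C\<^sup>2 * (infsum z UNIV * infsum z UNIV)"
      using P Q Z by (intro mult_left_mono mult_mono z sum_nonneg) (auto simp: z_def)
    finally show ?thesis .
  qed
  then show ?thesis unfolding HS_bounded_def by blast
qed

section \<open>The homomorphism\<close>

lemma pullback_id: "u \<in> H_S1 \<Longrightarrow> pullback id u = u"
  by (simp add: pullback_def H_S1_def)

lemma pullback_pullback:
  assumes "\<eta>\<^sub>1 \<in> carrier Diff_S1" "\<eta>\<^sub>2 \<in> carrier Diff_S1" "u \<in> H_S1"
  shows "pullback \<eta>\<^sub>1 (pullback \<eta>\<^sub>2 u) = pullback (\<eta>\<^sub>2 \<circ> \<eta>\<^sub>1) u"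
proof -
  have "circle_cont (\<lambda>z. u (\<eta>\<^sub>2 (\<eta>\<^sub>1 z)))"
    using smooth_imp_circle_cont[OF smooth_compose_Diff[OF Diff_S1_compose[OF assms(2,1)] H_S1_smooth[OF assms(3)]]]
    by simp
  then show ?thesis
    by (simp add: pullback_def mean_diff)
qed

lemma operator_properties_cong:
  assumes "\<forall>u\<in>H_S1. A u = B u"
  shows "H_linear B \<Longrightarrow> H_linear A" "bounded_on_H B \<Longrightarrow> bounded_on_H A"
    "real_op B \<Longrightarrow> real_op A" "symplectic B \<Longrightarrow> symplectic A" "HS_bounded B \<Longrightarrow> HS_bounded A"
proof -
  show "H_linear B \<Longrightarrow> H_linear A"
    unfolding H_linear_def linear_on_H_def using assms by (simp add: H_S1_add H_S1_cmult)
  show "bounded_on_H A" if b: "bounded_on_H B"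
  proof -
    obtain C where C: "\<forall>u\<in>H_S1. norm_omega (B u) \<le> C * norm_omega u"
      using b unfolding bounded_on_H_def by (rule exE)
    have "\<forall>u\<in>H_S1. norm_omega (A u) \<le> C * norm_omega u"
    proof
      fix u assume u: "u \<in> H_S1"
      show "norm_omega (A u) \<le> C * norm_omega u"
        unfolding bspec[OF assms u] by (rule bspec[OF C u])
    qed
    then show ?thesis unfolding bounded_on_H_def by (rule exI)
  qed
  show "real_op A" if r: "real_op B"
  proof
    fix u assume u: "u \<in> H_S1"
    have "conj_op A u = conj_op B u"
      unfolding conj_op_def bspec[OF assms H_S1_cnj[OF u]] ..
    then show "A u = conj_op A u"
      unfolding bspec[OF assms u] using bspec[OF r u] by (rule trans[OF _ sym, rotated])
  qed
  show "symplectic A" if sy: "symplectic B"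
  proof (intro ballI)
    fix u v assume u: "u \<in> H_S1" and v: "v \<in> H_S1"
    show "omega (A u) (A v) = omega u v"
      unfolding bspec[OF assms u] bspec[OF assms v] by (rule bspec[OF bspec[OF sy u] v])
  qed
  have "block_sum A P Q = block_sum B P Q" if "P \<subseteq> {..<0}" for P Q
    unfolding block_sum_def matrix_entry_def
    by (rule sum.cong[OF refl]) (use that in \<open>auto simp: assms H_S1_chi\<close>)
  then show "HS_bounded B \<Longrightarrow> HS_bounded A" unfolding HS_bounded_def by simp
qed

lemma Phi_in_Sp_infinity:
  assumes \<psi>: "\<psi> \<in> carrier Diff_S1"
  shows "Phi \<psi> \<in> carrier Sp_infinity"
proof -
  define \<eta> where "\<eta> = inv_into UNIV \<psi>"
  have \<eta>: "\<eta> \<in> carrier Diff_S1" unfolding \<eta>_def by (rule Diff_S1_inverse[OF \<psi>])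
  have b: "bij \<psi>" using \<psi> by (simp add: Diff_S1_carrier)
  have inv: "\<psi> \<circ> \<eta> = id" "\<eta> \<circ> \<psi> = id"
    unfolding \<eta>_def using surj_iff[of \<psi>] inj_iff[of \<psi>] b by (auto simp: bij_def)
  have Phi: "Phi \<psi> u = pullback \<eta> u" if "u \<in> H_S1" for u
    using that by (simp add: Phi_eq_pullback \<eta>_def)
  have "bij_betw (Phi \<psi>) H_S1 H_S1"
  proof (rule bij_betw_byWitness[where f' = "pullback \<psi>"])
    show "\<forall>u\<in>H_S1. pullback \<psi> (Phi \<psi> u) = u"
      by (simp add: Phi pullback_pullback[OF \<psi> \<eta>] inv pullback_id)
    show "\<forall>u\<in>H_S1. Phi \<psi> (pullback \<psi> u) = u"
      by (simp add: Phi pullback_H_S1[OF \<psi>] pullback_pullback[OF \<eta> \<psi>] inv pullback_id)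
    show "Phi \<psi> ` H_S1 \<subseteq> H_S1" by (auto simp: Phi pullback_H_S1[OF \<eta>])
    show "pullback \<psi> ` H_S1 \<subseteq> H_S1" by (auto simp: pullback_H_S1[OF \<psi>])
  qed
  then have bij: "Phi \<psi> \<in> Bij H_S1" by (simp add: Bij_def Phi_def)
  have "\<forall>u\<in>H_S1. Phi \<psi> u = pullback \<eta> u" using Phi by blast
  note cong = operator_properties_cong[OF this]
  note HS = pullback_HS_bounded[OF \<eta>]
  show ?thesis
    unfolding Sp_infinity_carrier
    by (intro conjI bij cong(1)[OF pullback_H_linear[OF \<eta>]] cong(2)[OF pullback_bounded[OF \<eta> HS]]
        cong(3)[OF pullback_real] cong(4)[OF pullback_symplectic[OF \<eta>]] cong(5)[OF HS])
qed

lemma Phi_compose: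
  assumes \<psi>: "\<psi>\<^sub>1 \<in> carrier Diff_S1" "\<psi>\<^sub>2 \<in> carrier Diff_S1"
  shows "Phi (\<psi>\<^sub>1 \<circ> \<psi>\<^sub>2) = compose H_S1 (Phi \<psi>\<^sub>1) (Phi \<psi>\<^sub>2)"
proof
  fix u
  have b: "bij \<psi>\<^sub>1" "bij \<psi>\<^sub>2" using \<psi> by (auto simp: Diff_S1_carrier)
  note i = Diff_S1_inverse[OF \<psi>(1)] Diff_S1_inverse[OF \<psi>(2)]
  show "Phi (\<psi>\<^sub>1 \<circ> \<psi>\<^sub>2) u = compose H_S1 (Phi \<psi>\<^sub>1) (Phi \<psi>\<^sub>2) u"
    using pullback_H_S1[OF i(2)] pullback_pullback[OF i(1,2)] o_inv_distrib[OF b]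
    by (simp add: Phi_eq_pullback compose_def)
qed

text \<open>
  The point of the circle opposite to the direction of \<open>c\<close> is moved out of the circle by subtracting \<open>c\<close>.
\<close>

lemma circle_translation_zero:
  assumes f: "surj f" and eq: "\<And>z. of_circle (g z) = of_circle (f z) - c"
  shows "c = 0"
proof (rule ccontr)
  assume "c \<noteq> 0"
  \<comment> \<open>The point of the circle at which subtracting \<open>c\<close> increases the modulus most.\<close>
  define w where "w = - c / of_real (cmod c)"
  have "cmod w = 1" using \<open>c \<noteq> 0\<close> by (simp add: w_def norm_divide)
  then have w: "of_circle (to_circle w) = w" by (simp add: to_circle_inverse)
  obtain z where z: "f z = to_circle w" using f by (metis surjD)
  have "w - c = w * of_real (1 + cmod c)" using \<open>c \<noteq> 0\<close> by (simp add: w_def field_simps)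
  then have "cmod (of_circle (g z)) = 1 + cmod c"
    using eq[of z] \<open>cmod w = 1\<close> by (simp only: z w norm_mult norm_of_real) simp
  then show False using \<open>c \<noteq> 0\<close> by simp
qed

text \<open>
  The images of \<open>chi 1\<close>, the coordinate function, determine the inverse diffeomorphisms up to a constant.
\<close>

lemma inj_on_Phi: "inj_on Phi (carrier Diff_S1)"
proof (rule inj_onI)
  fix \<psi>\<^sub>1 \<psi>\<^sub>2 assume \<psi>: "\<psi>\<^sub>1 \<in> carrier Diff_S1" "\<psi>\<^sub>2 \<in> carrier Diff_S1" and eq: "Phi \<psi>\<^sub>1 = Phi \<psi>\<^sub>2"
  let ?\<eta>1 = "inv_into UNIV \<psi>\<^sub>1" and ?\<eta>2 = "inv_into UNIV \<psi>\<^sub>2"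
  have b: "bij \<psi>\<^sub>1" "bij \<psi>\<^sub>2" using \<psi> by (auto simp: Diff_S1_carrier)
  define c where "c = mean (\<lambda>w. chi 1 (?\<eta>1 w)) - mean (\<lambda>w. chi 1 (?\<eta>2 w))"
  have pb: "pullback ?\<eta>1 (chi 1) = pullback ?\<eta>2 (chi 1)"
    using fun_cong[OF eq, of "chi 1"] H_S1_chi[of 1] by (simp add: Phi_eq_pullback)
  have chi1: "chi 1 z = of_circle z" for z by (simp add: chi_def)
  have e: "of_circle (?\<eta>2 z) = of_circle (?\<eta>1 z) - c" for z
  proof -
    have "of_circle (?\<eta>1 z) - mean (\<lambda>w. chi 1 (?\<eta>1 w)) = of_circle (?\<eta>2 z) - mean (\<lambda>w. chi 1 (?\<eta>2 w))"
      using fun_cong[OF pb, of z] unfolding pullback_def chi1[of "?\<eta>1 z"] chi1[of "?\<eta>2 z"] .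
    then show ?thesis unfolding c_def by (simp add: algebra_simps)
  qed
  have "c = 0" by (rule circle_translation_zero[OF bij_is_surj[OF bij_imp_bij_inv[OF b(1)]] e])
  then have "?\<eta>1 z = ?\<eta>2 z" for z using e[of z] by (intro circle_eqI) simp
  then have "?\<eta>1 = ?\<eta>2" by (rule ext)
  then show "\<psi>\<^sub>1 = \<psi>\<^sub>2" using b by (metis inv_inv_eq)
qed

text \<open>
  Testing \<open>Phi \<psi> = - id\<close> on \<open>chi 1\<close> forces the inverse of \<open>\<psi>\<close> to be the antipodal map, which leaves
  \<open>chi 2\<close> unchanged instead of negating it.
\<close>

lemma uminus_not_in_image_Phi:
  "(\<lambda>u\<in>H_S1. \<lambda>z. - 1 * u z) \<notin> Phi ` carrier Diff_S1"
proof
  assume "(\<lambda>u\<in>H_S1. \<lambda>z. - 1 * u z) \<in> Phi ` carrier Diff_S1"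
  then obtain \<psi> where \<psi>: "\<psi> \<in> carrier Diff_S1" and eq: "Phi \<psi> = (\<lambda>u\<in>H_S1. \<lambda>z. - 1 * u z)" by (metis imageE)
  let ?\<eta> = "inv_into UNIV \<psi>"
  have b: "bij ?\<eta>" using \<psi> by (auto simp: Diff_S1_carrier bij_imp_bij_inv)
  have pb: "chi k (?\<eta> z) - mean (\<lambda>w. chi k (?\<eta> w)) = - chi k z" if "k \<noteq> 0" for k z
    using fun_cong[OF fun_cong[OF eq, of "chi k"], of z] H_S1_chi[OF that] by (simp add: Phi_eq_pullback pullback_def)
  let ?m = "mean (\<lambda>w. chi 1 (?\<eta> w))"
  define g where "g z = to_circle (- of_circle z)" for z
  have g: "of_circle (g z) = of_circle (?\<eta> z) - ?m" for z
  proof -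
    have "of_circle (g z) = - of_circle z" unfolding g_def by (rule to_circle_inverse) simp
    then show ?thesis using pb[of 1 z] by (simp add: chi_def)
  qed
  have "?m = 0" by (rule circle_translation_zero[OF bij_is_surj[OF b] g])
  then have "of_circle (?\<eta> z) = - of_circle z" for z using pb[of 1 z] by (simp add: chi_def)
  then have sq: "chi 2 (?\<eta> z) = chi 2 z" for z by (simp add: chi_def)
  have "chi 2 z + chi 2 z = 0" for z
    using pb[of 2 z] mean_chi[of 2] by (simp add: sq)
  from this[of "pt 0"] show False by simp
qed

theorem theorem4p6:
  shows "(\<forall>\<psi> \<in> carrier Diff_S1. Phi \<psi> \<in> carrier Sp_infinity) \<and>
         group_hom Diff_S1 Sp_infinity Phi \<and>
         inj_on Phi (carrier Diff_S1) \<and>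
         Phi ` carrier Diff_S1 \<noteq> carrier Sp_infinity"
proof (intro conjI)
  show maps: "\<forall>\<psi> \<in> carrier Diff_S1. Phi \<psi> \<in> carrier Sp_infinity"
    by (rule ballI) (rule Phi_in_Sp_infinity)
  have "Phi (\<psi>\<^sub>1 \<otimes>\<^bsub>Diff_S1\<^esub> \<psi>\<^sub>2) = Phi \<psi>\<^sub>1 \<otimes>\<^bsub>Sp_infinity\<^esub> Phi \<psi>\<^sub>2"
    if "\<psi>\<^sub>1 \<in> carrier Diff_S1" "\<psi>\<^sub>2 \<in> carrier Diff_S1" for \<psi>\<^sub>1 \<psi>\<^sub>2
  proof -
    have "Phi \<psi>\<^sub>1 \<in> Bij H_S1" "Phi \<psi>\<^sub>2 \<in> Bij H_S1"
      using Phi_in_Sp_infinity that unfolding Sp_infinity_carrier by blast+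
    then show ?thesis
      using Phi_compose[OF that] by (simp add: Diff_S1_def Sp_infinity_def BijGroup_def)
  qed
  then have "Phi \<in> hom Diff_S1 Sp_infinity" using maps by (intro homI) auto
  then show "group_hom Diff_S1 Sp_infinity Phi"
    by (intro group_hom.intro group_Diff_S1 group_Sp_infinity group_hom_axioms.intro)
  show "inj_on Phi (carrier Diff_S1)" by (rule inj_on_Phi)
  show "Phi ` carrier Diff_S1 \<noteq> carrier Sp_infinity"
    using uminus_not_in_image_Phi scalar_in_Sp_infinity[of "- 1"] by metis
qed

end
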